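(* There exist universal constants $s\in\mathbb{N}$, $D\ge 1$ and $c>0$ such that for arbitrarily large $n\in\mathbb{N}$ there exists an $n$-point metric space $(M(n),d_{M(n)})$ with the following two properties. (1) $d_{M(n)}$ (viewed as a nonnegative kernel on $M(n)$) is $(s,D)$-sketchable. (2) For every $\varepsilon\in(0,\tfrac12)$ and every $\alpha\ge 1$, if there exists a mapping $f:M(n)\to\ell_{1-\varepsilon}$ such that $d_{M(n)}(x,y)\le \|f(x)-f(y)\|_{1-\varepsilon}\le \alpha\, d_{M(n)}(x,y)$ for all $x,y\in M(n)$, then $$\alpha\ \ge\ c\,(\log\log n)^{\frac{1-2\varepsilon}{2(1-\varepsilon)}}.$$
   Context: A nonnegative kernel on a set $X$ is a function $K:X\times X\to[0,\infty)$ with $K(x,y)=K(y,x)$. Given $s\in\mathbb{N}$ and $D\ge1$, $K$ is called $(s,D)$-sketchable if for every $r>0$ there exist a mapping $\mathsf{R}=\mathsf{R}_r:\{0,1\}^s\times\{0,1\}^s\to\{0,1\}$ and a probability distribution over mappings $\mathsf{Sk}=\mathsf{Sk}_r:X\to\{0,1\}^s$ such that for all $x,y\in X$ with $K(x,y)\le r$ one has $\mathbf{Prob}[\mathsf{R}(\mathsf{Sk}(x),\mathsf{Sk}(y))=0]\ge \tfrac35$, and for all $x,y\in X$ with $K(x,y)>Dr$ one has $\mathbf{Prob}[\mathsf{R}(\mathsf{Sk}(x),\mathsf{Sk}(y))=1]\ge\tfrac35$. For $p=1-\varepsilon\in(0,1)$, $\ell_{1-\varepsilon}$ is the space of real sequences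 $\varphi$ with $\|\varphi\|_{1-\varepsilon}=\big(\sum_i|\varphi_i|^{1-\varepsilon}\big)^{1/(1-\varepsilon)}<\infty$ (a quasi-norm). *)

theory Defs
  imports "HOL-Probability.Probability"
begin

definition nonnegative_kernel :: "'a set \<Rightarrow> ('a \<Rightarrow> 'a \<Rightarrow> real) \<Rightarrow> bool" where
  "nonnegative_kernel X K \<longleftrightarrow> (\<forall>x\<in>X. \<forall>y\<in>X. 0 \<le> K x y \<and> K x y = K y x)"

text \<open>Bits are Booleans, with \<^const>\<open>False\<close> standing for 0 and \<^const>\<open>True\<close> for 1.\<close>

definition bit_strings :: "nat \<Rightarrow> bool list set" where
  "bit_strings s = {b. length b = s}"

text \<open>
  A probability distribution over mappings from \<open>X\<close> to the \<open>s\<close>-bit strings is a probability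
  measure on the product \<open>\<sigma>\<close>-algebra, whose space consists of the mappings that are extensional
  outside \<open>X\<close>. When \<open>X\<close> is finite, every set of such mappings is an event. The values of \<open>R\<close>
  outside \<open>bit_strings s\<close> are irrelevant.
\<close>

definition sketchable :: "nat \<Rightarrow> real \<Rightarrow> 'a set \<Rightarrow> ('a \<Rightarrow> 'a \<Rightarrow> real) \<Rightarrow> bool" where
  "sketchable s D X K \<longleftrightarrow>
     nonnegative_kernel X K \<and> 1 \<le> D \<and>
     (\<forall>r>0. \<exists>(R :: bool list \<Rightarrow> bool list \<Rightarrow> bool) (P :: ('a \<Rightarrow> bool list) measure).
        prob_space P \<and>
        sets P = sets (Pi\<^sub>M X (\<lambda>_. count_space (bit_strings s))) \<and>
        (\<forall>x\<in>X. \<forall>y\<in>X. K x y \<le> r \<longrightarrow>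
           measure P {Sk \<in> space P. R (Sk x) (Sk y) = False} \<ge> 3 / 5) \<and>
        (\<forall>x\<in>X. \<forall>y\<in>X. K x y > D * r \<longrightarrow>
           measure P {Sk \<in> space P. R (Sk x) (Sk y) = True} \<ge> 3 / 5))"

definition ell :: "real \<Rightarrow> (nat \<Rightarrow> real) set" where
  "ell p = {\<phi>. summable (\<lambda>i. \<bar>\<phi> i\<bar> powr p)}"

definition ell_qnorm :: "real \<Rightarrow> (nat \<Rightarrow> real) \<Rightarrow> real" where
  "ell_qnorm p \<phi> = (\<Sum>i. \<bar>\<phi> i\<bar> powr p) powr (1 / p)"

end

(*
  Let Z_m act on the cube {-1,1}^(m x L) by cyclic shifts of the first coordinate, where
  m = exp(Theta(l^2)) and L = m^10. The space consists of the orbits of those points all of whose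
  nontrivial autocorrelations are small, with the quotient Hamming metric.

  Sketching: the third tensor powers of the shifts of a good point are nearly orthonormal, so their
  sum is an integer vector, and squared Euclidean distances between these vectors are proportional
  to the metric up to constants. Random signs and a random threshold turn Euclidean distance into
  the probability of a cut; the parity of many cuts amplifies it at every scale.

  Nonembeddability: let f be the indicator of a shift-invariant set of measure mu <= 1/2 and let rho = cos t,
  t = pi/(2l). It is shown that f changes under rho-correlated noise with probability at least a constant times
  mu/l. If s is this probability, the part g of f of degree at most l^2 is within s of f in
  squared L2. For independent X and Y, the vectors cos(jt)X + sin(jt)Y, 0 <= j <= l, lead from X to Y.
  By invariance g has small influences, so by Bonami's inequality and a Lindeberg
  replacement sin(pi g)^2 has nearly the same mean at each of these vectors as at X, namely O(s).
  Hence (1 - cos(pi g))/2 moves by O(s) in each of the l steps, whereas f(X) and f(Y) are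
  independent. Noise moves a point by a 1/l^2 fraction of the diameter, and |a - b|^p is a
  superposition of cuts, so an embedding into l_p has distortion alpha with
  alpha^p >= c l^(2p-1).
*)

theory Submission
  imports Defs
begin

section \<open>Polynomials on the discrete cube\<close>

text \<open>The obstacle is a cut along one coordinate: it changes under the noise with probability
  (1 - rho)/2, of order 1/l^2, and such cuts embed the Hamming metric isometrically into l_1.
  Shift-invariance excludes them, since it forces every low-degree influence below l^2/m. Passing
  from 1/l^2 to 1/l is the whole gain. It needs the path from X to Y, but f has no meaning at the
  intermediate vectors, which leave the cube. The polynomial g does, and Lindeberg replacement
  carries over to them the fact that g is nearly 0/1-valued. The test functions are trigonometric
  because sin(pi t) vanishes at 0 and 1 and stays bounded however large g gets.

  Replacement costs 9^(l^2) times the largest influence, whence m = exp(Theta(l^2)). That L is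
  polynomial in m comes from controlling the autocorrelations by Chebyshev's inequality and a union
  bound over the m shifts. So log log n is at most of order l^2, and l^((2p-1)/p), with p = 1 -
  epsilon, is the stated power of l^2.\<close>

definition cube :: "'i set \<Rightarrow> ('i \<Rightarrow> real) set" where
  "cube I = (\<Pi>\<^sub>E i\<in>I. {-1, 1})"

text \<open>The pair \<open>x, y\<close> is uniform with coordinatewise correlation \<open>\<rho>\<close>. Expectations over a single
  uniform point are written with \<open>\<rho> = 0\<close> and a \<open>G\<close> that ignores \<open>y\<close>.\<close>

definition corr_exp :: "real \<Rightarrow> 'i set \<Rightarrow> (('i \<Rightarrow> real) \<Rightarrow> ('i \<Rightarrow> real) \<Rightarrow> real) \<Rightarrow> real" where
  "corr_exp \<rho> I G = (\<Sum>x\<in>cube I. \<Sum>y\<in>cube I. (\<Prod>i\<in>I. (1 + \<rho> * x i * y i) / 4) * G x y)"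

text \<open>The argument z may be any real vector. This is how a function on the cube is evaluated
  at points off the cube.\<close>

definition mlin :: "'i set \<Rightarrow> ('i set \<Rightarrow> real) \<Rightarrow> ('i \<Rightarrow> real) \<Rightarrow> real" where
  "mlin I c z = (\<Sum>S\<in>Pow I. c S * (\<Prod>i\<in>S. z i))"

text \<open>The coefficients depend on the coordinate so that, during the replacement argument, some
  coordinates can already be rotated while the others are still plain signs.\<close>

definition lcomb :: "('i \<Rightarrow> real) \<Rightarrow> ('i \<Rightarrow> real) \<Rightarrow> ('i \<Rightarrow> real) \<Rightarrow> ('i \<Rightarrow> real) \<Rightarrow> 'i \<Rightarrow> real" where
  "lcomb a b x y = (\<lambda>i. a i * x i + b i * y i)"

section \<open>Expectations over correlated pairs of cube points\<close>

lemma finite_cube: "finite I \<Longrightarrow> finite (cube I)"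
  unfolding cube_def by (intro finite_PiE) auto

lemma cube_mem: "x \<in> cube I \<Longrightarrow> i \<in> I \<Longrightarrow> x i = 1 \<or> x i = -1"
  unfolding cube_def by (auto simp: PiE_def Pi_def)

lemma cube_sq: "x \<in> cube I \<Longrightarrow> i \<in> I \<Longrightarrow> x i * x i = 1"
  using cube_mem by fastforce

lemma cube_abs: "x \<in> cube I \<Longrightarrow> i \<in> I \<Longrightarrow> \<bar>x i\<bar> = 1"
  using cube_mem by fastforce

lemma card_cube: "finite I \<Longrightarrow> card (cube I) = 2 ^ card I"
  unfolding cube_def by (simp add: card_PiE numeral_eq_Suc)

lemma sum_cube_prod:
  assumes "finite I"
  shows "(\<Sum>x\<in>cube I. \<Prod>i\<in>I. q i (x i)) = (\<Prod>i\<in>I. q i (-1) + q i (1::real) :: real)"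
proof -
  have "(\<Prod>i\<in>I. \<Sum>v\<in>{-1,1}. q i v) = (\<Sum>x\<in>cube I. \<Prod>i\<in>I. q i (x i))"
    unfolding cube_def using assms by (intro prod_sum_PiE) auto
  then show ?thesis by simp
qed

lemma sum_cube_insert:
  assumes "finite I" "i \<notin> I"
  shows "(\<Sum>x\<in>cube (insert i I). F x) = (\<Sum>x\<in>cube I. F (x(i := 1)) + F (x(i := -1)))"
proof -
  have inj: "inj_on (\<lambda>(y, g). g(i := y)) ({-1, 1::real} \<times> cube I)"
    using inj_combinator[OF assms(2), of "\<lambda>_. {-1, 1::real}"] unfolding cube_def by simp
  have eq: "cube (insert i I) = (\<lambda>(y, g). g(i := y)) ` ({-1, 1::real} \<times> cube I)"
    unfolding cube_def by (simp add: PiE_insert_eq)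
  have "(\<Sum>x\<in>cube (insert i I). F x) = (\<Sum>(y, g)\<in>{-1, 1::real} \<times> cube I. F (g(i := y)))"
    unfolding eq by (subst sum.reindex[OF inj]) (auto simp: case_prod_unfold intro: sum.cong)
  also have "\<dots> = (\<Sum>y\<in>{-1,1::real}. \<Sum>g\<in>cube I. F (g(i := y)))"
    by (simp add: sum.cartesian_product)
  also have "\<dots> = (\<Sum>x\<in>cube I. F (x(i := 1)) + F (x(i := -1)))"
    by (simp add: sum.distrib add.commute)
  finally show ?thesis .
qed

text \<open>Conditioning on one coordinate: the two signs agree with probability (1 +
  \<open>\<rho>\<close>)/2 and disagree with probability (1 - \<open>\<rho>\<close>)/2. The later
  inductions over coordinates all rest on this recursion.\<close>

lemma corr_exp_insert:
  assumes "finite I" "i \<notin> I"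
  shows "corr_exp \<rho> (insert i I) G =
    (1 + \<rho>) / 4 * corr_exp \<rho> I (\<lambda>x y. G (x(i := 1)) (y(i := 1)) + G (x(i := -1)) (y(i := -1))) +
    (1 - \<rho>) / 4 * corr_exp \<rho> I (\<lambda>x y. G (x(i := 1)) (y(i := -1)) + G (x(i := -1)) (y(i := 1)))"
proof -
  have [simp]: "(\<Prod>j\<in>insert i I. (1 + \<rho> * (x(i := u)) j * (y(i := v)) j) / 4)
      = (1 + \<rho> * u * v) / 4 * (\<Prod>j\<in>I. (1 + \<rho> * x j * y j) / 4)" for x y u v
  proof -
    have "(\<Prod>j\<in>I. (1 + \<rho> * (x(i := u)) j * (y(i := v)) j) / 4) = (\<Prod>j\<in>I. (1 + \<rho> * x j * y j) / 4)"
      using assms by (intro prod.cong) auto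
    then show ?thesis using assms by simp
  qed
  show ?thesis
    unfolding corr_exp_def sum_cube_insert[OF assms] sum.distrib[symmetric] sum_distrib_left
    by (intro sum.cong refl) (simp del: fun_upd_apply, simp add: field_simps)
qed

lemma corr_exp_add: "corr_exp \<rho> I (\<lambda>x y. F x y + G x y) = corr_exp \<rho> I F + corr_exp \<rho> I G"
  unfolding corr_exp_def by (simp add: algebra_simps sum.distrib)

lemma corr_exp_diff: "corr_exp \<rho> I (\<lambda>x y. F x y - G x y) = corr_exp \<rho> I F - corr_exp \<rho> I G"
  unfolding corr_exp_def by (simp add: algebra_simps sum_subtractf)

lemma corr_exp_cmult: "corr_exp \<rho> I (\<lambda>x y. k * F x y) = k * corr_exp \<rho> I F"
  unfolding corr_exp_def by (simp add: sum_distrib_left mult.left_commute)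

lemma corr_exp_sum: "corr_exp \<rho> I (\<lambda>x y. \<Sum>t\<in>T. F t x y) = (\<Sum>t\<in>T. corr_exp \<rho> I (F t))"
  by (induction T rule: infinite_finite_induct)
     (auto simp: corr_exp_add, simp_all add: corr_exp_def)

lemma corr_exp_cong:
  "(\<And>x y. x \<in> cube I \<Longrightarrow> y \<in> cube I \<Longrightarrow> F x y = G x y) \<Longrightarrow> corr_exp \<rho> I F = corr_exp \<rho> I G"
  unfolding corr_exp_def by (intro sum.cong refl) auto

lemma corr_weight_nonneg:
  assumes "x \<in> cube I" "y \<in> cube I" "\<bar>\<rho>\<bar> \<le> 1"
  shows "0 \<le> (\<Prod>i\<in>I. (1 + \<rho> * x i * y i) / 4)"
proof (intro prod_nonneg)
  fix i assume "i \<in> I"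
  with assms show "0 \<le> (1 + \<rho> * x i * y i) / 4"
    using cube_mem[of x I i] cube_mem[of y I i] by auto
qed

lemma corr_exp_mono:
  assumes "\<And>x y. x \<in> cube I \<Longrightarrow> y \<in> cube I \<Longrightarrow> F x y \<le> G x y" "\<bar>\<rho>\<bar> \<le> 1"
  shows "corr_exp \<rho> I F \<le> corr_exp \<rho> I G"
  unfolding corr_exp_def using assms
  by (intro sum_mono mult_left_mono corr_weight_nonneg) auto

lemma corr_exp_nonneg:
  assumes "\<And>x y. x \<in> cube I \<Longrightarrow> y \<in> cube I \<Longrightarrow> 0 \<le> G x y" "\<bar>\<rho>\<bar> \<le> 1"
  shows "0 \<le> corr_exp \<rho> I G"
  unfolding corr_exp_def using assms
  by (intro sum_nonneg mult_nonneg_nonneg corr_weight_nonneg) auto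

lemma corr_exp_empty: "corr_exp \<rho> {} G = G (\<lambda>_. undefined) (\<lambda>_. undefined)"
  unfolding corr_exp_def cube_def by simp

lemma corr_exp_const: "finite I \<Longrightarrow> corr_exp \<rho> I (\<lambda>x y. k) = k"
proof (induction I rule: finite_induct)
  case empty then show ?case by (simp add: corr_exp_empty)
next
  case (insert i I)
  have "corr_exp \<rho> I (\<lambda>x y. k + k) = 2 * k" using insert corr_exp_add[of \<rho> I "\<lambda>_ _. k" "\<lambda>_ _. k"] by simp
  then show ?case using insert by (simp add: corr_exp_insert field_simps)
qed

lemma corr_exp_swap: "corr_exp \<rho> I (\<lambda>x y. G y x) = corr_exp \<rho> I G"
  unfolding corr_exp_def by (subst sum.swap) (simp add: mult.commute mult.left_commute)

lemma corr_exp_fst: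
  assumes "finite I"
  shows "corr_exp \<rho> I (\<lambda>x y. F x) = (\<Sum>x\<in>cube I. F x) / 2 ^ card I"
  using assms
proof (induction I arbitrary: F rule: finite_induct)
  case empty then show ?case by (simp add: corr_exp_empty) (simp add: cube_def)
next
  case (insert i I)
  then show ?case
    by (simp add: corr_exp_insert corr_exp_add sum_cube_insert field_simps sum.distrib)
qed

lemma corr_exp_0_prod:
  assumes "finite I"
  shows "corr_exp 0 I (\<lambda>x y. F x * G y) = corr_exp 0 I (\<lambda>x y. F x) * corr_exp 0 I (\<lambda>x y. G x)"
proof -
  have "corr_exp 0 I (\<lambda>x y. F x * G y) = (1/4) ^ card I * ((\<Sum>x\<in>cube I. F x) * (\<Sum>y\<in>cube I. G y))"
    unfolding corr_exp_def sum_product by (simp add: sum_distrib_left power_divide)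
  also have "(1/4 :: real) ^ card I = 1 / 2 ^ card I * (1 / 2 ^ card I)"
    by (simp add: power_divide flip: power_mult_distrib)
  finally show ?thesis using assms by (simp add: corr_exp_fst)
qed

lemma corr_exp_Cauchy_Schwarz:
  assumes "\<bar>\<rho>\<bar> \<le> 1"
  shows "(corr_exp \<rho> I (\<lambda>x y. F x y * G x y))\<^sup>2 \<le>
    corr_exp \<rho> I (\<lambda>x y. (F x y)\<^sup>2) * corr_exp \<rho> I (\<lambda>x y. (G x y)\<^sup>2)"
proof -
  define A B C where "A = corr_exp \<rho> I (\<lambda>x y. (F x y)\<^sup>2)" and "B = corr_exp \<rho> I (\<lambda>x y. (G x y)\<^sup>2)"
    and "C = corr_exp \<rho> I (\<lambda>x y. F x y * G x y)"
  have key: "0 \<le> s\<^sup>2 * A - 2 * s * t * C + t\<^sup>2 * B" for s t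
  proof -
    have "0 \<le> corr_exp \<rho> I (\<lambda>x y. (s * F x y - t * G x y)\<^sup>2)"
      using assms by (intro corr_exp_nonneg) auto
    also have "\<dots> = corr_exp \<rho> I (\<lambda>x y. s\<^sup>2 * (F x y)\<^sup>2 - (2 * s * t) * (F x y * G x y) + t\<^sup>2 * (G x y)\<^sup>2)"
      by (intro corr_exp_cong) (simp add: power2_eq_square algebra_simps)
    finally show ?thesis
      by (simp only: corr_exp_add corr_exp_diff corr_exp_cmult A_def B_def C_def)
  qed
  have B0: "B \<ge> 0" unfolding B_def using assms by (intro corr_exp_nonneg) auto
  have "C\<^sup>2 \<le> A * B"
  proof (cases "B = 0")
    case True
    have "C = 0"
    proof (rule ccontr)
      assume "C \<noteq> 0"
      moreover have "0 \<le> A - 2 * t * C" for t using key[of 1 t] True by simp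
      from this[of "(A + 1) / (2 * C)"] have "0 \<le> A - (A + 1)" using \<open>C \<noteq> 0\<close> by simp
      ultimately show False by simp
    qed
    then show ?thesis using True by simp
  next
    case False
    have "0 \<le> B * (A * B - C\<^sup>2)" using key[of B C] by (simp add: power2_eq_square algebra_simps)
    then show ?thesis using False B0 by (simp add: zero_le_mult_iff)
  qed
  then show ?thesis unfolding A_def B_def C_def .
qed

section \<open>Multilinear polynomials: orthogonality and Bonami's inequality\<close>

lemma mlin_insert:
  assumes "finite I" "i \<notin> I"
  shows "mlin (insert i I) c z = mlin I c z + z i * mlin I (\<lambda>S. c (insert i S)) z"
proof -
  have inj: "inj_on (insert i) (Pow I)" using assms by (auto simp: inj_on_def)
  have "mlin (insert i I) c z = mlin I c z + (\<Sum>S\<in>insert i ` Pow I. c S * (\<Prod>i\<in>S. z i))"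
    unfolding mlin_def Pow_insert using assms by (subst sum.union_disjoint) auto
  also have "(\<Sum>S\<in>insert i ` Pow I. c S * (\<Prod>i\<in>S. z i)) = (\<Sum>S\<in>Pow I. c (insert i S) * (z i * (\<Prod>i\<in>S. z i)))"
  proof (subst sum.reindex[OF inj], unfold comp_def, intro sum.cong refl)
    fix S assume "S \<in> Pow I"
    then have "finite S" "i \<notin> S" using assms finite_subset by auto
    then show "c (insert i S) * prod z (insert i S) = c (insert i S) * (z i * prod z S)" by simp
  qed
  finally show ?thesis unfolding mlin_def by (simp add: sum_distrib_left mult.left_commute)
qed

lemma mlin_cong: "(\<And>i. i \<in> I \<Longrightarrow> z i = w i) \<Longrightarrow> mlin I c z = mlin I c w"
  unfolding mlin_def by (intro sum.cong refl arg_cong2[of _ _ _ _ "(*)"] prod.cong) auto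

lemma mlin_empty [simp]: "mlin {} c z = c {}"
  by (simp add: mlin_def)

lemma sum_Pow_insert:
  assumes "finite I" "i \<notin> I"
  shows "(\<Sum>S\<in>Pow (insert i I). F S) = (\<Sum>S\<in>Pow I. F S + F (insert i S) :: real)"
proof -
  have inj: "inj_on (insert i) (Pow I)" using assms by (auto simp: inj_on_def)
  have "(\<Sum>S\<in>Pow (insert i I). F S) = (\<Sum>S\<in>Pow I. F S) + (\<Sum>S\<in>insert i ` Pow I. F S)"
    unfolding Pow_insert using assms by (subst sum.union_disjoint) auto
  also have "(\<Sum>S\<in>insert i ` Pow I. F S) = (\<Sum>S\<in>Pow I. F (insert i S))"
    by (subst sum.reindex[OF inj]) simp
  finally show ?thesis by (simp add: sum.distrib add.commute)
qed

lemma mlin_lcomb_upd: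
  assumes "i \<notin> I"
  shows "mlin I c (lcomb a b (x(i := u)) (y(i := v))) = mlin I c (lcomb a b x y)"
  using assms by (intro mlin_cong) (auto simp: lcomb_def)

lemma mlin_lcomb_insert:
  assumes "finite I" "i \<notin> I"
  shows "mlin (insert i I) c (lcomb a b (x(i := u)) (y(i := v))) =
     mlin I c (lcomb a b x y) + (a i * u + b i * v) * mlin I (\<lambda>S. c (insert i S)) (lcomb a b x y)"
  using assms by (simp add: mlin_insert mlin_lcomb_upd) (simp add: lcomb_def)

text \<open>Each \<open>a i * x i + b i * y i\<close> has mean zero, so monomials over different
  sets are orthogonal; over the same set, every coordinate contributes the covariance of its two
  linear forms.\<close>

lemma corr_exp_mlin_mult:
  assumes "finite I"
  shows "corr_exp \<rho> I (\<lambda>x y. mlin I c (lcomb a b x y) * mlin I c' (lcomb a' b' x y)) =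
    (\<Sum>S\<in>Pow I. c S * c' S * (\<Prod>i\<in>S. a i * a' i + b i * b' i + \<rho> * (a i * b' i + b i * a' i)))"
  using assms
proof (induction I arbitrary: c c' rule: finite_induct)
  case empty then show ?case by (simp add: corr_exp_empty)
next
  case (insert i I)
  define P where "P x y = mlin I c (lcomb a b x y)" for x y
  define Q where "Q x y = mlin I (\<lambda>S. c (insert i S)) (lcomb a b x y)" for x y
  define P' where "P' x y = mlin I c' (lcomb a' b' x y)" for x y
  define Q' where "Q' x y = mlin I (\<lambda>S. c' (insert i S)) (lcomb a' b' x y)" for x y
  define k where "k = a i * a' i + b i * b' i + \<rho> * (a i * b' i + b i * a' i)"
  have "corr_exp \<rho> (insert i I) (\<lambda>x y. mlin (insert i I) c (lcomb a b x y) * mlin (insert i I) c' (lcomb a' b' x y))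
     = (1 + \<rho>) / 4 * corr_exp \<rho> I (\<lambda>x y. 2 * (P x y * P' x y) + (2 * (a i + b i) * (a' i + b' i)) * (Q x y * Q' x y))
     + (1 - \<rho>) / 4 * corr_exp \<rho> I (\<lambda>x y. 2 * (P x y * P' x y) + (2 * (a i - b i) * (a' i - b' i)) * (Q x y * Q' x y))"
    unfolding corr_exp_insert[OF insert(1,2)] mlin_lcomb_insert[OF insert(1,2)]
    unfolding P_def[symmetric] Q_def[symmetric] P'_def[symmetric] Q'_def[symmetric]
    by (rule arg_cong2[of _ _ _ _ "(+)"]; rule arg_cong2[of _ _ _ _ "(*)", OF refl]; rule corr_exp_cong;
        simp add: algebra_simps)
  also have "\<dots> = corr_exp \<rho> I (\<lambda>x y. P x y * P' x y) + k * corr_exp \<rho> I (\<lambda>x y. Q x y * Q' x y)"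
    unfolding corr_exp_add corr_exp_cmult k_def by (simp add: field_simps)
  also have "\<dots> = (\<Sum>S\<in>Pow (insert i I). c S * c' S * (\<Prod>i\<in>S. a i * a' i + b i * b' i + \<rho> * (a i * b' i + b i * a' i)))"
    (is "_ = (\<Sum>S\<in>_. c S * c' S * prod ?g S)")
  proof -
    have "(\<Sum>S\<in>Pow I. c (insert i S) * c' (insert i S) * prod ?g (insert i S))
        = k * (\<Sum>S\<in>Pow I. c (insert i S) * c' (insert i S) * prod ?g S)"
      unfolding sum_distrib_left
    proof (intro sum.cong refl)
      fix S assume "S \<in> Pow I"
      then have "finite S" "i \<notin> S" using insert finite_subset by auto
      then show "c (insert i S) * c' (insert i S) * prod ?g (insert i S) =
         k * (c (insert i S) * c' (insert i S) * prod ?g S)" by (simp add: k_def)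
    qed
    then show ?thesis
      unfolding sum_Pow_insert[OF insert(1,2)] sum.distrib P_def Q_def P'_def Q'_def insert.IH by simp
  qed
  finally show ?case .
qed

text \<open>Up to sign, \<open>a * x + b * y\<close> with independent signs takes the values a + b
  and a - b. Thus a form of variance one has fourth moment at most 2.\<close>

lemma fourth_moment_bound:
  assumes "a\<^sup>2 + b\<^sup>2 = (1::real)"
  shows "(a + b) ^ 4 + (a - b) ^ 4 \<le> 4"
proof -
  have "(a + b)\<^sup>2 + (a - b)\<^sup>2 = 2" using assms by (simp add: power2_eq_square algebra_simps)
  then have "((a + b)\<^sup>2 + (a - b)\<^sup>2)\<^sup>2 = 4" by simp
  moreover have "((a + b)\<^sup>2 + (a - b)\<^sup>2)\<^sup>2 = (a + b) ^ 4 + (a - b) ^ 4 + 2 * ((a + b)\<^sup>2 * (a - b)\<^sup>2)"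
    by algebra
  ultimately show ?thesis by (smt (verit) zero_le_mult_iff zero_le_power2)
qed

text \<open>Write the polynomial as P + z Q with z the new coordinate. Odd powers of z average out,
  leaving E P^4 + 6 E P^2 Q^2 + m E Q^4 with m at most 2. Cauchy-Schwarz and induction bound this by
  p^2 + 6 p q + 2 q^2, and the weight 3 per variable is what makes (p + 3 q)^2 absorb the cross
  term.\<close>

lemma bonami:
  assumes "finite I" "\<And>i. i \<in> I \<Longrightarrow> (a i)\<^sup>2 + (b i)\<^sup>2 = 1"
  shows "corr_exp 0 I (\<lambda>x y. (mlin I c (lcomb a b x y)) ^ 4) \<le> (\<Sum>S\<in>Pow I. 3 ^ card S * (c S)\<^sup>2)\<^sup>2"
  using assms
proof (induction I arbitrary: c rule: finite_induct)
  case empty then show ?case by (simp add: corr_exp_empty flip: power_mult)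
next
  case (insert i I)
  define P where "P x y = mlin I c (lcomb a b x y)" for x y
  define Q where "Q x y = mlin I (\<lambda>S. c (insert i S)) (lcomb a b x y)" for x y
  define p where "p = (\<Sum>S\<in>Pow I. 3 ^ card S * (c S)\<^sup>2)"
  define q where "q = (\<Sum>S\<in>Pow I. 3 ^ card S * (c (insert i S))\<^sup>2)"
  have p0: "p \<ge> 0" and q0: "q \<ge> 0" unfolding p_def q_def by (intro sum_nonneg; simp)+
  define m where "m = ((a i + b i) ^ 4 + (a i - b i) ^ 4) / 2"
  have m: "m \<le> 2" using fourth_moment_bound[of "a i" "b i"] insert.prems[of i] by (simp add: m_def)
  have ab: "(a i + b i)\<^sup>2 + (a i - b i)\<^sup>2 = 2"
    using insert.prems[of i] by (simp add: power2_eq_square algebra_simps)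
  have e: "(P' + (a i * 1 + b i * 1) * Q') ^ 4 + (P' + (a i * (-1) + b i * (-1)) * Q') ^ 4 +
        ((P' + (a i * 1 + b i * (-1)) * Q') ^ 4 + (P' + (a i * (-1) + b i * 1) * Q') ^ 4) =
        4 * P' ^ 4 + 12 * ((a i + b i)\<^sup>2 + (a i - b i)\<^sup>2) * (P'\<^sup>2 * Q'\<^sup>2) +
        2 * ((a i + b i) ^ 4 + (a i - b i) ^ 4) * Q' ^ 4" for P' Q' :: real
    by algebra
  have "corr_exp 0 (insert i I) (\<lambda>x y. (mlin (insert i I) c (lcomb a b x y)) ^ 4)
     = 1 / 4 * corr_exp 0 I (\<lambda>x y. 4 * P x y ^ 4 + 24 * ((P x y)\<^sup>2 * (Q x y)\<^sup>2) + (4 * m) * Q x y ^ 4)"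
    unfolding corr_exp_insert[OF insert(1,2)] mlin_lcomb_insert[OF insert(1,2)]
    unfolding P_def[symmetric] Q_def[symmetric]
    apply (simp only: add_0_right diff_0_right flip: distrib_left corr_exp_add)
    apply (rule arg_cong2[of _ _ _ _ "(*)"], simp)
    apply (rule corr_exp_cong)
    apply (subst e) apply (simp only: ab m_def) done
  also have "\<dots> = corr_exp 0 I (\<lambda>x y. P x y ^ 4) + 6 * corr_exp 0 I (\<lambda>x y. (P x y)\<^sup>2 * (Q x y)\<^sup>2)
       + m * corr_exp 0 I (\<lambda>x y. Q x y ^ 4)"
    by (simp only: corr_exp_add corr_exp_cmult) simp
  also have "\<dots> \<le> p\<^sup>2 + 6 * (p * q) + 2 * q\<^sup>2"
  proof -
    have P4: "corr_exp 0 I (\<lambda>x y. P x y ^ 4) \<le> p\<^sup>2" and Q4: "corr_exp 0 I (\<lambda>x y. Q x y ^ 4) \<le> q\<^sup>2"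
      unfolding P_def Q_def p_def q_def using insert by auto
    have P40: "corr_exp 0 I (\<lambda>x y. P x y ^ 4) \<ge> 0" and Q40: "corr_exp 0 I (\<lambda>x y. Q x y ^ 4) \<ge> 0"
      by (intro corr_exp_nonneg; simp)+
    have "(corr_exp 0 I (\<lambda>x y. (P x y)\<^sup>2 * (Q x y)\<^sup>2))\<^sup>2 \<le> corr_exp 0 I (\<lambda>x y. P x y ^ 4) * corr_exp 0 I (\<lambda>x y. Q x y ^ 4)"
      using corr_exp_Cauchy_Schwarz[of 0 I "\<lambda>x y. (P x y)\<^sup>2" "\<lambda>x y. (Q x y)\<^sup>2"] by (simp flip: power_mult)
    also have "\<dots> \<le> p\<^sup>2 * q\<^sup>2" using P4 Q4 P40 Q40 by (intro mult_mono) auto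
    also have "\<dots> = (p * q)\<^sup>2" by (simp add: power_mult_distrib)
    finally have "corr_exp 0 I (\<lambda>x y. (P x y)\<^sup>2 * (Q x y)\<^sup>2) \<le> p * q"
      using p0 q0 by (meson mult_nonneg_nonneg power2_le_imp_le)
    moreover have "m * corr_exp 0 I (\<lambda>x y. Q x y ^ 4) \<le> 2 * q\<^sup>2"
      using m Q4 Q40 by (intro mult_mono) auto
    ultimately show ?thesis using P4 by linarith
  qed
  also have "\<dots> \<le> (p + 3 * q)\<^sup>2" by (simp add: power2_eq_square algebra_simps)
  also have "p + 3 * q = (\<Sum>S\<in>Pow (insert i I). 3 ^ card S * (c S)\<^sup>2)"
  proof -
    have "(\<Sum>S\<in>Pow I. 3 ^ card (insert i S) * (c (insert i S))\<^sup>2) = 3 * q"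
      unfolding q_def sum_distrib_left
    proof (intro sum.cong refl)
      fix S assume "S \<in> Pow I"
      then have "finite S" "i \<notin> S" using insert finite_subset by auto
      then show "3 ^ card (insert i S) * (c (insert i S))\<^sup>2 = 3 * (3 ^ card S * (c (insert i S))\<^sup>2)" by simp
    qed
    then show ?thesis unfolding sum_Pow_insert[OF insert(1,2)] sum.distrib p_def by simp
  qed
  finally show ?case .
qed

section \<open>Lindeberg replacement for cosines\<close>

lemma cos_taylor2: "\<bar>cos y - (1 - y\<^sup>2 / 2)\<bar> \<le> y ^ 4 / (24::real)"
proof -
  obtain t where t: "cos y = (\<Sum>m<4. cos_coeff m * y ^ m) + cos (t + 1/2 * real 4 * pi) / fact 4 * y ^ 4"
    using Maclaurin_cos_expansion[of y 4] by blast
  have "(\<Sum>m<4. cos_coeff m * y ^ m) = 1 - y\<^sup>2 / 2"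
  proof -
    have "{..<4} = {0, 1, 2, 3::nat}" by auto
    then show ?thesis by (simp add: cos_coeff_def)
  qed
  with t have "cos y - (1 - y\<^sup>2 / 2) = cos (t + 1/2 * real 4 * pi) / 24 * y ^ 4"
    by (simp add: fact_numeral)
  then have "\<bar>cos y - (1 - y\<^sup>2 / 2)\<bar> = \<bar>cos (t + 1/2 * real 4 * pi)\<bar> / 24 * y ^ 4"
    by (simp only: abs_mult abs_divide) simp
  also have "\<dots> \<le> 1 / 24 * y ^ 4"
    by (intro mult_right_mono divide_right_mono) auto
  finally show ?thesis by simp
qed

lemma cos_quad_average:
  fixes A B a b :: real
  shows "cos (A + (a + b) * B) + cos (A + (a - b) * B) + cos (A - (a + b) * B) + cos (A - (a - b) * B)
    = 2 * cos A * (cos ((a + b) * B) + cos ((a - b) * B))"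
proof -
  have "cos (A + s) + cos (A + t) + cos (A - s) + cos (A - t) = 2 * cos A * (cos s + cos t)" for s t
    by (simp add: cos_add cos_diff algebra_simps)
  then show ?thesis .
qed

text \<open>A symmetric coordinate of variance one may replace a sign: moments up to the third agree, so
  only a fourth-order error appears.\<close>

lemma lindeberg_cos:
  assumes "finite I" "J \<subseteq> I" "\<And>i. i \<in> I \<Longrightarrow> (a i)\<^sup>2 + (b i)\<^sup>2 = 1"
  defines "aJ \<equiv> \<lambda>J i. if i \<in> J then a i else 1" and "bJ \<equiv> \<lambda>J i. if i \<in> J then b i else 0"
  shows "\<bar>corr_exp 0 I (\<lambda>x y. cos (\<kappa> * mlin I c (lcomb (aJ J) (bJ J) x y))) -
     corr_exp 0 I (\<lambda>x y. cos (\<kappa> * mlin I c x))\<bar>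
     \<le> \<kappa> ^ 4 / 8 * (\<Sum>i\<in>J. (\<Sum>S\<in>Pow (I - {i}). 3 ^ card S * (c (insert i S))\<^sup>2)\<^sup>2)"
  using finite_subset[OF assms(2,1)] assms(2)
proof (induction J rule: finite_induct)
  case empty
  have "mlin I c (lcomb (aJ {}) (bJ {}) x y) = mlin I c x" for x y
    by (intro mlin_cong) (simp add: lcomb_def aJ_def bJ_def)
  then show ?case by simp
next
  case (insert i J)
  define I' where "I' = I - {i}"
  have I: "I = insert i I'" "finite I'" "i \<notin> I'" using insert.prems assms(1) by (auto simp: I'_def)
  define P where "P x y = mlin I' c (lcomb (aJ J) (bJ J) x y)" for x y
  define Q where "Q x y = mlin I' (\<lambda>S. c (insert i S)) (lcomb (aJ J) (bJ J) x y)" for x y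
  define q where "q = (\<Sum>S\<in>Pow (I - {i}). 3 ^ card S * (c (insert i S))\<^sup>2)"
  have same: "mlin I' c' (lcomb (aJ (insert i J)) (bJ (insert i J)) x y) = mlin I' c' (lcomb (aJ J) (bJ J) x y)" for c' x y
    using I by (intro mlin_cong) (auto simp: lcomb_def aJ_def bJ_def)
  have vals: "aJ (insert i J) i = a i" "bJ (insert i J) i = b i" "aJ J i = 1" "bJ J i = 0"
    using insert.hyps by (auto simp: aJ_def bJ_def)
  have norm: "(aJ J j)\<^sup>2 + (bJ J j)\<^sup>2 = 1" if "j \<in> I'" for j
    using assms(3)[of j] that by (auto simp: aJ_def bJ_def I'_def)
  \<comment> \<open>Averaging over the four sign choices at i removes the part odd in the new
    coordinate. The formula serves both sides of the replacement, since P and Q do not see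
    coordinate i.\<close>
  have E: "corr_exp 0 I (\<lambda>x y. cos (\<kappa> * mlin I c (lcomb (aJ J') (bJ J') x y)))
     = corr_exp 0 I' (\<lambda>x y. cos (\<kappa> * P x y) * ((cos ((u + v) * (\<kappa> * Q x y)) + cos ((u - v) * (\<kappa> * Q x y))) / 2))"
    if J': "J' = J \<or> J' = insert i J" and u: "u = aJ J' i" and v: "v = bJ J' i" for u v J'
  proof -
    have 1: "mlin I' c' (lcomb (aJ J') (bJ J') x y) = mlin I' c' (lcomb (aJ J) (bJ J) x y)" for c' x y
      using J' same by auto
    have e: "cos (\<kappa> * (P' + (u * 1 + v * 1) * Q')) + cos (\<kappa> * (P' + (u * (-1) + v * (-1)) * Q')) +
        (cos (\<kappa> * (P' + (u * 1 + v * (-1)) * Q')) + cos (\<kappa> * (P' + (u * (-1) + v * 1) * Q')))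
        = 4 * (cos (\<kappa> * P') * ((cos ((u + v) * (\<kappa> * Q')) + cos ((u - v) * (\<kappa> * Q'))) / 2))" for P' Q'
      using cos_quad_average[of "\<kappa> * P'" u v "\<kappa> * Q'"] by (simp add: algebra_simps)
    show ?thesis
      unfolding I(1) corr_exp_insert[OF I(2,3)] mlin_lcomb_insert[OF I(2,3)] 1 u[symmetric] v[symmetric]
      unfolding P_def[symmetric] Q_def[symmetric]
      apply (simp only: add_0_right diff_0_right flip: distrib_left corr_exp_add)
      apply (subst e) by (simp only: corr_exp_cmult)
  qed
  have "\<bar>corr_exp 0 I (\<lambda>x y. cos (\<kappa> * mlin I c (lcomb (aJ (insert i J)) (bJ (insert i J)) x y)))
      - corr_exp 0 I (\<lambda>x y. cos (\<kappa> * mlin I c (lcomb (aJ J) (bJ J) x y)))\<bar>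
      \<le> corr_exp 0 I' (\<lambda>x y. \<kappa> ^ 4 / 8 * (Q x y) ^ 4)"
  proof -
    \<comment> \<open>With s = a + b and t = a - b, the second-order terms cancel because s^2 + t^2
      = 2. The three fourth-order remainders add up to at most (4 + 2) B^4 / 24, and the average
      halves this.\<close>
    have pt: "\<bar>C * ((cos ((a i + b i) * B) + cos ((a i - b i) * B)) / 2) - C * ((cos ((1 + 0) * B) + cos ((1 - 0) * B)) / 2)\<bar>
       \<le> B ^ 4 / 8" if C: "\<bar>C\<bar> \<le> 1" for C B :: real
    proof -
      define s t where "s = a i + b i" and "t = a i - b i"
      have st: "s\<^sup>2 + t\<^sup>2 = 2" and st4: "s ^ 4 + t ^ 4 \<le> 4"
        using assms(3)[of i] insert.prems fourth_moment_bound[of "a i" "b i"]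
        by (auto simp: s_def t_def power2_eq_square algebra_simps)
      have "\<bar>cos (s * B) + cos (t * B) - 2 * cos B\<bar> \<le> (s * B) ^ 4 / 24 + (t * B) ^ 4 / 24 + 2 * (B ^ 4 / 24)"
      proof -
        have "(s * B)\<^sup>2 / 2 + (t * B)\<^sup>2 / 2 = B\<^sup>2" using st
          by (simp add: power_mult_distrib flip: distrib_right add_divide_distrib)
        then show ?thesis
          using cos_taylor2[of "s * B"] cos_taylor2[of "t * B"] cos_taylor2[of B] by (simp only: abs_le_iff) argo
      qed
      also have "\<dots> = (s ^ 4 + t ^ 4 + 2) * B ^ 4 / 24" by (simp add: power_mult_distrib algebra_simps add_divide_distrib)
      also have "\<dots> \<le> 6 * B ^ 4 / 24" using st4 by (intro divide_right_mono mult_right_mono) auto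
      finally have "\<bar>(cos (s * B) + cos (t * B) - 2 * cos B) / 2\<bar> \<le> B ^ 4 / 8" by simp
      then have "\<bar>C\<bar> * \<bar>(cos (s * B) + cos (t * B) - 2 * cos B) / 2\<bar> \<le> 1 * (B ^ 4 / 8)"
        using C by (intro mult_mono) auto
      then show ?thesis unfolding s_def t_def abs_mult[symmetric] by (simp add: field_simps)
    qed
    have abs_le: "\<bar>corr_exp 0 I' F\<bar> \<le> corr_exp 0 I' G" if "\<And>x y. \<bar>F x y\<bar> \<le> G x y" for F G
    proof -
      have "corr_exp 0 I' F \<le> corr_exp 0 I' G" using that by (intro corr_exp_mono) (auto simp: abs_le_iff)
      moreover have "corr_exp 0 I' (\<lambda>x y. (-1) * F x y) \<le> corr_exp 0 I' G"
        using that by (intro corr_exp_mono) (auto simp: abs_le_iff)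
      ultimately show ?thesis unfolding corr_exp_cmult by simp
    qed
    show ?thesis
      unfolding E[OF disjI2[OF refl] refl refl] E[OF disjI1[OF refl] refl refl] vals corr_exp_diff[symmetric]
      by (rule abs_le, rule order_trans[OF pt]) (auto simp: power_mult_distrib)
  qed
  also have "\<dots> = \<kappa> ^ 4 / 8 * corr_exp 0 I' (\<lambda>x y. (Q x y) ^ 4)" by (rule corr_exp_cmult)
  also have "\<dots> \<le> \<kappa> ^ 4 / 8 * q\<^sup>2"
    unfolding Q_def q_def I'_def[symmetric]
    by (intro mult_left_mono bonami I norm) auto
  finally show ?case
    using insert.IH[OF subset_trans[OF subset_insertI insert.prems]] unfolding q_def sum.insert[OF insert.hyps] distrib_left by linarith
qed

section \<open>Fourier expansion on the cube\<close>

definition fourier :: "'i set \<Rightarrow> (('i \<Rightarrow> real) \<Rightarrow> real) \<Rightarrow> 'i set \<Rightarrow> real" where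
  "fourier I f S = (\<Sum>x\<in>cube I. f x * (\<Prod>i\<in>S. x i)) / 2 ^ card I"

lemma cube_eqI: "x \<in> cube I \<Longrightarrow> y \<in> cube I \<Longrightarrow> (\<And>i. i \<in> I \<Longrightarrow> x i = y i) \<Longrightarrow> x = y"
  unfolding cube_def by (rule PiE_ext) auto

text \<open>The kernel obtained by summing over S factors as the product of 1 + y_i x_i, which
  vanishes unless y = x.\<close>

lemma fourier_expansion:
  assumes "finite I" "x \<in> cube I"
  shows "mlin I (fourier I f) x = f x"
proof -
  have ker: "(\<Sum>S\<in>Pow I. (\<Prod>i\<in>S. y i) * (\<Prod>i\<in>S. x i)) = (if y = x then 2 ^ card I else 0)"
    if y: "y \<in> cube I" for y
  proof -
    have "(\<Sum>S\<in>Pow I. (\<Prod>i\<in>S. y i) * (\<Prod>i\<in>S. x i)) = (\<Prod>i\<in>I. y i * x i + 1)"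
      using prod_add[OF assms(1), of "\<lambda>i. y i * x i" "\<lambda>_. 1"] by (simp add: prod.distrib)
    also have "\<dots> = (if y = x then 2 ^ card I else 0)"
    proof (cases "y = x")
      case True
      then have "(\<Prod>i\<in>I. y i * x i + 1) = (\<Prod>i\<in>I. 2)"
        using cube_sq[OF assms(2)] by (intro prod.cong) auto
      then show ?thesis using True by simp
    next
      case False
      then obtain i where i: "i \<in> I" "y i \<noteq> x i" using cube_eqI[OF y assms(2)] by blast
      then have "y i * x i + 1 = 0" using cube_mem[OF y i(1)] cube_mem[OF assms(2) i(1)] by auto
      then show ?thesis using False i assms(1) by auto
    qed
    finally show ?thesis .
  qed
  have "mlin I (fourier I f) x = (\<Sum>S\<in>Pow I. \<Sum>y\<in>cube I. f y * ((\<Prod>i\<in>S. y i) * (\<Prod>i\<in>S. x i)) / 2 ^ card I)"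
    unfolding mlin_def fourier_def by (simp add: sum_distrib_right sum_divide_distrib mult.assoc)
  also have "\<dots> = (\<Sum>y\<in>cube I. f y / 2 ^ card I * (\<Sum>S\<in>Pow I. (\<Prod>i\<in>S. y i) * (\<Prod>i\<in>S. x i)))"
    by (subst sum.swap) (simp add: sum_distrib_left)
  also have "\<dots> = (\<Sum>y\<in>cube I. if y = x then f x else 0)"
    using ker by (intro sum.cong) auto
  also have "\<dots> = f x" using assms finite_cube[OF assms(1)] by simp
  finally show ?thesis .
qed

lemma lcomb_fst [simp]: "lcomb (\<lambda>_. 1) (\<lambda>_. 0) x y = x" by (simp add: lcomb_def)
lemma lcomb_snd [simp]: "lcomb (\<lambda>_. 0) (\<lambda>_. 1) x y = y" by (simp add: lcomb_def)

text \<open>The last hypothesis makes a^2 + b^2 + 2 \<open>\<rho>\<close> a b equal to 1, so both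
  polynomials have second moment equal to the sum of the c(S)^2. It covers the two uses: x against y
  at correlation \<open>\<rho>\<close>, and two rotated vectors built from independent x and
  y.\<close>

lemma corr_exp_mlin_diff_sq:
  assumes "finite I" "a\<^sup>2 + b\<^sup>2 = 1" "a'\<^sup>2 + b'\<^sup>2 = 1" "\<rho> = 0 \<or> (a * b = 0 \<and> a' * b' = 0)"
  shows "corr_exp \<rho> I (\<lambda>x y. (mlin I c (lcomb (\<lambda>_. a) (\<lambda>_. b) x y) - mlin I c (lcomb (\<lambda>_. a') (\<lambda>_. b') x y))\<^sup>2)
    = (\<Sum>S\<in>Pow I. (c S)\<^sup>2 * (2 - 2 * (a * a' + b * b' + \<rho> * (a * b' + b * a')) ^ card S))"
proof -
  let ?u = "\<lambda>x y. mlin I c (lcomb (\<lambda>_. a) (\<lambda>_. b) x y)" and ?v = "\<lambda>x y. mlin I c (lcomb (\<lambda>_. a') (\<lambda>_. b') x y)"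
  have "corr_exp \<rho> I (\<lambda>x y. (?u x y - ?v x y)\<^sup>2) =
    corr_exp \<rho> I (\<lambda>x y. ?u x y * ?u x y + ?v x y * ?v x y - 2 * (?u x y * ?v x y))"
    by (rule corr_exp_cong) (simp add: power2_eq_square algebra_simps)
  also have "\<dots> = (\<Sum>S\<in>Pow I. (c S)\<^sup>2 * (2 - 2 * (a * a' + b * b' + \<rho> * (a * b' + b * a')) ^ card S))"
    using assms(2-4)
    by (auto simp: corr_exp_add corr_exp_diff corr_exp_cmult corr_exp_mlin_mult[OF assms(1)]
          power2_eq_square sum_distrib_left simp flip: sum.distrib sum_subtractf
          intro!: sum.cong simp: algebra_simps)
  finally show ?thesis .
qed

text \<open>The first-order change is sin(pi t) times the increment; splitting it by the
  arithmetic-geometric mean inequality leaves only two squares. Both have expectation of the order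
  of the noise probability, so a step along the path costs that much and not its square
  root.\<close>

lemma half_cos_diff_le:
  "\<bar>(1 - cos (pi * t)) / 2 - (1 - cos (pi * u)) / 2\<bar> \<le> 1 / 4 * (sin (pi * t))\<^sup>2 + pi\<^sup>2 / 2 * (t - u)\<^sup>2"
  for t u :: real
proof -
  define a e where "a = pi * t" and "e = pi * u - pi * t"
  have "\<bar>cos e - 1\<bar> \<le> e\<^sup>2 / 2"
  proof -
    have "1 - cos e = 2 * (sin (e / 2))\<^sup>2" using cos_double_sin[of "e / 2"] by simp
    moreover have "(sin (e / 2))\<^sup>2 \<le> (e / 2)\<^sup>2"
      using abs_sin_x_le_abs_x[of "e / 2"] by (metis abs_le_square_iff)
    ultimately show ?thesis by (simp add: power2_eq_square)
  qed
  moreover have "\<bar>cos a * (cos e - 1)\<bar> \<le> 1 * \<bar>cos e - 1\<bar>"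
    unfolding abs_mult by (intro mult_right_mono) auto
  moreover have "\<bar>sin a * sin e\<bar> \<le> \<bar>sin a\<bar> * \<bar>e\<bar>"
    unfolding abs_mult by (intro mult_left_mono abs_sin_x_le_abs_x) auto
  moreover have "\<bar>sin a\<bar> * \<bar>e\<bar> \<le> ((sin a)\<^sup>2 + e\<^sup>2) / 2"
    using sum_squares_bound[of "\<bar>sin a\<bar>" "\<bar>e\<bar>"] by simp
  moreover have "cos (a + e) - cos a = cos a * (cos e - 1) - sin a * sin e"
    by (simp add: cos_add algebra_simps)
  ultimately have "\<bar>cos (a + e) - cos a\<bar> \<le> (sin a)\<^sup>2 / 2 + e\<^sup>2" by argo
  moreover have "e\<^sup>2 = pi\<^sup>2 * (t - u)\<^sup>2" unfolding e_def by algebra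
  ultimately have "\<bar>cos (pi * u) - cos (pi * t)\<bar> \<le> (sin (pi * t))\<^sup>2 / 2 + pi\<^sup>2 * (t - u)\<^sup>2"
    by (simp add: a_def e_def)
  then show ?thesis unfolding abs_le_iff by (simp add: field_simps)
qed

text \<open>The Taylor polynomial of degree four already shows that cos(8/5) is negative, so 8/5
  exceeds pi/2.\<close>

lemma pi_le_16_5: "pi \<le> 16 / 5"
proof (rule ccontr)
  assume "\<not> pi \<le> 16 / 5"
  then have "cos (8 / 5 :: real) > 0" by (intro cos_gt_zero) auto
  moreover have "cos (8 / 5 :: real) < 0"
    using cos_taylor2[of "8 / 5"] by (simp add: power2_eq_square power4_eq_xxxx abs_if split: if_splits)
  ultimately show False by simp
qed

lemma pi_ge_3: "pi \<ge> 3"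
  using sin_x_le_x[of "pi / 6"] by (simp add: sin_30)

text \<open>The angle t lies between 3/(2l) and 8/5. Hence the factor 1/2 - t^2/24 is at least 1/3,
  and t^2/3 is at least 3/(4 l^2).\<close>

lemma one_minus_cos_ge:
  assumes "l \<ge> (1::nat)"
  shows "3 / (4 * (real l)\<^sup>2) \<le> 1 - cos (pi / (2 * l))"
proof -
  define t where "t = pi / (2 * l)"
  have t2: "t\<^sup>2 \<le> 2.56"
  proof -
    have "0 \<le> t" "t \<le> 1.6" unfolding t_def using assms pi_le_16_5 by (auto simp: field_simps intro: order_trans[of _ "16 / 5 * real l"])
    then have "t * t \<le> 1.6 * 1.6" by (intro mult_mono) auto
    then show ?thesis by (simp add: power2_eq_square)
  qed
  have "t\<^sup>2 \<ge> 9 / (4 * (real l)\<^sup>2)"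
  proof -
    have "pi\<^sup>2 \<ge> 3\<^sup>2" using pi_ge_3 by (intro power_mono) auto
    then show ?thesis unfolding t_def by (simp add: power_divide power_mult_distrib divide_right_mono)
  qed
  then have "3 / (4 * (real l)\<^sup>2) \<le> t\<^sup>2 / 3" by simp
  also have "\<dots> \<le> t\<^sup>2 * (1 / 2 - t\<^sup>2 / 24)"
    using mult_left_mono[of "1/3" "1 / 2 - t\<^sup>2 / 24" "t\<^sup>2"] t2 by simp
  also have "\<dots> = t\<^sup>2 / 2 - t ^ 4 / 24" by (simp add: algebra_simps power4_eq_xxxx power2_eq_square)
  also have "\<dots> \<le> 1 - cos t" using cos_taylor2[of t] by (simp only: abs_le_iff) argo
  finally show ?thesis unfolding t_def .
qed

text \<open>This fixes the truncation degree l^2: a Fourier coefficient of larger degree enters the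
  noise probability with weight 2 - 2 \<open>\<rho>\<close>^|S|, which is then at least 1.\<close>

lemma cos_power_le_half:
  assumes "l \<ge> (1::nat)" "l\<^sup>2 \<le> n"
  shows "cos (pi / (2 * l)) ^ n \<le> 1 / 2"
proof -
  define \<rho> where "\<rho> = cos (pi / (2 * l))"
  have \<rho>0: "0 \<le> \<rho>" unfolding \<rho>_def
  proof (rule cos_ge_zero)
    have "pi / real (2 * l) \<ge> 0" by simp
    then show "- (pi / 2) \<le> pi / real (2 * l)" using pi_ge_zero by linarith
    show "pi / real (2 * l) \<le> pi / 2" using assms by (intro divide_left_mono) auto
  qed
  have "\<rho> \<le> 1 + - (3 / (4 * (real l)\<^sup>2))" using one_minus_cos_ge[OF assms(1)] by (simp add: \<rho>_def)
  also have "\<dots> \<le> exp (- (3 / (4 * (real l)\<^sup>2)))" by (rule exp_ge_add_one_self)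
  finally have 1: "\<rho> \<le> exp (- (3 / (4 * (real l)\<^sup>2)))" .
  have "\<rho> ^ n \<le> \<rho> ^ (l\<^sup>2)" using assms \<rho>0 by (intro power_decreasing) (auto simp: \<rho>_def)
  also have "\<dots> \<le> exp (- (3 / (4 * (real l)\<^sup>2))) ^ (l\<^sup>2)" using 1 \<rho>0 by (intro power_mono)
  also have "\<dots> = exp (- (3 / 4))" using assms by (simp flip: exp_of_nat_mult)
  also have "\<dots> \<le> 1 / 2"
  proof -
    have "exp (3 / 4 :: real) \<ge> 1 + 3/4 + (3/4)\<^sup>2 / 2" by (rule exp_lower_Taylor_quadratic) simp
    then have "exp (3 / 4 :: real) \<ge> 2" by (simp add: power2_eq_square)
    then show ?thesis by (simp add: exp_minus field_simps)
  qed
  finally show ?thesis unfolding \<rho>_def .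
qed

section \<open>Isoperimetry under noise\<close>

lemma sum_Pow_remove_insert:
  assumes "finite I" "i \<in> I"
  shows "(\<Sum>S\<in>Pow (I - {i}). F (insert i S)) = (\<Sum>S | S \<subseteq> I \<and> i \<in> S. F S :: real)"
proof (rule sum.reindex_bij_witness[of _ "\<lambda>S. S - {i}" "insert i"])
qed (use assms in \<open>auto simp: insert_absorb\<close>)

lemma corr_exp_sum_abs_le:
  assumes "\<bar>\<rho>\<bar> \<le> 1"
  shows "corr_exp \<rho> I (\<lambda>x y. \<bar>F 0 x y - F (n::nat) x y\<bar>) \<le> (\<Sum>j<n. corr_exp \<rho> I (\<lambda>x y. \<bar>F j x y - F (Suc j) x y\<bar>))"
proof -
  have "\<bar>F 0 x y - F n x y\<bar> \<le> (\<Sum>j<n. \<bar>F j x y - F (Suc j) x y\<bar>)" for x y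
    by (induction n) auto
  then show ?thesis using assms by (simp flip: corr_exp_sum add: corr_exp_mono)
qed

lemma corr_exp_mlin_sq:
  assumes "finite I"
  shows "corr_exp \<rho> I (\<lambda>x y. (mlin I c x)\<^sup>2) = (\<Sum>S\<in>Pow I. (c S)\<^sup>2)"
  using corr_exp_mlin_mult[OF assms, of \<rho> c "\<lambda>_. 1" "\<lambda>_. 0" c "\<lambda>_. 1" "\<lambda>_. 0"]
  by (simp add: power2_eq_square)

lemma fourier_parseval:
  assumes "finite I"
  shows "(\<Sum>S\<in>Pow I. (fourier I f S)\<^sup>2) = corr_exp \<rho> I (\<lambda>x y. (f x)\<^sup>2)"
  unfolding corr_exp_mlin_sq[OF assms, of \<rho>, symmetric]
  by (rule corr_exp_cong) (simp add: fourier_expansion[OF assms])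

text \<open>Only influences of degree at most l^2 enter, because replacement is applied to the
  truncated polynomial alone. The smallness condition on \<open>\<kappa>\<close> makes the
  accumulated replacement error at most \<open>\<mu>\<close>/2, which the left-hand side
  absorbs.\<close>

theorem cube_isoperimetry:
  fixes f :: "('i \<Rightarrow> real) \<Rightarrow> real"
  assumes I: "finite I" and f01: "\<And>x. x \<in> cube I \<Longrightarrow> f x = 0 \<or> f x = 1"
    and half: "corr_exp 0 I (\<lambda>x y. f x) \<le> 1 / 2" and l: "l \<ge> 1"
    and infl: "\<And>i. i \<in> I \<Longrightarrow> (\<Sum>S | S \<subseteq> I \<and> i \<in> S \<and> card S \<le> l\<^sup>2. (fourier I f S)\<^sup>2) \<le> \<kappa>"
    and small: "60 * 9 ^ (l\<^sup>2) * \<kappa> * l ^ 3 \<le> 1" and \<kappa>: "\<kappa> \<ge> 0"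
  shows "corr_exp 0 I (\<lambda>x y. f x) \<le> 40 * real l * corr_exp (cos (pi / (2 * l))) I (\<lambda>x y. \<bar>f x - f y\<bar>)"
proof -
  define \<mu> where "\<mu> = corr_exp 0 I (\<lambda>x y. f x)"
  define \<theta> where "\<theta> = pi / (2 * l)"
  define \<rho> where "\<rho> = cos \<theta>"
  define s where "s = corr_exp \<rho> I (\<lambda>x y. \<bar>f x - f y\<bar>)"
  define c where "c = fourier I f"
  define c' where "c' = (\<lambda>S. if card S \<le> l\<^sup>2 then c S else 0)"
  define h where "h = (\<lambda>t. (1 - cos (pi * t)) / 2)"
  define X where "X = (\<lambda>(j::nat) x y. lcomb (\<lambda>_::'i. cos (j * \<theta>)) (\<lambda>_. sin (j * \<theta>)) x y)"
  have \<theta>: "0 \<le> \<theta>" "\<theta> \<le> pi / 2" unfolding \<theta>_def using l by (auto simp: field_simps)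
  have \<rho>: "0 \<le> \<rho>" "\<rho> \<le> 1" "\<bar>\<rho>\<bar> \<le> 1"
    unfolding \<rho>_def using \<theta> pi_ge_zero by (auto intro!: cos_ge_zero)
  have \<mu>0: "\<mu> \<ge> 0" unfolding \<mu>_def by (rule corr_exp_nonneg) (use f01 in fastforce)+
  have s0: "s \<ge> 0" unfolding s_def by (rule corr_exp_nonneg) (use \<rho> in auto)
  have fexp: "mlin I c x = f x" if "x \<in> cube I" for x
    unfolding c_def using fourier_expansion[OF I that] .
  \<comment> \<open>As f takes the values 0 and 1, \<open>\<bar>f x - f y\<bar>\<close> equals its
    own square, so the noise probability is a quadratic form in the Fourier coefficients.\<close>
  have s_eq: "s = (\<Sum>S\<in>Pow I. (c S)\<^sup>2 * (2 - 2 * \<rho> ^ card S))"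
  proof -
    have "s = corr_exp \<rho> I (\<lambda>x y. (mlin I c (lcomb (\<lambda>_. 1) (\<lambda>_. 0) x y) - mlin I c (lcomb (\<lambda>_. 0) (\<lambda>_. 1) x y))\<^sup>2)"
      unfolding s_def
    proof (rule corr_exp_cong)
      fix x y assume "x \<in> cube I" "y \<in> cube I"
      then show "\<bar>f x - f y\<bar> = (mlin I c (lcomb (\<lambda>_. 1) (\<lambda>_. 0) x y) - mlin I c (lcomb (\<lambda>_. 0) (\<lambda>_. 1) x y))\<^sup>2"
        using f01[of x] f01[of y] by (auto simp: fexp)
    qed
    then show ?thesis using corr_exp_mlin_diff_sq[OF I, of 1 0 0 1 \<rho> c] by simp
  qed
  have parseval: "(\<Sum>S\<in>Pow I. (c S)\<^sup>2) = \<mu>"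
  proof -
    have "\<mu> = corr_exp 0 I (\<lambda>x y. (f x)\<^sup>2)"
      unfolding \<mu>_def by (rule corr_exp_cong) (use f01 in fastforce)
    then show ?thesis by (simp add: c_def fourier_parseval[OF I, where \<rho> = 0])
  qed
  have tail: "corr_exp 0 I (\<lambda>x y. (mlin I c' x - f x)\<^sup>2) \<le> s"
  proof -
    have "corr_exp 0 I (\<lambda>x y. (mlin I c' x - f x)\<^sup>2) =
       corr_exp 0 I (\<lambda>x y. (mlin I (\<lambda>S. c' S - c S) x)\<^sup>2)"
    proof (rule corr_exp_cong)
      fix x y assume x: "x \<in> cube I"
      have "mlin I (\<lambda>S. c' S - c S) x = mlin I c' x - mlin I c x"
        unfolding mlin_def by (simp add: sum_subtractf algebra_simps)
      then show "(mlin I c' x - f x)\<^sup>2 = (mlin I (\<lambda>S. c' S - c S) x)\<^sup>2"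
        using fexp[OF x] by simp
    qed
    also have "\<dots> = (\<Sum>S\<in>Pow I. (c' S - c S)\<^sup>2)"
      by (rule corr_exp_mlin_sq[OF I])
    also have "\<dots> \<le> s"
      unfolding s_eq
    proof (rule sum_mono)
      fix S
      show "(c' S - c S)\<^sup>2 \<le> (c S)\<^sup>2 * (2 - 2 * \<rho> ^ card S)"
      proof (cases "card S \<le> l\<^sup>2")
        case True
        then show ?thesis using \<rho> by (simp add: c'_def power_le_one)
      next
        case False
        then have "\<rho> ^ card S \<le> 1 / 2" using cos_power_le_half[OF l, of "card S"] by (simp add: \<rho>_def \<theta>_def)
        then have "(c S)\<^sup>2 * 1 \<le> (c S)\<^sup>2 * (2 - 2 * \<rho> ^ card S)" by (intro mult_left_mono) auto
        then show ?thesis using False by (simp add: c'_def)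
      qed
    qed
    finally show ?thesis .
  qed
  define err where "err = (\<Sum>i\<in>I. (\<Sum>S\<in>Pow (I - {i}). 3 ^ card S * (c' (insert i S))\<^sup>2)\<^sup>2)"
  \<comment> \<open>In each squared weighted influence one factor is bounded by
    \<open>\<kappa>\<close>; the other is summed over i to the total influence, at most l^2 times
    the squared norm \<open>\<mu>\<close>. Squaring the Bonami weight 3^(l^2) gives 9^(l^2).\<close>
  have err: "err \<le> 9 ^ (l\<^sup>2) * \<kappa> * l\<^sup>2 * \<mu>"
  proof -
    define J where "J = (\<lambda>i. \<Sum>S | S \<subseteq> I \<and> i \<in> S. (c' S)\<^sup>2)"
    have J\<kappa>: "J i \<le> \<kappa>" if "i \<in> I" for i
    proof -
      have "J i = (\<Sum>S | S \<subseteq> I \<and> i \<in> S \<and> card S \<le> l\<^sup>2. (c S)\<^sup>2)"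
        unfolding J_def c'_def using I by (intro sum.mono_neutral_cong_right) auto
      then show ?thesis using infl[OF that] by (simp add: c_def)
    qed
    have J0: "J i \<ge> 0" for i unfolding J_def by (intro sum_nonneg) auto
    have inner: "(\<Sum>S\<in>Pow (I - {i}). 3 ^ card S * (c' (insert i S))\<^sup>2) \<le> 3 ^ (l\<^sup>2) * J i" if "i \<in> I" for i
    proof -
      have "(\<Sum>S\<in>Pow (I - {i}). 3 ^ card S * (c' (insert i S))\<^sup>2) \<le> (\<Sum>S\<in>Pow (I - {i}). 3 ^ (l\<^sup>2) * (c' (insert i S))\<^sup>2)"
      proof (rule sum_mono)
        fix S assume S: "S \<in> Pow (I - {i})"
        then have "card S \<le> card (insert i S)" using I by (auto intro!: card_mono finite_subset[of S I])
        then have "3 ^ card S \<le> (3::real) ^ (l\<^sup>2) \<or> c' (insert i S) = 0" unfolding c'_def by auto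
        then show "3 ^ card S * (c' (insert i S))\<^sup>2 \<le> 3 ^ (l\<^sup>2) * (c' (insert i S))\<^sup>2"
          by (auto intro: mult_right_mono)
      qed
      also have "\<dots> = 3 ^ (l\<^sup>2) * J i"
        unfolding J_def sum_Pow_remove_insert[OF I that, of "\<lambda>S. 3 ^ (l\<^sup>2) * (c' S)\<^sup>2"]
        by (simp add: sum_distrib_left)
      finally show ?thesis .
    qed
    have "err \<le> (\<Sum>i\<in>I. 9 ^ (l\<^sup>2) * \<kappa> * J i)"
      unfolding err_def
    proof (rule sum_mono)
      fix i assume i: "i \<in> I"
      have "(\<Sum>S\<in>Pow (I - {i}). 3 ^ card S * (c' (insert i S))\<^sup>2)\<^sup>2 \<le> (3 ^ (l\<^sup>2) * J i)\<^sup>2"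
        by (rule power_mono[OF inner[OF i]]) (intro sum_nonneg, simp)
      also have "\<dots> = 9 ^ (l\<^sup>2) * J i * J i"
      proof -
        have "((3::real) ^ (l\<^sup>2))\<^sup>2 = 9 ^ (l\<^sup>2)" by (simp add: mult.commute flip: power_mult) (simp add: power_mult)
        then show ?thesis by (simp add: power_mult_distrib power2_eq_square)
      qed
      also have "\<dots> \<le> 9 ^ (l\<^sup>2) * \<kappa> * J i" using J\<kappa>[OF i] J0[of i] by (intro mult_right_mono mult_left_mono) auto
      finally show "(\<Sum>S\<in>Pow (I - {i}). 3 ^ card S * (c' (insert i S))\<^sup>2)\<^sup>2 \<le> 9 ^ (l\<^sup>2) * \<kappa> * J i" .
    qed
    also have "\<dots> = 9 ^ (l\<^sup>2) * \<kappa> * (\<Sum>i\<in>I. J i)" by (simp add: sum_distrib_left)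
    also have "(\<Sum>i\<in>I. J i) \<le> l\<^sup>2 * \<mu>"
    proof -
      have "(\<Sum>i\<in>I. J i) = (\<Sum>i\<in>I. \<Sum>S\<in>Pow I. if i \<in> S then (c' S)\<^sup>2 else 0)"
        unfolding J_def using I by (intro sum.cong refl sum.mono_neutral_cong_left) auto
      also have "\<dots> = (\<Sum>S\<in>Pow I. card S * (c' S)\<^sup>2)"
      proof (subst sum.swap, intro sum.cong refl)
        fix S assume "S \<in> Pow I"
        then have "I \<inter> S = S" by auto
        then show "(\<Sum>i\<in>I. if i \<in> S then (c' S)\<^sup>2 else 0) = card S * (c' S)\<^sup>2"
          using I by (simp flip: sum.inter_restrict)
      qed
      also have "\<dots> \<le> (\<Sum>S\<in>Pow I. l\<^sup>2 * (c S)\<^sup>2)"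
        by (intro sum_mono) (auto simp: c'_def intro!: mult_right_mono simp flip: of_nat_power)
      also have "\<dots> = l\<^sup>2 * \<mu>" by (simp add: parseval flip: sum_distrib_left)
      finally show ?thesis .
    qed
    finally show ?thesis using \<kappa> by (simp add: mult.assoc mult_left_mono)
  qed
  have sinX: "corr_exp 0 I (\<lambda>x y. (sin (pi * mlin I c' (X j x y)))\<^sup>2) \<le> pi\<^sup>2 * s + pi ^ 4 * err" for j
  proof -
    \<comment> \<open>The double-angle formula reduces sin^2 to a cosine of frequency 2 pi, to which
      \<open>lindeberg_cos\<close> applies. Its error (2 pi)^4/8 is halved here to pi^4.\<close>
    have dbl: "(sin t)\<^sup>2 = 1 / 2 - 1 / 2 * cos (2 * t)" for t :: real
      using cos_double_sin[of t] by (simp add: field_simps)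
    have Xeq: "mlin I c' (X j x y) = mlin I c' (lcomb (\<lambda>i. if i \<in> I then cos (j * \<theta>) else 1) (\<lambda>i. if i \<in> I then sin (j * \<theta>) else 0) x y)" for x y
      unfolding X_def by (intro mlin_cong) (simp add: lcomb_def)
    have "\<bar>corr_exp 0 I (\<lambda>x y. cos ((2 * pi) * mlin I c' (X j x y))) - corr_exp 0 I (\<lambda>x y. cos ((2 * pi) * mlin I c' x))\<bar>
      \<le> (2 * pi) ^ 4 / 8 * err"
      unfolding Xeq err_def by (rule lindeberg_cos[OF I subset_refl]) simp
    then have 1: "\<bar>corr_exp 0 I (\<lambda>x y. cos (2 * (pi * mlin I c' (X j x y)))) - corr_exp 0 I (\<lambda>x y. cos (2 * (pi * mlin I c' x)))\<bar>
      \<le> 2 * (pi ^ 4 * err)"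
      by (simp add: power_mult_distrib mult.assoc)
    have 2: "corr_exp 0 I (\<lambda>x y. (sin (pi * mlin I c' x))\<^sup>2) \<le> pi\<^sup>2 * s"
    proof -
      have "corr_exp 0 I (\<lambda>x y. (sin (pi * mlin I c' x))\<^sup>2) \<le> corr_exp 0 I (\<lambda>x y. pi\<^sup>2 * (mlin I c' x - f x)\<^sup>2)"
      proof (rule corr_exp_mono)
        fix x y assume x: "x \<in> cube I"
        \<comment> \<open>Subtracting the integer f x from the polynomial changes sin(pi g) at most
          in sign.\<close>
        define e where "e = pi * (mlin I c' x - f x)"
        have "(sin (pi * mlin I c' x))\<^sup>2 = (sin e)\<^sup>2"
          using f01[OF x] by (auto simp: e_def right_diff_distrib sin_diff)
        also have "\<dots> \<le> e\<^sup>2" using abs_sin_x_le_abs_x[of e] by (metis abs_le_square_iff)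
        finally show "(sin (pi * mlin I c' x))\<^sup>2 \<le> pi\<^sup>2 * (mlin I c' x - f x)\<^sup>2"
          by (simp add: e_def power_mult_distrib)
      qed simp
      also have "\<dots> \<le> pi\<^sup>2 * s" unfolding corr_exp_cmult using tail by (intro mult_left_mono) auto
      finally show ?thesis .
    qed
    show ?thesis using 1 2 unfolding dbl corr_exp_diff corr_exp_cmult by (simp add: abs_le_iff)
  qed
  have step: "corr_exp 0 I (\<lambda>x y. \<bar>h (mlin I c' (X j x y)) - h (mlin I c' (X (Suc j) x y))\<bar>)
     \<le> 1 / 4 * (pi\<^sup>2 * s + pi ^ 4 * err) + pi\<^sup>2 / 2 * s" for j
  proof -
    have "corr_exp 0 I (\<lambda>x y. \<bar>h (mlin I c' (X j x y)) - h (mlin I c' (X (Suc j) x y))\<bar>) \<le>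
       corr_exp 0 I (\<lambda>x y. 1 / 4 * (sin (pi * mlin I c' (X j x y)))\<^sup>2 + pi\<^sup>2 / 2 * (mlin I c' (X j x y) - mlin I c' (X (Suc j) x y))\<^sup>2)"
      unfolding h_def by (rule corr_exp_mono) (rule half_cos_diff_le, simp)
    also have "\<dots> = 1 / 4 * corr_exp 0 I (\<lambda>x y. (sin (pi * mlin I c' (X j x y)))\<^sup>2)
       + pi\<^sup>2 / 2 * corr_exp 0 I (\<lambda>x y. (mlin I c' (X j x y) - mlin I c' (X (Suc j) x y))\<^sup>2)"
      by (simp only: corr_exp_add corr_exp_cmult)
    also have "\<dots> \<le> 1 / 4 * (pi\<^sup>2 * s + pi ^ 4 * err) + pi\<^sup>2 / 2 * s"
    proof (intro add_mono mult_left_mono sinX)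
      \<comment> \<open>Consecutive vectors have coordinatewise covariance cos
        \<open>\<theta>\<close> = \<open>\<rho>\<close>. Their squared difference is therefore the
        same quadratic form as the noise probability, with truncated coefficients.\<close>
      have "cos (j * \<theta>) * cos (Suc j * \<theta>) + sin (j * \<theta>) * sin (Suc j * \<theta>) = cos (j * \<theta> - Suc j * \<theta>)"
        by (simp add: cos_diff)
      also have "j * \<theta> - Suc j * \<theta> = - \<theta>" by (simp add: algebra_simps)
      finally have ang: "cos (j * \<theta>) * cos (Suc j * \<theta>) + sin (j * \<theta>) * sin (Suc j * \<theta>) = \<rho>" by (simp add: \<rho>_def)
      have "corr_exp 0 I (\<lambda>x y. (mlin I c' (X j x y) - mlin I c' (X (Suc j) x y))\<^sup>2) = (\<Sum>S\<in>Pow I. (c' S)\<^sup>2 * (2 - 2 * \<rho> ^ card S))"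
        unfolding X_def by (subst corr_exp_mlin_diff_sq[OF I]) (simp_all only: ang, simp_all)
      also have "\<dots> \<le> s" unfolding s_eq using \<rho>
        by (intro sum_mono mult_right_mono) (auto simp: c'_def power_le_one)
      finally show "corr_exp 0 I (\<lambda>x y. (mlin I c' (X j x y) - mlin I c' (X (Suc j) x y))\<^sup>2) \<le> s" .
    qed auto
    finally show ?thesis .
  qed
  have hf: "corr_exp 0 I (\<lambda>x y. \<bar>f x - h (mlin I c' x)\<bar>) \<le> pi\<^sup>2 / 2 * s"
  proof -
    have "corr_exp 0 I (\<lambda>x y. \<bar>f x - h (mlin I c' x)\<bar>) \<le> corr_exp 0 I (\<lambda>x y. pi\<^sup>2 / 2 * (mlin I c' x - f x)\<^sup>2)"
    proof (rule corr_exp_mono)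
      fix x y assume x: "x \<in> cube I"
      \<comment> \<open>At an exact value 0 or 1 the sine term of \<open>half_cos_diff_le\<close>
        disappears and only the squared truncation error remains.\<close>
      have e: "h (f x) = f x" "sin (pi * f x) = 0" using f01[OF x] by (auto simp: h_def)
      have "\<bar>h (f x) - h (mlin I c' x)\<bar> \<le> pi\<^sup>2 / 2 * (f x - mlin I c' x)\<^sup>2"
        using half_cos_diff_le[of "f x" "mlin I c' x"] by (simp add: h_def e(2))
      then show "\<bar>f x - h (mlin I c' x)\<bar> \<le> pi\<^sup>2 / 2 * (mlin I c' x - f x)\<^sup>2"
        by (simp only: e(1) power2_commute)
    qed simp
    also have "\<dots> \<le> pi\<^sup>2 / 2 * s" unfolding corr_exp_cmult using tail by (intro mult_left_mono) auto
    finally show ?thesis .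
  qed
  have hf': "corr_exp 0 I (\<lambda>x y. \<bar>f y - h (mlin I c' y)\<bar>) \<le> pi\<^sup>2 / 2 * s"
    using hf corr_exp_swap[of 0 I "\<lambda>x y. \<bar>f x - h (mlin I c' x)\<bar>"] by simp
  have ends: "X 0 x y = x" "X l x y = y" for x y
    using l by (simp_all add: X_def \<theta>_def)
  have chain: "corr_exp 0 I (\<lambda>x y. \<bar>h (mlin I c' x) - h (mlin I c' y)\<bar>) \<le> l * (1 / 4 * (pi\<^sup>2 * s + pi ^ 4 * err) + pi\<^sup>2 / 2 * s)"
  proof -
    have "corr_exp 0 I (\<lambda>x y. \<bar>h (mlin I c' (X 0 x y)) - h (mlin I c' (X l x y))\<bar>) \<le>
      (\<Sum>j<l. corr_exp 0 I (\<lambda>x y. \<bar>h (mlin I c' (X j x y)) - h (mlin I c' (X (Suc j) x y))\<bar>))"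
      by (rule corr_exp_sum_abs_le[of 0 I "\<lambda>j x y. h (mlin I c' (X j x y))" l]) simp
    also have "\<dots> \<le> (\<Sum>j<l. 1 / 4 * (pi\<^sup>2 * s + pi ^ 4 * err) + pi\<^sup>2 / 2 * s)"
      by (rule sum_mono) (rule step)
    finally show ?thesis unfolding ends by simp
  qed
  have "\<mu> \<le> 2 * \<mu> * (1 - \<mu>)"
    using half mult_left_mono[of 1 "2 * (1 - \<mu>)" \<mu>] \<mu>0 by (simp add: \<mu>_def algebra_simps)
  also have "\<dots> = corr_exp 0 I (\<lambda>x y. \<bar>f x - f y\<bar>)"
  proof -
    have "corr_exp 0 I (\<lambda>x y. \<bar>f x - f y\<bar>) = corr_exp 0 I (\<lambda>x y. f x + f y - 2 * (f x * f y))"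
    proof (rule corr_exp_cong)
      fix x y assume "x \<in> cube I" "y \<in> cube I"
      then show "\<bar>f x - f y\<bar> = f x + f y - 2 * (f x * f y)" using f01[of x] f01[of y] by auto
    qed
    also have "\<dots> = \<mu> + \<mu> - 2 * (\<mu> * \<mu>)"
      using corr_exp_swap[of 0 I "\<lambda>x y. f x"]
      by (simp only: corr_exp_add corr_exp_diff corr_exp_cmult corr_exp_0_prod[OF I] \<mu>_def)
    finally show ?thesis by (simp add: algebra_simps)
  qed
  also have "\<dots> \<le> corr_exp 0 I (\<lambda>x y. \<bar>f x - h (mlin I c' x)\<bar> + \<bar>h (mlin I c' x) - h (mlin I c' y)\<bar> + \<bar>f y - h (mlin I c' y)\<bar>)"
    by (rule corr_exp_mono) auto
  also have "\<dots> \<le> pi\<^sup>2 / 2 * s + l * (1 / 4 * (pi\<^sup>2 * s + pi ^ 4 * err) + pi\<^sup>2 / 2 * s) + pi\<^sup>2 / 2 * s"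
    unfolding corr_exp_add using hf hf' chain by linarith
  also have "\<dots> = pi\<^sup>2 * s * (1 + 3 / 4 * l) + l * pi ^ 4 * err / 4"
    by (simp add: algebra_simps)
  \<comment> \<open>Here (16/5)^2 times 7/4 is below 20 and pi^4 is below 120. Moving
    \<open>\<mu>\<close>/2 to the left then gives the factor 40.\<close>
  also have "\<dots> \<le> 20 * l * s + \<mu> / 2"
  proof (rule add_mono)
    have p2: "pi\<^sup>2 \<le> (16 / 5)\<^sup>2" using pi_le_16_5 by (intro power_mono) auto
    then have "pi\<^sup>2 * s * (1 + 3 / 4 * l) \<le> (16/5)\<^sup>2 * s * (7 / 4 * l)"
      using s0 l by (intro mult_mono) auto
    also have "\<dots> \<le> 20 * l * s" using s0 by (simp add: power2_eq_square mult_nonneg_nonneg)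
    finally show "pi\<^sup>2 * s * (1 + 3 / 4 * l) \<le> 20 * l * s" .
    have "pi ^ 4 \<le> 120"
    proof -
      have "pi ^ 4 \<le> (16 / 5) ^ 4" using pi_le_16_5 by (intro power_mono) auto
      also have "\<dots> \<le> (120 :: real)" by (simp add: power4_eq_xxxx)
      finally show ?thesis .
    qed
    then have "l * pi ^ 4 \<le> real l * 120" by (intro mult_left_mono) auto
    moreover have "err \<ge> 0" unfolding err_def by (intro sum_nonneg) auto
    ultimately have "l * pi ^ 4 * err / 4 \<le> l * 120 * (9 ^ (l\<^sup>2) * \<kappa> * l\<^sup>2 * \<mu>) / 4"
      using err by (intro divide_right_mono mult_mono) auto
    also have "\<dots> = (60 * 9 ^ (l\<^sup>2) * \<kappa> * l ^ 3) * (\<mu> / 2)" by (simp add: power3_eq_cube power2_eq_square)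
    also have "\<dots> \<le> 1 * (\<mu> / 2)" using small \<mu>0 by (intro mult_right_mono) auto
    finally show "l * pi ^ 4 * err / 4 \<le> \<mu> / 2" by simp
  qed
  finally show ?thesis unfolding \<mu>_def[symmetric] s_def \<rho>_def \<theta>_def by simp
qed

section \<open>The cube modulo cyclic shifts\<close>

locale shift_cube =
  fixes m L :: nat
  assumes m_pos: "m > 0"
begin

definition I :: "(nat \<times> nat) set" where "I = {..<m} \<times> {..<L}"
definition rot :: "nat \<Rightarrow> nat \<times> nat \<Rightarrow> nat \<times> nat" where "rot j p = ((fst p + j) mod m, snd p)"
text \<open>The restriction to I keeps shifted points extensional, hence inside
  \<open>cube I\<close>.\<close>

definition sh :: "nat \<Rightarrow> (nat \<times> nat \<Rightarrow> real) \<Rightarrow> nat \<times> nat \<Rightarrow> real" where "sh j x = (\<lambda>p\<in>I. x (rot j p))"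
definition ip :: "(nat \<times> nat \<Rightarrow> real) \<Rightarrow> (nat \<times> nat \<Rightarrow> real) \<Rightarrow> real" where "ip x y = (\<Sum>p\<in>I. x p * y p)"
definition ham :: "(nat \<times> nat \<Rightarrow> real) \<Rightarrow> (nat \<times> nat \<Rightarrow> real) \<Rightarrow> real" where
  "ham x y = (\<Sum>p\<in>I. \<bar>x p - y p\<bar>) / 2"
text \<open>Shifting one argument suffices for the distance of orbits, since shifts preserve
  \<open>ham\<close>.\<close>

definition qd :: "(nat \<times> nat \<Rightarrow> real) \<Rightarrow> (nat \<times> nat \<Rightarrow> real) \<Rightarrow> real" where
  "qd x y = Min ((\<lambda>j. ham x (sh j y)) ` {..<m})"
text \<open>The bound is 1/(1000 m) of the squared norm m L of a cube point, so that all m shifts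
  together contribute at most 1/1000.\<close>

definition good :: "(nat \<times> nat \<Rightarrow> real) \<Rightarrow> bool" where
  "good x \<longleftrightarrow> x \<in> cube I \<and> (\<forall>j\<in>{1..<m}. \<bar>ip x (sh j x)\<bar> \<le> L / 1000)"

section \<open>The shift action, inner products and Hamming distance\<close>

lemma finite_I [simp, intro]: "finite I" by (simp add: I_def)
lemma card_I: "card I = m * L" by (simp add: I_def)

lemma rot_I: "p \<in> I \<Longrightarrow> rot j p \<in> I" using m_pos by (auto simp: I_def rot_def)
lemma rot_rot: "rot j (rot k p) = rot (j + k) p" by (simp add: rot_def mod_add_left_eq ac_simps)
    (metis mod_add_right_eq)
lemma rot_mod: "rot (j mod m) p = rot j p" by (simp add: rot_def mod_add_right_eq)
lemma rot_0: "p \<in> I \<Longrightarrow> rot 0 p = p" by (auto simp: rot_def I_def)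
lemma rot_m: "p \<in> I \<Longrightarrow> rot m p = p" by (auto simp: rot_def I_def)

lemma rot_inverse:
  assumes "p \<in> I" shows "rot (m - j mod m) (rot j p) = p" "rot j (rot (m - j mod m) p) = p"
proof -
  have "(m - j mod m + j mod m) = m" using m_pos by (simp add: less_imp_le)
  then have "rot (m - j mod m) (rot (j mod m) p) = p" "rot (j mod m) (rot (m - j mod m) p) = p"
    using assms by (simp_all add: rot_rot rot_m add.commute)
  then show "rot (m - j mod m) (rot j p) = p" "rot j (rot (m - j mod m) p) = p" by (simp_all add: rot_mod)
qed

lemma sum_rot: "(\<Sum>p\<in>I. F (rot j p)) = (\<Sum>p\<in>I. F p)"
  by (rule sum.reindex_bij_witness[of _ "rot (m - j mod m)" "rot j"]) (auto simp: rot_I rot_inverse)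

lemma inj_on_rot: "S \<subseteq> I \<Longrightarrow> inj_on (rot j) S"
  by (rule inj_on_inverseI[where g = "rot (m - j mod m)"]) (auto simp: rot_inverse)

lemma sh_apply [simp]: "p \<in> I \<Longrightarrow> sh j x p = x (rot j p)" by (simp add: sh_def)

lemma sh_cube: "x \<in> cube I \<Longrightarrow> sh j x \<in> cube I"
  unfolding cube_def sh_def using rot_I by (intro PiE_I) (auto dest: PiE_mem)

lemma sh_sh: "sh j (sh k x) = sh (j + k) x"
  by (auto simp: sh_def rot_I rot_rot add.commute fun_eq_iff)

lemma sh_mod: "sh (j mod m) x = sh j x" by (simp add: sh_def rot_mod)

lemma sh_0: "x \<in> cube I \<Longrightarrow> sh 0 x = x"
  by (rule cube_eqI[OF sh_cube]) (auto simp: rot_0)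

lemma sh_inverse:
  assumes "x \<in> cube I" shows "sh (m - j mod m) (sh j x) = x" "sh j (sh (m - j mod m) x) = x"
  using assms by (auto intro!: cube_eqI[of _ I] sh_cube simp: rot_inverse rot_I)

lemma sum_sh: "(\<Sum>x\<in>cube I. F (sh j x)) = (\<Sum>x\<in>cube I. F x)"
  by (rule sum.reindex_bij_witness[of _ "sh (m - j mod m)" "sh j"]) (auto simp: sh_cube sh_inverse)

lemma ip_sh: "ip (sh j x) (sh j y) = ip x y"
  unfolding ip_def using sum_rot[of "\<lambda>p. x p * y p" j] by simp

lemma ham_sh: "ham (sh j x) (sh j y) = ham x y"
  unfolding ham_def using sum_rot[of "\<lambda>p. \<bar>x p - y p\<bar>" j] by simp

lemma ip_commute: "ip x y = ip y x" by (simp add: ip_def mult.commute)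
lemma ham_commute: "ham x y = ham y x" by (simp add: ham_def abs_minus_commute)
lemma ham_nonneg: "0 \<le> ham x y" by (simp add: ham_def sum_nonneg)

lemma ham_triangle: "ham x z \<le> ham x y + ham y z"
proof -
  have "(\<Sum>p\<in>I. \<bar>x p - z p\<bar>) \<le> (\<Sum>p\<in>I. \<bar>x p - y p\<bar> + \<bar>y p - z p\<bar>)" by (rule sum_mono) simp
  then show ?thesis by (simp add: ham_def sum.distrib)
qed

lemma ham_eq_0: "x \<in> cube I \<Longrightarrow> y \<in> cube I \<Longrightarrow> ham x y = 0 \<Longrightarrow> x = y"
  by (rule cube_eqI[of _ I]) (auto simp: ham_def sum_nonneg_eq_0_iff)

lemma ham_self [simp]: "ham x x = 0" by (simp add: ham_def)

lemma ip_ham: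
  assumes "x \<in> cube I" "y \<in> cube I" shows "ip x y = m * L - 2 * ham x y"
proof -
  have "ip x y = (\<Sum>p\<in>I. 1 - \<bar>x p - y p\<bar>)"
    unfolding ip_def
  proof (intro sum.cong refl)
    fix p assume "p \<in> I"
    then show "x p * y p = 1 - \<bar>x p - y p\<bar>" using cube_mem[OF assms(1)] cube_mem[OF assms(2)] by fastforce
  qed
  then show ?thesis by (simp add: sum_subtractf card_I ham_def)
qed

lemma ip_diff_le: "x \<in> cube I \<Longrightarrow> \<bar>ip x y - ip x z\<bar> \<le> 2 * ham y z"
proof -
  assume x: "x \<in> cube I"
  have "\<bar>ip x y - ip x z\<bar> = \<bar>\<Sum>p\<in>I. x p * (y p - z p)\<bar>"
    by (simp add: ip_def algebra_simps sum_subtractf)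
  also have "\<dots> \<le> (\<Sum>p\<in>I. \<bar>x p * (y p - z p)\<bar>)" by (rule sum_abs)
  also have "\<dots> = (\<Sum>p\<in>I. \<bar>y p - z p\<bar>)" by (intro sum.cong refl) (simp add: abs_mult cube_abs[OF x])
  finally show ?thesis by (simp add: ham_def)
qed

section \<open>The quotient metric and good points\<close>

lemma qd_le: "qd x y \<le> ham x (sh j y)"
proof -
  have "ham x (sh (j mod m) y) \<in> (\<lambda>j. ham x (sh j y)) ` {..<m}" using m_pos by auto
  then show ?thesis unfolding qd_def by (auto simp: sh_mod intro!: Min_le)
qed

lemma qd_attained: "\<exists>j<m. qd x y = ham x (sh j y)"
proof -
  have "qd x y \<in> (\<lambda>j. ham x (sh j y)) ` {..<m}" unfolding qd_def using m_pos by (intro Min_in) auto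
  then show ?thesis by auto
qed

lemma qd_nonneg: "0 \<le> qd x y"
  using qd_attained[of x y] ham_nonneg by metis

lemma qd_le_swap: "x \<in> cube I \<Longrightarrow> y \<in> cube I \<Longrightarrow> qd x y \<le> qd y x"
proof -
  assume xy: "x \<in> cube I" "y \<in> cube I"
  obtain j where j: "qd y x = ham y (sh j x)" using qd_attained by blast
  have "qd x y \<le> ham x (sh (m - j mod m) y)" by (rule qd_le)
  also have "\<dots> = ham (sh j x) (sh j (sh (m - j mod m) y))" by (simp add: ham_sh)
  also have "\<dots> = ham y (sh j x)" using xy by (simp add: sh_inverse ham_commute)
  finally show ?thesis using j by simp
qed

lemma qd_commute: "x \<in> cube I \<Longrightarrow> y \<in> cube I \<Longrightarrow> qd x y = qd y x"
  using qd_le_swap by (simp add: order_antisym)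

lemma qd_triangle: "qd x z \<le> qd x y + qd y z"
proof -
  obtain j where j: "qd x y = ham x (sh j y)" using qd_attained by blast
  obtain k where k: "qd y z = ham y (sh k z)" using qd_attained by blast
  have "qd x z \<le> ham x (sh (j + k) z)" by (rule qd_le)
  also have "\<dots> \<le> ham x (sh j y) + ham (sh j y) (sh j (sh k z))"
    by (simp add: ham_triangle flip: sh_sh)
  finally show ?thesis using j k by (simp add: ham_sh)
qed

lemma qd_sh_right: "qd x (sh j y) = qd x y" if "x \<in> cube I" "y \<in> cube I"
proof (rule order_antisym)
  obtain k where k: "qd x y = ham x (sh k y)" using qd_attained by blast
  have "qd x (sh j y) \<le> ham x (sh (k + (m - j mod m)) (sh j y))" by (rule qd_le)
  also have "\<dots> = ham x (sh k y)" using that by (simp add: sh_inverse flip: sh_sh)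
  finally show "qd x (sh j y) \<le> qd x y" using k by simp
  obtain k where k: "qd x (sh j y) = ham x (sh k (sh j y))" using qd_attained by blast
  have "qd x y \<le> ham x (sh (k + j) y)" by (rule qd_le)
  then show "qd x y \<le> qd x (sh j y)" using k by (simp add: sh_sh)
qed

lemma good_cube: "good x \<Longrightarrow> x \<in> cube I" by (simp add: good_def)

lemma good_sh: "good x \<Longrightarrow> good (sh j x)"
proof -
  have "ip (sh j x) (sh i (sh j x)) = ip x (sh i x)" for i
    using ip_sh[of j x "sh i x"] by (simp add: sh_sh add.commute)
  then show "good x \<Longrightarrow> good (sh j x)" by (simp add: good_def sh_cube)
qed

lemma good_sh_iff: "x \<in> cube I \<Longrightarrow> good (sh j x) \<longleftrightarrow> good x"
  using good_sh[of "sh j x" "m - j mod m"] good_sh[of x j] by (auto simp: sh_inverse)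

section \<open>Shift-invariant functions\<close>

lemma fourier_rot:
  assumes "\<And>x. x \<in> cube I \<Longrightarrow> f (sh j x) = f x" "S \<subseteq> I"
  shows "fourier I f (rot j ` S) = fourier I f S"
proof -
  have "(\<Sum>x\<in>cube I. f x * (\<Prod>i\<in>rot j ` S. x i)) = (\<Sum>x\<in>cube I. f (sh j x) * (\<Prod>i\<in>S. sh j x i))"
  proof (intro sum.cong refl)
    fix x assume "x \<in> cube I"
    moreover have "(\<Prod>i\<in>S. x (rot j i)) = (\<Prod>i\<in>S. sh j x i)" using assms(2) by (intro prod.cong) auto
    ultimately show "f x * (\<Prod>i\<in>rot j ` S. x i) = f (sh j x) * (\<Prod>i\<in>S. sh j x i)"
      using assms by (simp add: prod.reindex[OF inj_on_rot])
  qed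
  then show ?thesis unfolding fourier_def using sum_sh[of "\<lambda>x. f x * (\<Prod>i\<in>S. x i)" j] by simp
qed

text \<open>The m shifts of i are distinct and have equal influence. In the sum of these influences
  a set S is counted at most |S| times, hence at most d times.\<close>

lemma invariant_influence:
  assumes inv: "\<And>j x. x \<in> cube I \<Longrightarrow> f (sh j x) = f x" and i: "i \<in> I"
  shows "m * (\<Sum>S | S \<subseteq> I \<and> i \<in> S \<and> card S \<le> d. (fourier I f S)\<^sup>2) \<le> d * corr_exp 0 I (\<lambda>x y. (f x)\<^sup>2)"
proof -
  define J where "J = (\<lambda>i. \<Sum>S | S \<subseteq> I \<and> i \<in> S \<and> card S \<le> d. (fourier I f S)\<^sup>2)"
  have J: "J (rot j i) = J i" for j
    unfolding J_def
  proof (rule sum.reindex_bij_witness[of _ "image (rot j)" "image (rot (m - j mod m))"])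
    fix S assume S: "S \<in> {S. S \<subseteq> I \<and> rot j i \<in> S \<and> card S \<le> d}"
    have "i \<in> rot (m - j mod m) ` S" using S i rot_inverse(1)[OF i, of j] by (metis (mono_tags) image_eqI mem_Collect_eq)
    then show "rot (m - j mod m) ` S \<in> {S. S \<subseteq> I \<and> i \<in> S \<and> card S \<le> d}"
      using S by (auto simp: rot_I card_image[OF inj_on_rot])
    show "rot j ` rot (m - j mod m) ` S = S" using S by (force simp: image_image rot_inverse)
    show "(fourier I f (rot (m - j mod m) ` S))\<^sup>2 = (fourier I f S)\<^sup>2" using S inv by (simp add: fourier_rot)
  next
    fix S assume S: "S \<in> {S. S \<subseteq> I \<and> i \<in> S \<and> card S \<le> d}"
    then show "rot j ` S \<in> {S. S \<subseteq> I \<and> rot j i \<in> S \<and> card S \<le> d}"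
      by (auto simp: rot_I card_image[OF inj_on_rot])
    show "rot (m - j mod m) ` rot j ` S = S" using S by (force simp: image_image rot_inverse)
  qed
  have inj: "inj_on (\<lambda>j. rot j i) {..<m}"
  proof (rule inj_onI)
    fix j k assume jk: "j \<in> {..<m}" "k \<in> {..<m}" "rot j i = rot k i"
    have *: "(m - fst i + (fst i + j) mod m) mod m = j" if "j < m" for j
    proof -
      have "m - fst i + (fst i + j) = m + j" using i by (auto simp: I_def)
      then show ?thesis using that by (simp only: mod_add_right_eq) simp
    qed
    from jk have "(fst i + j) mod m = (fst i + k) mod m" by (simp add: rot_def)
    then show "j = k" using *[of j] *[of k] jk(1,2) by (metis lessThan_iff)
  qed
  have "m * J i = (\<Sum>j<m. J (rot j i))" by (simp add: J)
  also have "\<dots> = (\<Sum>j<m. \<Sum>S\<in>Pow I. if rot j i \<in> S \<and> card S \<le> d then (fourier I f S)\<^sup>2 else 0)"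
    unfolding J_def by (intro sum.cong refl sum.mono_neutral_cong_left) auto
  also have "\<dots> = (\<Sum>S\<in>Pow I. \<Sum>j<m. if rot j i \<in> S \<and> card S \<le> d then (fourier I f S)\<^sup>2 else 0)"
    by (rule sum.swap)
  also have "\<dots> \<le> (\<Sum>S\<in>Pow I. d * (fourier I f S)\<^sup>2)"
  proof (rule sum_mono)
    fix S assume "S \<in> Pow I"
    then have fS: "finite S" using finite_subset by auto
    have "card {j\<in>{..<m}. rot j i \<in> S} \<le> card S"
      by (rule card_inj_on_le[of "\<lambda>j. rot j i"]) (use inj fS in \<open>auto intro: inj_on_subset\<close>)
    moreover have "(\<Sum>j<m. if rot j i \<in> S \<and> card S \<le> d then (fourier I f S)\<^sup>2 else 0) =
       (if card S \<le> d then card {j\<in>{..<m}. rot j i \<in> S} * (fourier I f S)\<^sup>2 else 0)"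
      by (auto simp: sum.If_cases Int_def)
    ultimately show "(\<Sum>j<m. if rot j i \<in> S \<and> card S \<le> d then (fourier I f S)\<^sup>2 else 0) \<le> d * (fourier I f S)\<^sup>2"
      by (auto intro!: mult_right_mono)
  qed
  also have "\<dots> = d * corr_exp 0 I (\<lambda>x y. (f x)\<^sup>2)"
    by (simp add: fourier_parseval flip: sum_distrib_left)
  finally show ?thesis unfolding J_def .
qed

text \<open>Invariance allows the influence bound l^2/m, and substituting it for
  \<open>\<kappa>\<close> turns l^3 into the l^5 of the condition on m.\<close>

theorem invariant_isoperimetry:
  assumes inv: "\<And>j x. x \<in> cube I \<Longrightarrow> f (sh j x) = f x" and f01: "\<And>x. x \<in> cube I \<Longrightarrow> f x = 0 \<or> f x = 1"
    and half: "corr_exp 0 I (\<lambda>x y. f x) \<le> 1 / 2" and l: "l \<ge> 1" and m: "60 * 9 ^ (l\<^sup>2) * l ^ 5 \<le> m"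
  shows "corr_exp 0 I (\<lambda>x y. f x) \<le> 40 * real l * corr_exp (cos (pi / (2 * l))) I (\<lambda>x y. \<bar>f x - f y\<bar>)"
proof (rule cube_isoperimetry[where \<kappa> = "l\<^sup>2 / m"])
  have "corr_exp 0 I (\<lambda>x y. (f x)\<^sup>2) = corr_exp 0 I (\<lambda>x y. f x)"
    by (rule corr_exp_cong) (use f01 in force)
  then have e: "corr_exp 0 I (\<lambda>x y. (f x)\<^sup>2) \<le> 1" using half by simp
  fix i assume "i \<in> I"
  from invariant_influence[of f, OF inv this, of "l\<^sup>2"]
  have "m * (\<Sum>S | S \<subseteq> I \<and> i \<in> S \<and> card S \<le> l\<^sup>2. (fourier I f S)\<^sup>2) \<le> l\<^sup>2 * corr_exp 0 I (\<lambda>x y. (f x)\<^sup>2)" .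
  also have "\<dots> \<le> real (l\<^sup>2) * 1" using e by (intro mult_left_mono) auto
  finally show "(\<Sum>S | S \<subseteq> I \<and> i \<in> S \<and> card S \<le> l\<^sup>2. (fourier I f S)\<^sup>2) \<le> l\<^sup>2 / m"
    using m_pos by (simp add: field_simps)
next
  have "60 * 9 ^ (l\<^sup>2) * (l\<^sup>2 / m) * l ^ 3 = real (60 * 9 ^ (l\<^sup>2) * l ^ 5) / m"
    by (simp add: power2_eq_square power3_eq_cube eval_nat_numeral)
  also have "\<dots> \<le> 1" using m m_pos by (simp only: of_nat_le_iff divide_le_eq_1) simp
  finally show "60 * 9 ^ (l\<^sup>2) * (l\<^sup>2 / m) * l ^ 3 \<le> 1" .
qed (use assms in auto)

end

section \<open>Concentration of autocorrelations\<close>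

text \<open>The expectation over y conditioned on x. Averages over both points would not do: every
  single good x has to stay good with high probability.\<close>

definition noise_mean :: "real \<Rightarrow> 'i set \<Rightarrow> ('i \<Rightarrow> real) \<Rightarrow> (('i \<Rightarrow> real) \<Rightarrow> real) \<Rightarrow> real" where
  "noise_mean \<rho> I x F = (\<Sum>y\<in>cube I. (\<Prod>i\<in>I. (1 + \<rho> * x i * y i) / 2) * F y)"

lemma corr_exp_noise_mean: "corr_exp \<rho> I G = (\<Sum>x\<in>cube I. noise_mean \<rho> I x (G x)) / 2 ^ card I"
proof -
  have "(\<Prod>i\<in>I. (1 + \<rho> * x i * y i) / 4) = (\<Prod>i\<in>I. (1 + \<rho> * x i * y i) / 2) / 2 ^ card I" for x y :: "'a \<Rightarrow> real"
    by (subst prod_constant[symmetric], subst prod_dividef[symmetric]) simp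
  then show ?thesis
    unfolding corr_exp_def noise_mean_def by (simp add: sum_divide_distrib)
qed

lemma noise_mean_add: "noise_mean \<rho> I x (\<lambda>y. F y + G y) = noise_mean \<rho> I x F + noise_mean \<rho> I x G"
  unfolding noise_mean_def by (simp add: algebra_simps sum.distrib)

lemma noise_mean_diff: "noise_mean \<rho> I x (\<lambda>y. F y - G y) = noise_mean \<rho> I x F - noise_mean \<rho> I x G"
  unfolding noise_mean_def by (simp add: algebra_simps sum_subtractf)

lemma noise_mean_cmult: "noise_mean \<rho> I x (\<lambda>y. k * F y) = k * noise_mean \<rho> I x F"
  unfolding noise_mean_def by (simp add: sum_distrib_left mult.left_commute)

lemma noise_mean_sum: "noise_mean \<rho> I x (\<lambda>y. \<Sum>t\<in>T. F t y) = (\<Sum>t\<in>T. noise_mean \<rho> I x (F t))"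
  by (induction T rule: infinite_finite_induct)
     (auto simp: noise_mean_add, simp_all add: noise_mean_def)

lemma noise_mean_mono:
  assumes "x \<in> cube I" "\<bar>\<rho>\<bar> \<le> 1" "\<And>y. y \<in> cube I \<Longrightarrow> F y \<le> G y"
  shows "noise_mean \<rho> I x F \<le> noise_mean \<rho> I x G"
  unfolding noise_mean_def
proof (intro sum_mono mult_left_mono prod_nonneg)
  fix y i assume "y \<in> cube I" "i \<in> I"
  then show "0 \<le> (1 + \<rho> * x i * y i) / 2"
    using cube_mem[of x I i] cube_mem[of y I i] assms by auto
qed (use assms in auto)

text \<open>The sum over y factors: a coordinate in S contributes its conditional mean
  \<open>\<rho>\<close> x_i, any other coordinate contributes 1.\<close>

lemma noise_mean_monomial:
  assumes "finite I" "x \<in> cube I" "S \<subseteq> I"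
  shows "noise_mean \<rho> I x (\<lambda>y. \<Prod>i\<in>S. y i) = \<rho> ^ card S * (\<Prod>i\<in>S. x i)"
proof -
  have prod_S: "(\<Prod>i\<in>S. g i) = (\<Prod>i\<in>I. if i \<in> S then g i else 1)" for g :: "'a \<Rightarrow> real"
    using assms by (simp add: prod.inter_restrict[symmetric] Int_absorb1)
  have "noise_mean \<rho> I x (\<lambda>y. \<Prod>i\<in>S. y i) = (\<Sum>y\<in>cube I. \<Prod>i\<in>I. (1 + \<rho> * x i * y i) / 2 * (if i \<in> S then y i else 1))"
    unfolding noise_mean_def prod_S by (simp only: prod.distrib)
  also have "\<dots> = (\<Prod>i\<in>I. if i \<in> S then \<rho> * x i else 1)"
    by (subst sum_cube_prod[OF assms(1)]) (intro prod.cong refl, auto simp: field_simps)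
  also have "\<dots> = (\<Prod>i\<in>S. \<rho> * x i)" by (rule prod_S[symmetric])
  finally show ?thesis by (simp add: prod.distrib)
qed

lemma noise_mean_const: "finite I \<Longrightarrow> x \<in> cube I \<Longrightarrow> noise_mean \<rho> I x (\<lambda>y. k) = k"
  using noise_mean_monomial[of I x "{}" \<rho>] noise_mean_cmult[of \<rho> I x k "\<lambda>_. 1"] by simp

context shift_cube
begin

text \<open>A conditional variance. The autocorrelation is a sum of m L products \<open>t p\<close>
  of two distinct coordinates, with conditional means \<open>\<rho>\<close>^2 t_p(x). Two such
  products are uncorrelated unless they share a coordinate; each p has at most three such partners,
  and each pair costs at most 2.\<close>

lemma noise_mean_autocorrelation:
  assumes x: "x \<in> cube I" and \<rho>: "0 \<le> \<rho>" "\<rho> \<le> 1" and j: "0 < j" "j < m"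
  shows "noise_mean \<rho> I x (\<lambda>y. (ip y (sh j y) - \<rho>\<^sup>2 * ip x (sh j x))\<^sup>2) \<le> 6 * (m * L)"
proof -
  define t where "t = (\<lambda>p (y :: nat \<times> nat \<Rightarrow> real). y p * y (rot j p))"
  let ?N = "noise_mean \<rho> I x"
  have ip_t: "ip y (sh j y) = (\<Sum>p\<in>I. t p y)" for y
    by (simp add: ip_def t_def)
  have ne: "p \<noteq> rot j p" if "p \<in> I" for p
  proof
    assume "p = rot j p"
    then have "(fst p + j) mod m = fst p" by (metis fst_conv rot_def)
    moreover have "fst p < m" using that by (auto simp: I_def)
    ultimately show False using j by (cases "fst p + j < m") (auto simp: le_mod_geq)
  qed
  have t1: "\<bar>t p y\<bar> = 1" if "p \<in> I" "y \<in> cube I" for p y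
    using that by (simp add: t_def abs_mult cube_abs rot_I)
  have t_le: "t p y * t q y \<le> 1" if "p \<in> I" "q \<in> I" "y \<in> cube I" for p q y
    using abs_le_D1[of "t p y * t q y" 1] t1 that by (simp add: abs_mult)
  have t_set: "t p y = (\<Prod>i\<in>{p, rot j p}. y i)" if "p \<in> I" for p y
    using ne[OF that] by (simp add: t_def)
  have Nt: "?N (t p) = \<rho>\<^sup>2 * t p x" if "p \<in> I" for p
    using noise_mean_monomial[OF finite_I x, of "{p, rot j p}" \<rho>] that ne[OF that]
    by (simp add: t_def rot_I power2_eq_square)
  \<comment> \<open>The set contains every q for which {q, rot j q} can meet {p, rot j p}; its last
    element is p shifted back by j.\<close>
  define B where "B = (\<lambda>p. {p, rot j p, rot (m - j mod m) p})"
  have cov: "?N (\<lambda>y. t p y * t q y) - \<rho> ^ 4 * (t p x * t q x) \<le> (if q \<in> B p then 2 else 0)"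
    if pq: "p \<in> I" "q \<in> I" for p q
  proof (cases "q \<in> B p")
    case True
    have "?N (\<lambda>y. t p y * t q y) \<le> ?N (\<lambda>y. 1)"
      using \<rho> t_le pq by (intro noise_mean_mono x) auto
    moreover have "- (\<rho> ^ 4 * (t p x * t q x)) \<le> 1"
    proof -
      have "\<bar>\<rho> ^ 4 * (t p x * t q x)\<bar> = \<rho> ^ 4" using t1 pq x \<rho> by (simp add: abs_mult)
      also have "\<dots> \<le> 1" using \<rho> by (simp add: power_le_one)
      finally show ?thesis by linarith
    qed
    ultimately show ?thesis using True by (simp add: noise_mean_const x)
  next
    case False
    have disj: "{p, rot j p} \<inter> {q, rot j q} = {}"
      using False rot_inverse(1)[OF pq(1), of j] rot_inverse(1)[OF pq(2), of j]
      unfolding B_def by auto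
    have c4: "card ({p, rot j p} \<union> {q, rot j q}) = 4"
      using disj ne pq by (subst card_Un_disjoint) auto
    have tt: "t p y * t q y = (\<Prod>i\<in>{p, rot j p} \<union> {q, rot j q}. y i)" for y
      unfolding t_set[OF pq(1)] t_set[OF pq(2)] using disj by (subst prod.union_disjoint) auto
    have "?N (\<lambda>y. t p y * t q y) = \<rho> ^ 4 * (t p x * t q x)"
      unfolding tt using noise_mean_monomial[OF finite_I x, of "{p, rot j p} \<union> {q, rot j q}" \<rho>] pq rot_I
      unfolding c4 by auto
    then show ?thesis using False by simp
  qed
  have "?N (\<lambda>y. (ip y (sh j y) - \<rho>\<^sup>2 * ip x (sh j x))\<^sup>2) =
      ?N (\<lambda>y. (\<Sum>p\<in>I. \<Sum>q\<in>I. t p y * t q y) - (2 * \<rho>\<^sup>2 * ip x (sh j x)) * (\<Sum>p\<in>I. t p y) + (\<rho>\<^sup>2 * ip x (sh j x))\<^sup>2 * 1)"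
    unfolding ip_t by (rule arg_cong[of _ _ ?N]) (auto simp: power2_eq_square algebra_simps sum_product)
  also have "\<dots> = (\<Sum>p\<in>I. \<Sum>q\<in>I. ?N (\<lambda>y. t p y * t q y)) - 2 * \<rho>\<^sup>2 * ip x (sh j x) * (\<Sum>p\<in>I. ?N (t p)) + (\<rho>\<^sup>2 * ip x (sh j x))\<^sup>2"
    by (simp only: noise_mean_add noise_mean_diff noise_mean_cmult noise_mean_sum noise_mean_const[OF finite_I x] mult_1_right)
  also have "(\<Sum>p\<in>I. ?N (t p)) = \<rho>\<^sup>2 * ip x (sh j x)"
    by (simp add: Nt ip_t sum_distrib_left)
  also have "(\<Sum>p\<in>I. \<Sum>q\<in>I. ?N (\<lambda>y. t p y * t q y)) - 2 * \<rho>\<^sup>2 * ip x (sh j x) * (\<rho>\<^sup>2 * ip x (sh j x)) + (\<rho>\<^sup>2 * ip x (sh j x))\<^sup>2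
     = (\<Sum>p\<in>I. \<Sum>q\<in>I. ?N (\<lambda>y. t p y * t q y)) - \<rho> ^ 4 * (\<Sum>p\<in>I. \<Sum>q\<in>I. t p x * t q x)"
    unfolding ip_t sum_product[symmetric] by algebra
  also have "\<dots> = (\<Sum>p\<in>I. \<Sum>q\<in>I. ?N (\<lambda>y. t p y * t q y) - \<rho> ^ 4 * (t p x * t q x))"
    by (simp add: sum_subtractf sum_distrib_left)
  also have "\<dots> \<le> (\<Sum>p\<in>I. \<Sum>q\<in>I. if q \<in> B p then 2 else 0)"
    by (intro sum_mono cov)
  also have "\<dots> \<le> (\<Sum>p\<in>I. 6)"
  proof (rule sum_mono)
    fix p
    have "card (I \<inter> B p) \<le> card (B p)" by (intro card_mono) (auto simp: B_def)
    also have "\<dots> \<le> 3" unfolding B_def by (simp add: card_insert_if)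
    finally have "card (I \<inter> B p) \<le> 3" .
    then show "(\<Sum>q\<in>I. if q \<in> B p then 2 else 0) \<le> (6::real)"
      by (simp flip: sum.inter_restrict)
  qed
  also have "\<dots> = 6 * (m * L)" by (simp add: card_I)
  finally show ?thesis .
qed

text \<open>Noise multiplies the expected autocorrelations by \<open>\<rho>\<close>^2, so those of a
  good x leave a margin of (1 - \<open>\<rho>\<close>^2) L/1000 below the threshold. Chebyshev's
  inequality and a union bound over the shifts do the rest. At \<open>\<rho>\<close> = 0 the means
  vanish, and x may be arbitrary.\<close>

lemma noise_mean_not_good:
  fixes \<rho> :: real
  assumes x: "x \<in> cube I" and \<rho>: "0 \<le> \<rho>" "\<rho> < 1" and g: "good x \<or> \<rho> = 0" and L: "L > 0"
  shows "noise_mean \<rho> I x (\<lambda>y. of_bool (\<not> good y)) \<le> 6 * 10 ^ 6 * (real m)\<^sup>2 / (L * (1 - \<rho>\<^sup>2)\<^sup>2)"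
proof -
  define T where "T = real L / 1000"
  have r: "1 - \<rho>\<^sup>2 > 0" using \<rho> by (simp add: abs_square_less_1)
  have T: "T > 0" using L by (simp add: T_def)
  define k where "k = 1 / (T * (1 - \<rho>\<^sup>2))\<^sup>2"
  have k0: "k \<ge> 0" by (simp add: k_def)
  have pt: "of_bool (\<not> good y) \<le> (\<Sum>j\<in>{1..<m}. k * (ip y (sh j y) - \<rho>\<^sup>2 * ip x (sh j x))\<^sup>2)"
    if y: "y \<in> cube I" for y
  proof (cases "good y")
    case False
    then obtain j where j: "j \<in> {1..<m}" "\<bar>ip y (sh j y)\<bar> > T" using y by (auto simp: good_def T_def not_le)
    have "\<bar>ip x (sh j x)\<bar> \<le> T \<or> \<rho> = 0"
      using g j by (auto simp: good_def T_def)
    then have "\<rho>\<^sup>2 * \<bar>ip x (sh j x)\<bar> \<le> \<rho>\<^sup>2 * T"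
      by (auto intro: mult_left_mono)
    then have "\<bar>\<rho>\<^sup>2 * ip x (sh j x)\<bar> \<le> \<rho>\<^sup>2 * T" by (simp add: abs_mult)
    with j(2) have "T * (1 - \<rho>\<^sup>2) \<le> \<bar>ip y (sh j y) - \<rho>\<^sup>2 * ip x (sh j x)\<bar>"
      by (simp add: algebra_simps)
    then have "(T * (1 - \<rho>\<^sup>2))\<^sup>2 \<le> (ip y (sh j y) - \<rho>\<^sup>2 * ip x (sh j x))\<^sup>2"
      using T r by (intro abs_le_square_iff[THEN iffD1]) (simp add: abs_mult)
    then have "1 \<le> k * (ip y (sh j y) - \<rho>\<^sup>2 * ip x (sh j x))\<^sup>2"
      using T r by (simp add: k_def field_simps)
    also have "\<dots> \<le> (\<Sum>j\<in>{1..<m}. k * (ip y (sh j y) - \<rho>\<^sup>2 * ip x (sh j x))\<^sup>2)"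
      by (rule member_le_sum) (use j k0 in auto)
    finally show ?thesis by simp
  qed (use k0 in \<open>auto intro!: sum_nonneg\<close>)
  have "noise_mean \<rho> I x (\<lambda>y. of_bool (\<not> good y)) \<le>
      noise_mean \<rho> I x (\<lambda>y. \<Sum>j\<in>{1..<m}. k * (ip y (sh j y) - \<rho>\<^sup>2 * ip x (sh j x))\<^sup>2)"
    using \<rho> pt by (intro noise_mean_mono x) auto
  also have "\<dots> = (\<Sum>j\<in>{1..<m}. k * noise_mean \<rho> I x (\<lambda>y. (ip y (sh j y) - \<rho>\<^sup>2 * ip x (sh j x))\<^sup>2))"
    by (simp only: noise_mean_sum noise_mean_cmult)
  also have "\<dots> \<le> (\<Sum>j\<in>{1..<m}. k * (6 * (m * L)))"
    using k0 \<rho> by (intro sum_mono mult_left_mono noise_mean_autocorrelation x) auto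
  also have "\<dots> \<le> m * (k * (6 * (m * L)))"
    using k0 by (simp add: mult_right_mono)
  also have "\<dots> = 6 * 10 ^ 6 * (real m)\<^sup>2 / (L * (1 - \<rho>\<^sup>2)\<^sup>2)"
  proof -
    have "m * (1 / (real L / 1000 * R)\<^sup>2 * (6 * (m * L))) = 6 * 10 ^ 6 * (real m)\<^sup>2 / (L * R\<^sup>2)" if "R > 0" for R :: real
      using that L by (simp add: power2_eq_square field_simps)
    from this[OF r] show ?thesis unfolding k_def T_def .
  qed
  finally show ?thesis .
qed

text \<open>For uniform y each inner product with a shift has second moment K = m L, while distance
  below K/4 forces it to be at least K/2. Chebyshev's inequality gives 4/K per shift, and there are
  m shifts.\<close>

lemma noise_mean_close:
  assumes x: "x \<in> cube I" and L: "L > 0"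
  shows "noise_mean 0 I x (\<lambda>y. of_bool (qd x y < m * L / 4)) \<le> 4 / L"
proof -
  define K where "K = real (m * L)"
  have K: "K > 0" using L m_pos by (simp add: K_def)
  have sq: "noise_mean 0 I x (\<lambda>y. (ip x (sh j y))\<^sup>2) = K" for j
  proof -
    have N: "noise_mean 0 I x (\<lambda>y. y (rot j p) * y (rot j q)) = (if p = q then 1 else 0)" if pq: "p \<in> I" "q \<in> I" for p q
    proof (cases "p = q")
      case True
      have "noise_mean 0 I x (\<lambda>y. y (rot j p) * y (rot j q)) = noise_mean 0 I x (\<lambda>y. 1)"
        unfolding noise_mean_def using True pq by (intro sum.cong refl) (simp add: cube_sq rot_I)
      then show ?thesis using True by (simp add: noise_mean_const x)
    next
      case False
      then have "rot j p \<noteq> rot j q" using inj_on_rot[of I j] pq by (auto simp: inj_on_def)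
      then show ?thesis
        using noise_mean_monomial[OF finite_I x, of "{rot j p, rot j q}" 0] False pq by (simp add: rot_I)
    qed
    have "noise_mean 0 I x (\<lambda>y. (ip x (sh j y))\<^sup>2) = noise_mean 0 I x (\<lambda>y. \<Sum>p\<in>I. \<Sum>q\<in>I. (x p * x q) * (y (rot j p) * y (rot j q)))"
      by (rule arg_cong[of _ _ "noise_mean 0 I x"]) (auto simp: ip_def power2_eq_square sum_product mult.commute mult.left_commute intro!: sum.cong)
    also have "\<dots> = (\<Sum>p\<in>I. \<Sum>q\<in>I. (x p * x q) * (if p = q then 1 else 0))"
      by (simp only: noise_mean_sum noise_mean_cmult) (intro sum.cong refl, simp add: N)
    also have "\<dots> = (\<Sum>p\<in>I. 1)"
      by (intro sum.cong refl) (simp add: if_distrib[of "\<lambda>z. _ * z"] cube_sq[OF x] cong: if_cong)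
    finally show ?thesis by (simp add: card_I K_def)
  qed
  have pt: "of_bool (qd x y < m * L / 4) \<le> (\<Sum>j<m. 4 / K\<^sup>2 * (ip x (sh j y))\<^sup>2)" if y: "y \<in> cube I" for y
  proof (cases "qd x y < m * L / 4")
    case True
    obtain j where j: "j < m" "qd x y = ham x (sh j y)" using qd_attained by blast
    then have "K / 2 \<le> ip x (sh j y)" using True ip_ham[OF x sh_cube[OF y, of j]] by (simp add: K_def mult.commute)
    then have "(K / 2)\<^sup>2 \<le> (ip x (sh j y))\<^sup>2" using K by (intro power_mono) auto
    then have "1 \<le> 4 / K\<^sup>2 * (ip x (sh j y))\<^sup>2" using K by (simp add: field_simps power2_eq_square)
    also have "\<dots> \<le> (\<Sum>j<m. 4 / K\<^sup>2 * (ip x (sh j y))\<^sup>2)"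
      by (rule member_le_sum) (use j in auto)
    finally show ?thesis using True by simp
  qed (auto intro!: sum_nonneg)
  have "noise_mean 0 I x (\<lambda>y. of_bool (qd x y < m * L / 4)) \<le> noise_mean 0 I x (\<lambda>y. \<Sum>j<m. 4 / K\<^sup>2 * (ip x (sh j y))\<^sup>2)"
    using pt by (intro noise_mean_mono x) auto
  also have "\<dots> = m * (4 / K\<^sup>2 * K)"
    by (simp only: noise_mean_sum noise_mean_cmult sq) simp
  also have "\<dots> = 4 / L" using L m_pos by (simp add: K_def power2_eq_square)
  finally show ?thesis .
qed

end

section \<open>Sketching integer vectors\<close>

text \<open>Khinchine's inequality for the first moment. The upper bound is Cauchy-Schwarz; the
  lower one combines the second moment n^2 with Bonami's fourth-moment bound 9 n^4, the linear form
  being a polynomial supported on singletons.\<close>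

lemma rademacher_L1:
  fixes v :: "'t \<Rightarrow> real"
  assumes J: "finite J"
  defines "E \<equiv> corr_exp 0 J (\<lambda>x y. \<bar>\<Sum>t\<in>J. v t * x t\<bar>)" and "n \<equiv> sqrt (\<Sum>t\<in>J. (v t)\<^sup>2)"
  shows "E \<le> n" and "n / 4 \<le> E"
proof -
  define c where "c = (\<lambda>S. if is_singleton S then v (the_elem S) else 0)"
  have n2: "n\<^sup>2 = (\<Sum>t\<in>J. (v t)\<^sup>2)" and n0: "n \<ge> 0" unfolding n_def by (auto intro: sum_nonneg)
  have singles: "(\<Sum>S\<in>Pow J. F S) = (\<Sum>t\<in>J. F {t})" if "\<And>S. \<not> is_singleton S \<Longrightarrow> F S = 0" for F :: "'t set \<Rightarrow> real"
  proof -
    have "(\<Sum>S\<in>Pow J. F S) = (\<Sum>S\<in>(\<lambda>t. {t}) ` J. F S)"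
      using J that by (intro sum.mono_neutral_right) (auto simp: is_singleton_def)
    also have "\<dots> = (\<Sum>t\<in>J. F {t})" by (subst sum.reindex) auto
    finally show ?thesis .
  qed
  have Z: "mlin J c x = (\<Sum>t\<in>J. v t * x t)" for x
    unfolding mlin_def by (subst singles) (auto simp: c_def)
  have m2: "corr_exp 0 J (\<lambda>x y. (mlin J c x)\<^sup>2) = n\<^sup>2"
    unfolding corr_exp_mlin_sq[OF J] n2 by (subst singles) (auto simp: c_def)
  have m4: "corr_exp 0 J (\<lambda>x y. (mlin J c x) ^ 4) \<le> 9 * n ^ 4"
  proof -
    have "(\<Sum>S\<in>Pow J. 3 ^ card S * (c S)\<^sup>2) = 3 * n\<^sup>2"
      unfolding n2 sum_distrib_left by (subst singles) (auto simp: c_def)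
    then show ?thesis using bonami[OF J, of "\<lambda>_. 1" "\<lambda>_. 0" c] by (simp add: power_mult_distrib flip: power_mult)
  qed
  have E: "E = corr_exp 0 J (\<lambda>x y. \<bar>mlin J c x\<bar>)" unfolding E_def Z ..
  have "E\<^sup>2 \<le> n\<^sup>2"
    using corr_exp_Cauchy_Schwarz[of 0 J "\<lambda>x y. \<bar>mlin J c x\<bar>" "\<lambda>x y. 1"] by (simp add: E m2 corr_exp_const J)
  then show "E \<le> n" using n0 by (rule power2_le_imp_le)
  show "n / 4 \<le> E"
  proof (cases "n = 0")
    case True
    then show ?thesis unfolding E by (simp add: corr_exp_nonneg)
  next
    case False
    then have n: "n > 0" using n0 by simp
    \<comment> \<open>A pointwise lower bound for |z| by second and fourth powers at scale
      \<open>\<tau>\<close>. With \<open>\<tau>\<close> = 3 n the moments give n/3 - n/12 =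
      n/4.\<close>
    define \<tau> where "\<tau> = 3 * n"
    have pt: "1 / \<tau> * z\<^sup>2 - 1 / (4 * \<tau> ^ 3) * z ^ 4 \<le> \<bar>z\<bar>" for z
    proof -
      define u where "u = \<bar>z\<bar> / \<tau>"
      have u: "u \<ge> 0" using n by (simp add: u_def \<tau>_def)
      have "u\<^sup>2 - u ^ 4 / 4 \<le> u"
      proof (cases "u \<le> 1")
        case True
        then have "u\<^sup>2 \<le> u" using u by (simp add: power2_eq_square mult_left_le_one_le)
        then show ?thesis using u by (smt (verit) zero_le_power divide_nonneg_nonneg)
      next
        case False
        have "0 \<le> (u\<^sup>2 / 2 - 1)\<^sup>2" by simp
        then have "u\<^sup>2 - u ^ 4 / 4 \<le> 1" by (simp add: power2_eq_square power4_eq_xxxx algebra_simps)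
        then show ?thesis using False by simp
      qed
      then have "\<tau> * (u\<^sup>2 - u ^ 4 / 4) \<le> \<tau> * u" using n by (intro mult_left_mono) (auto simp: \<tau>_def)
      moreover have "\<tau> * u = \<bar>z\<bar>" using n by (simp add: u_def \<tau>_def)
      moreover have "\<tau> * (u\<^sup>2 - u ^ 4 / 4) = 1 / \<tau> * z\<^sup>2 - 1 / (4 * \<tau> ^ 3) * z ^ 4"
        using n by (simp add: u_def \<tau>_def power_divide power_mult_distrib field_simps eval_nat_numeral)
      ultimately show ?thesis by simp
    qed
    have "n / 4 = 1 / \<tau> * n\<^sup>2 - 1 / (4 * \<tau> ^ 3) * (9 * n ^ 4)"
      using n by (simp add: \<tau>_def field_simps eval_nat_numeral)
    also have "\<dots> \<le> 1 / \<tau> * corr_exp 0 J (\<lambda>x y. (mlin J c x)\<^sup>2) - 1 / (4 * \<tau> ^ 3) * corr_exp 0 J (\<lambda>x y. (mlin J c x) ^ 4)"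
      unfolding m2 using m4 n by (intro diff_left_mono mult_left_mono) (auto simp: \<tau>_def)
    also have "\<dots> = corr_exp 0 J (\<lambda>x y. 1 / \<tau> * (mlin J c x)\<^sup>2 - 1 / (4 * \<tau> ^ 3) * (mlin J c x) ^ 4)"
      by (simp only: corr_exp_diff corr_exp_cmult)
    also have "\<dots> \<le> E" unfolding E by (rule corr_exp_mono) (use pt in auto)
    finally show ?thesis .
  qed
qed

definition differ_prob :: "('x \<Rightarrow> bool) pmf \<Rightarrow> 'x \<Rightarrow> 'x \<Rightarrow> real" where
  "differ_prob p x y = pmf (map_pmf (\<lambda>f. f x \<noteq> f y) p) True"

text \<open>Among the 2 B integer thresholds exactly |u - v| separate integers u and v. Integrality
  keeps the distribution finite and the formula exact.\<close>

lemma threshold_cuts: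
  fixes Z :: "'e \<Rightarrow> 'x \<Rightarrow> int" and B :: int
  assumes A: "finite A" "A \<noteq> {}" and B: "B > 0" and Z: "\<And>e x. e \<in> A \<Longrightarrow> x \<in> X \<Longrightarrow> \<bar>Z e x\<bar> \<le> B"
  shows "\<exists>p. \<forall>x\<in>X. \<forall>y\<in>X. differ_prob p x y = real_of_int (\<Sum>e\<in>A. \<bar>Z e x - Z e y\<bar>) / (2 * real_of_int B * card A)"
proof -
  define S where "S = A \<times> {-B..<B}"
  have S: "finite S" "S \<noteq> {}" using A B by (auto simp: S_def)
  have cS: "real (card S) = 2 * B * card A" using B by (simp add: S_def card_cartesian_product)
  define p where "p = map_pmf (\<lambda>(e, t) x. Z e x \<le> t) (pmf_of_set S)"
  have "differ_prob p x y = real_of_int (\<Sum>e\<in>A. \<bar>Z e x - Z e y\<bar>) / (2 * real_of_int B * card A)" if xy: "x \<in> X" "y \<in> X" for x y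
  proof -
    have "differ_prob p x y = measure (pmf_of_set S) ((\<lambda>(e, t). (Z e x \<le> t) \<noteq> (Z e y \<le> t)) -` {True})"
      unfolding differ_prob_def p_def by (simp add: pmf.map_comp pmf_map o_def case_prod_unfold)
    also have "\<dots> = card (S \<inter> ((\<lambda>(e, t). (Z e x \<le> t) \<noteq> (Z e y \<le> t)) -` {True})) / card S"
      by (rule measure_pmf_of_set[OF S(2,1)])
    also have "S \<inter> ((\<lambda>(e, t). (Z e x \<le> t) \<noteq> (Z e y \<le> t)) -` {True}) =
       (SIGMA e:A. {min (Z e x) (Z e y)..<max (Z e x) (Z e y)})"
    proof (rule set_eqI)
      fix z :: "'e \<times> int"
      obtain e t where z: "z = (e, t)" by (cases z)
      show "z \<in> S \<inter> ((\<lambda>(e, t). (Z e x \<le> t) \<noteq> (Z e y \<le> t)) -` {True}) \<longleftrightarrow>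
         z \<in> (SIGMA e:A. {min (Z e x) (Z e y)..<max (Z e x) (Z e y)})"
        using Z[of e x] Z[of e y] xy unfolding S_def z by (cases "e \<in> A") auto
    qed
    also have "card \<dots> = (\<Sum>e\<in>A. nat \<bar>Z e x - Z e y\<bar>)"
    proof -
      have "max u v - min u v = \<bar>u - v\<bar>" for u v :: int by (cases "u \<le> v") auto
      then show ?thesis using A by (subst card_SigmaI) auto
    qed
    finally show ?thesis unfolding cS by (simp add: sum_divide_distrib)
  qed
  then show ?thesis by blast
qed

text \<open>The bias 1 - 2 Prob[differ] is multiplicative under the exclusive or of independent
  cuts.\<close>

lemma xor_cuts: "\<exists>q. \<forall>x y. 1 - 2 * differ_prob q x y = (1 - 2 * differ_prob p x y) ^ N"
proof (induction N)
  case 0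
  show ?case by (rule exI[of _ "return_pmf (\<lambda>_. False)"]) (simp add: differ_prob_def)
next
  case (Suc N)
  then obtain q where q: "\<And>x y. 1 - 2 * differ_prob q x y = (1 - 2 * differ_prob p x y) ^ N" by blast
  define q' where "q' = map_pmf (\<lambda>(f, g) z. f z \<noteq> g z) (pair_pmf p q)"
  have "1 - 2 * differ_prob q' x y = (1 - 2 * differ_prob p x y) * (1 - 2 * differ_prob q x y)" for x y
  proof -
    let ?p = "map_pmf (\<lambda>f. f x \<noteq> f y) p" and ?q = "map_pmf (\<lambda>f. f x \<noteq> f y) q"
    have "map_pmf (\<lambda>f. f x \<noteq> f y) q' = map_pmf (\<lambda>(u, v). u \<noteq> v) (map_pmf (\<lambda>(f, g). (f x \<noteq> f y, g x \<noteq> g y)) (pair_pmf p q))"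
      unfolding q'_def pmf.map_comp by (intro map_pmf_cong refl) auto
    also have "\<dots> = map_pmf (\<lambda>(u, v). u \<noteq> v) (pair_pmf ?p ?q)" by (simp only: map_pair)
    finally have "differ_prob q' x y = measure (pair_pmf ?p ?q) ((\<lambda>(u, v). u \<noteq> v) -` {True})"
      by (simp only: differ_prob_def pmf_map[of "\<lambda>(u, v). u \<noteq> v"])
    also have "(\<lambda>(u, v). u \<noteq> v) -` {True} = {(True, False), (False, True)}" by auto
    also have "measure (pair_pmf ?p ?q) \<dots> = pmf ?p True * pmf ?q False + pmf ?p False * pmf ?q True"
      by (subst measure_measure_pmf_finite) (auto simp: pmf_pair)
    finally show ?thesis by (simp add: pmf_False_conv_True differ_prob_def algebra_simps)
  qed
  then show ?case using q by (intro exI[of _ q']) simp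
qed

text \<open>Four independent copies of a cut, compared for equality. Four repetitions turn the gap
  between 1/10 and 1/4 into the required 3/5 on both sides: (9/10)^4 and 1 - (3/4)^4 both exceed
  it.\<close>

lemma four_bit_sketch:
  assumes X: "finite X"
  shows "\<exists>P :: ('x \<Rightarrow> bool list) measure. prob_space P \<and>
     sets P = sets (Pi\<^sub>M X (\<lambda>_. count_space (bit_strings 4))) \<and>
     (\<forall>x\<in>X. \<forall>y\<in>X. measure P {Sk \<in> space P. Sk x = Sk y} = (1 - differ_prob p x y) ^ 4 \<and>
        measure P {Sk \<in> space P. Sk x \<noteq> Sk y} = 1 - (1 - differ_prob p x y) ^ 4)"
proof -
  define M where "M = count_space (\<Pi>\<^sub>E x\<in>X. bit_strings 4)"
  have fin: "finite (bit_strings 4)"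
    using finite_lists_length_eq[of "UNIV :: bool set" 4] by (simp add: bit_strings_def)
  have M: "Pi\<^sub>M X (\<lambda>_. count_space (bit_strings 4)) = M"
    unfolding M_def using X fin by (intro count_space_PiM_finite) (auto intro: countable_finite)
  define q where "q = pair_pmf p (pair_pmf p (pair_pmf p p))"
  define g where "g = (\<lambda>(f1, f2, f3, f4). \<lambda>x\<in>X. [f1 x, f2 x, f3 x, f4 x :: bool])"
  have g: "g \<in> measurable (measure_pmf q) M"
    unfolding M_def g_def by (auto simp: bit_strings_def split: prod.splits)
  define P where "P = distr (measure_pmf q) M g"
  interpret P: prob_space P
    unfolding P_def by (rule measure_pmf.prob_space_distr[OF g])
  have sp: "space P = (\<Pi>\<^sub>E x\<in>X. bit_strings 4)" by (simp add: P_def M_def)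
  have eq: "measure P {Sk \<in> space P. Sk x = Sk y} = (1 - differ_prob p x y) ^ 4" if xy: "x \<in> X" "y \<in> X" for x y
  proof -
    let ?h = "\<lambda>f :: 'x \<Rightarrow> bool. f x \<noteq> f y"
    have "measure P {Sk \<in> space P. Sk x = Sk y} = measure q (g -` {Sk \<in> space P. Sk x = Sk y} \<inter> space q)"
      unfolding P_def by (rule measure_distr[OF g]) (auto simp: M_def)
    also have "g -` {Sk \<in> space P. Sk x = Sk y} \<inter> space q = (\<lambda>(f1, f2, f3, f4). (?h f1, ?h f2, ?h f3, ?h f4)) -` {(False, False, False, False)}"
      using xy unfolding sp by (auto simp: g_def bit_strings_def)
    also have "measure q \<dots> = pmf (map_pmf (\<lambda>(f1, f2, f3, f4). (?h f1, ?h f2, ?h f3, ?h f4)) q) (False, False, False, False)"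
      by (simp only: pmf_map)
    also have "map_pmf (\<lambda>(f1, f2, f3, f4). (?h f1, ?h f2, ?h f3, ?h f4)) q =
      pair_pmf (map_pmf ?h p) (pair_pmf (map_pmf ?h p) (pair_pmf (map_pmf ?h p) (map_pmf ?h p)))"
      unfolding q_def by (simp only: map_pair[symmetric] case_prod_unfold)
    finally show ?thesis by (simp add: pmf_pair pmf_False_conv_True differ_prob_def eval_nat_numeral)
  qed
  have "measure P {Sk \<in> space P. Sk x \<noteq> Sk y} = 1 - (1 - differ_prob p x y) ^ 4" if xy: "x \<in> X" "y \<in> X" for x y
  proof -
    have "{Sk \<in> space P. Sk x = Sk y} \<in> P.events" by (auto simp: P_def M_def)
    from P.prob_compl[OF this] eq[OF xy] show ?thesis
      by (simp add: set_diff_eq) (metis (mono_tags, lifting) Collect_cong)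
  qed
  then show ?thesis using eq P.prob_space_axioms by (intro exI[of _ P]) (simp add: M P_def)
qed

text \<open>Close pairs have Euclidean distance at most s = sqrt(b r). Far pairs have at least 32 s,
  because 1024 = 32^2. Khinchine's inequality loses a factor 4, so a random cut separates close
  pairs with probability at most \<open>\<eta>\<close> and far pairs with probability at least 8
  \<open>\<eta>\<close>; parity amplifies this gap.\<close>

lemma sketchable_of_integer_vectors:
  fixes V :: "'x \<Rightarrow> 't \<Rightarrow> real" and d :: "'x \<Rightarrow> 'x \<Rightarrow> real"
  assumes X: "finite X" and J: "finite J" and ker: "nonnegative_kernel X d"
    and int: "\<And>x t. x \<in> X \<Longrightarrow> t \<in> J \<Longrightarrow> V x t \<in> \<int>"
    and lower: "\<And>x y. x \<in> X \<Longrightarrow> y \<in> X \<Longrightarrow> a * d x y \<le> (\<Sum>t\<in>J. (V x t - V y t)\<^sup>2)"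
    and upper: "\<And>x y. x \<in> X \<Longrightarrow> y \<in> X \<Longrightarrow> (\<Sum>t\<in>J. (V x t - V y t)\<^sup>2) \<le> b * d x y"
    and ab: "0 < a" "0 < b" and D: "1024 * b \<le> a * D" "1 \<le> D"
  shows "sketchable 4 D X d"
  unfolding sketchable_def
proof (intro conjI allI impI ker D)
  fix r :: real assume r: "r > 0"
  define Z :: "('t \<Rightarrow> real) \<Rightarrow> 'x \<Rightarrow> int" where "Z = (\<lambda>e x. \<lfloor>\<Sum>t\<in>J. V x t * e t\<rfloor>)"
  have Z: "real_of_int (Z e x) = (\<Sum>t\<in>J. V x t * e t)" if e: "e \<in> cube J" and x: "x \<in> X" for e x
  proof -
    have "e t \<in> \<int>" if "t \<in> J" for t using cube_mem[OF e that] by auto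
    then have "(\<Sum>t\<in>J. V x t * e t) \<in> \<int>" using int[OF x] by (intro Ints_sum Ints_mult) auto
    then show ?thesis by (simp add: Z_def)
  qed
  have fc: "finite (cube J)" "cube J \<noteq> {}" using finite_cube[OF J] card_cube[OF J] by auto
  obtain B0 where B0: "\<And>e x. e \<in> cube J \<Longrightarrow> x \<in> X \<Longrightarrow> \<bar>Z e x\<bar> \<le> B0"
  proof -
    have "finite ((\<lambda>(e, x). \<bar>Z e x\<bar>) ` (cube J \<times> X))" using fc X by auto
    then have "bdd_above ((\<lambda>(e, x). \<bar>Z e x\<bar>) ` (cube J \<times> X))" by (rule bdd_above_finite)
    then obtain M where M: "\<And>z. z \<in> (\<lambda>(e, x). \<bar>Z e x\<bar>) ` (cube J \<times> X) \<Longrightarrow> z \<le> M"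
      unfolding bdd_above_def by blast
    show ?thesis by (rule that[of M], rule M) force
  qed
  define s where "s = sqrt (b * r)"
  have s: "s > 0" using ab r by (simp add: s_def)
  \<comment> \<open>The bound B at least 2 B0 keeps every cut probability at most 1/2, so that
    biases are nonnegative; B at least 10 s keeps \<open>\<eta>\<close> at most 1/20, so that
    rounding N down loses at most a factor 2.\<close>
  define B where "B = 2 * \<bar>B0\<bar> + 1 + \<lceil>10 * s\<rceil>"
  have B: "B > 0" "2 * B0 \<le> B" "10 * s \<le> B" using s unfolding B_def by linarith+
  have ZB: "\<bar>Z e x\<bar> \<le> B" if "e \<in> cube J" "x \<in> X" for e x
    using B0[OF that] B by linarith
  obtain p where p0: "\<forall>x\<in>X. \<forall>y\<in>X. differ_prob p x y = real_of_int (\<Sum>e\<in>cube J. \<bar>Z e x - Z e y\<bar>) / (2 * real_of_int B * card (cube J))"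
    using threshold_cuts[OF fc B(1) ZB] by (rule exE)
  have p: "differ_prob p x y = real_of_int (\<Sum>e\<in>cube J. \<bar>Z e x - Z e y\<bar>) / (2 * real_of_int B * card (cube J))"
    if "x \<in> X" "y \<in> X" for x y
    using p0[THEN bspec, OF that(1), THEN bspec, OF that(2)] .
  define \<nu> where "\<nu> = (\<lambda>x y. sqrt (\<Sum>t\<in>J. (V x t - V y t)\<^sup>2))"
  define E where "E = (\<lambda>x y. corr_exp 0 J (\<lambda>e e'. \<bar>\<Sum>t\<in>J. (V x t - V y t) * e t\<bar>))"
  have pE: "differ_prob p x y = E x y / (2 * B)" if xy: "x \<in> X" "y \<in> X" for x y
  proof -
    have "real_of_int (\<Sum>e\<in>cube J. \<bar>Z e x - Z e y\<bar>) = (\<Sum>e\<in>cube J. \<bar>\<Sum>t\<in>J. (V x t - V y t) * e t\<bar>)"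
      using Z xy by (auto simp: left_diff_distrib sum_subtractf intro!: sum.cong)
    then show ?thesis unfolding p[OF xy] E_def corr_exp_fst[OF J] card_cube[OF J] by simp
  qed
  have E: "E x y \<le> \<nu> x y" "\<nu> x y / 4 \<le> E x y" for x y
    unfolding E_def \<nu>_def using rademacher_L1[OF J] by auto
  have p_half: "differ_prob p x y \<le> 1 / 2" if xy: "x \<in> X" "y \<in> X" for x y
  proof -
    have "(\<Sum>e\<in>cube J. \<bar>Z e x - Z e y\<bar>) \<le> (\<Sum>e\<in>cube J. B)"
    proof (rule sum_mono)
      fix e assume "e \<in> cube J"
      then show "\<bar>Z e x - Z e y\<bar> \<le> B" using B0[of e x] B0[of e y] xy B by linarith
    qed
    then have "real_of_int (\<Sum>e\<in>cube J. \<bar>Z e x - Z e y\<bar>) \<le> card (cube J) * B"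
      by (simp only: of_int_le_iff sum_constant of_int_of_nat_eq flip: of_int_mult)
    then show ?thesis unfolding p[OF xy] using B fc by (simp add: field_simps card_gt_0_iff)
  qed
  define \<eta> where "\<eta> = s / (2 * B)"
  have \<eta>: "0 < \<eta>" "\<eta> \<le> 1 / 20" using s B by (auto simp: \<eta>_def field_simps)
  \<comment> \<open>Close pairs then have N p at most 1/10, so Bernoulli's inequality gives parity
    probability at most 1/10. Far pairs have 2 N p at least 4/5, and exp(-4/5) below 1/2 gives at
    least 1/4.\<close>
  define N where "N = nat \<lfloor>1 / (10 * \<eta>)\<rfloor>"
  have N: "N * \<eta> \<le> 1 / 10" "1 / 20 \<le> N * \<eta>"
  proof -
    have "1 / (10 * \<eta>) \<ge> 1" using \<eta> by (simp add: field_simps)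
    then have "real N \<le> 1 / (10 * \<eta>)" "1 / (10 * \<eta>) - 1 \<le> N" unfolding N_def by linarith+
    then show "N * \<eta> \<le> 1 / 10" "1 / 20 \<le> N * \<eta>" using \<eta> by (auto simp: field_simps)
  qed
  obtain q where q: "\<And>x y. 1 - 2 * differ_prob q x y = (1 - 2 * differ_prob p x y) ^ N"
    using xor_cuts by blast
  obtain P :: "('x \<Rightarrow> bool list) measure" where P: "prob_space P"
     "sets P = sets (Pi\<^sub>M X (\<lambda>_. count_space (bit_strings 4)))"
     "\<And>x y. x \<in> X \<Longrightarrow> y \<in> X \<Longrightarrow> measure P {Sk \<in> space P. Sk x = Sk y} = (1 - differ_prob q x y) ^ 4"
     "\<And>x y. x \<in> X \<Longrightarrow> y \<in> X \<Longrightarrow> measure P {Sk \<in> space P. Sk x \<noteq> Sk y} = 1 - (1 - differ_prob q x y) ^ 4"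
    using four_bit_sketch[OF X, of q] by blast
  have close: "(1 - differ_prob q x y) ^ 4 \<ge> 3 / 5" if xy: "x \<in> X" "y \<in> X" "d x y \<le> r" for x y
  proof -
    have "\<nu> x y \<le> s" unfolding \<nu>_def s_def
      using order_trans[OF upper[OF xy(1,2)] mult_left_mono[OF xy(3), of b]] ab by (intro real_sqrt_le_mono) auto
    then have "differ_prob p x y \<le> \<eta>"
      unfolding pE[OF xy(1,2)] \<eta>_def using E(1)[of x y] B by (intro divide_right_mono) auto
    then have "N * differ_prob p x y \<le> 1 / 10" using N(1) by (meson mult_left_mono of_nat_0_le_iff order_trans)
    moreover have "1 + N * (- 2 * differ_prob p x y) \<le> (1 + - 2 * differ_prob p x y) ^ N"
      using p_half[OF xy(1,2)] by (intro Bernoulli_inequality) auto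
    ultimately have "differ_prob q x y \<le> 1 / 10" using q[of x y] by simp
    then have "(9 / 10) ^ 4 \<le> (1 - differ_prob q x y) ^ 4" by (intro power_mono) auto
    then show ?thesis by (simp add: eval_nat_numeral)
  qed
  have far: "1 - (1 - differ_prob q x y) ^ 4 \<ge> 3 / 5" if xy: "x \<in> X" "y \<in> X" "d x y > D * r" for x y
  proof -
    have "(32 * s)\<^sup>2 \<le> (\<nu> x y)\<^sup>2"
    proof -
      have "(32 * s)\<^sup>2 = 1024 * b * r" using ab r by (simp add: s_def power_mult_distrib)
      also have "\<dots> \<le> a * D * r" using D r by (intro mult_right_mono) auto
      also have "\<dots> \<le> a * d x y" using xy(3) ab by (simp add: mult.assoc)
      also have "\<dots> \<le> (\<nu> x y)\<^sup>2" unfolding \<nu>_def using lower[OF xy(1,2)] by (simp add: sum_nonneg)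
      finally show ?thesis .
    qed
    then have "32 * s \<le> \<nu> x y" by (rule power2_le_imp_le) (simp add: \<nu>_def sum_nonneg)
    then have "8 * s \<le> E x y" using E(2)[of x y] by simp
    then have p8: "8 * \<eta> \<le> differ_prob p x y"
      unfolding pE[OF xy(1,2)] \<eta>_def using B by (simp add: field_simps)
    have "(1 - 2 * differ_prob p x y) ^ N \<le> exp (- (2 * differ_prob p x y)) ^ N"
      using p_half[OF xy(1,2)] exp_ge_add_one_self[of "- (2 * differ_prob p x y)"] by (intro power_mono) auto
    also have "\<dots> = exp (- (2 * (N * differ_prob p x y)))" by (simp flip: exp_of_nat_mult)
    also have "\<dots> \<le> exp (- (4 / 5))"
    proof -
      have "N * (8 * \<eta>) \<le> N * differ_prob p x y" using p8 by (intro mult_left_mono) auto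
      then show ?thesis using N(2) by simp
    qed
    also have "\<dots> \<le> 1 / 2"
    proof -
      have "exp (4 / 5 :: real) \<ge> 1 + 4/5 + (4/5)\<^sup>2 / 2" by (rule exp_lower_Taylor_quadratic) simp
      then have "exp (4 / 5 :: real) \<ge> 2" by (simp add: power2_eq_square)
      then show ?thesis by (simp add: exp_minus field_simps)
    qed
    finally have "differ_prob q x y \<ge> 1 / 4" using q[of x y] by simp
    moreover have "differ_prob q x y \<le> 1" by (simp add: differ_prob_def pmf_le_1)
    ultimately have "(1 - differ_prob q x y) ^ 4 \<le> (3 / 4) ^ 4" by (intro power_mono) auto
    then show ?thesis by (simp add: eval_nat_numeral)
  qed
  show "\<exists>R P. prob_space P \<and> sets P = sets (Pi\<^sub>M X (\<lambda>_. count_space (bit_strings 4))) \<and>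
        (\<forall>x\<in>X. \<forall>y\<in>X. d x y \<le> r \<longrightarrow> 3 / 5 \<le> measure P {Sk \<in> space P. R (Sk x) (Sk y) = False}) \<and>
        (\<forall>x\<in>X. \<forall>y\<in>X. D * r < d x y \<longrightarrow> 3 / 5 \<le> measure P {Sk \<in> space P. R (Sk x) (Sk y) = True})"
    using P close far by (intro exI[of _ "\<lambda>u v. u \<noteq> v"] exI[of _ P]) simp
qed

section \<open>Features of good points\<close>

lemma sum_mod_shift:
  fixes G :: "nat \<Rightarrow> real"
  assumes "m > 0"
  shows "(\<Sum>k<m. G ((k + j) mod m)) = (\<Sum>k<m. G k)"
proof (rule sum.reindex_bij_witness[of _ "\<lambda>k. (k + (m - j mod m)) mod m" "\<lambda>k. (k + j) mod m"])
  define w where "w = m - j mod m"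
  have w: "w + j mod m = m" using assms by (simp add: w_def less_imp_le)
  fix k assume k: "k \<in> {..<m}"
  have wj: "(k + w + j) mod m = k"
    using mod_add_right_eq[of "k + w" j m] w k by (simp add: add.assoc)
  have "((k + j) mod m + w) mod m = (k + j + w) mod m" by (rule mod_add_left_eq)
  also have "k + j + w = k + w + j" by simp
  finally show "((k + j) mod m + (m - j mod m)) mod m = k" unfolding wj w_def[symmetric] .
  show "((k + (m - j mod m)) mod m + j) mod m = k"
    unfolding w_def[symmetric] mod_add_left_eq by (rule wj)
qed (use assms in auto)

text \<open>Here a, b, c stand for normalized correlations of x with shifts of x, of y with shifts
  of y, and of x with shifts of y; e is the normalized distance and q the normalized squared feature
  distance. For small e the term j = 0 contributes between 5 e and 6 e, and the others at most e/2.
  For e above 1/50 the cubes of a and b sum to nearly 1 each, while the sum of the c_j^3 is bounded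
  away from 1.\<close>

lemma cubic_sum_bounds:
  fixes a b c :: "nat \<Rightarrow> real" and e :: real
  assumes m: "m \<ge> 1" and zero: "a 0 = 1" "b 0 = 1" "c 0 = 1 - e" and e: "0 \<le> e" "e \<le> 2"
    and small: "\<And>j. j \<in> {1..<m} \<Longrightarrow> \<bar>a j\<bar> \<le> 1 / (1000 * real m)" "\<And>j. j \<in> {1..<m} \<Longrightarrow> \<bar>b j\<bar> \<le> 1 / (1000 * real m)"
    and close: "\<And>j. j \<in> {1..<m} \<Longrightarrow> \<bar>c j - a j\<bar> \<le> e" "\<And>j. j \<in> {1..<m} \<Longrightarrow> \<bar>c j - b j\<bar> \<le> e"
    and le: "\<And>j. j < m \<Longrightarrow> c j \<le> 1 - e" and bessel: "(\<Sum>j<m. (c j)\<^sup>2) \<le> 1000 / 999"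
  defines "q \<equiv> \<Sum>j<m. (a j) ^ 3 + (b j) ^ 3 - 2 * (c j) ^ 3"
  shows "17 / 1000 * e \<le> q" "q \<le> 205 * e"
proof -
  define \<eta> where "\<eta> = 1 / (1000 * real m)"
  have \<eta>: "0 < \<eta>" "\<eta> \<le> 1 / 1000" "m * \<eta> = 1 / 1000" using m by (auto simp: \<eta>_def field_simps)
  have split: "(\<Sum>j<m. F j) = F 0 + (\<Sum>j\<in>{1..<m}. F j)" for F :: "nat \<Rightarrow> real"
  proof -
    have "{..<m} = insert 0 {1..<m}" using m by auto
    then show ?thesis by simp
  qed
  have const: "(\<Sum>j\<in>{1..<m}. k) \<le> m * k" if "k \<ge> 0" for k :: real
    using that by (simp add: mult_right_mono)
  have "17 / 1000 * e \<le> q \<and> q \<le> 205 * e"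
  proof (cases "e \<le> 1 / 50")
    case True
    \<comment> \<open>The quadratic factor is why cubes work: summed over all m shifts it is
      controlled by the Bessel bound, where a bare factor e per shift would add up to m e.\<close>
    have cube_diff: "\<bar>u ^ 3 - v ^ 3\<bar> \<le> 3 / 2 * e * (u\<^sup>2 + v\<^sup>2)" if "\<bar>v - u\<bar> \<le> e" for u v :: real
    proof -
      have "u ^ 3 - v ^ 3 = (u - v) * (u\<^sup>2 + u * v + v\<^sup>2)" by algebra
      moreover have "\<bar>u\<^sup>2 + u * v + v\<^sup>2\<bar> \<le> 3 / 2 * (u\<^sup>2 + v\<^sup>2)"
        using zero_le_power2[of "u - v"] zero_le_power2[of "u + v"] zero_le_power2[of u] zero_le_power2[of v]
        unfolding power2_sum power2_diff by (simp add: abs_le_iff)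
      ultimately have "\<bar>u ^ 3 - v ^ 3\<bar> \<le> e * (3 / 2 * (u\<^sup>2 + v\<^sup>2))"
        using that e mult_mono[of "\<bar>u - v\<bar>" e "\<bar>u\<^sup>2 + u * v + v\<^sup>2\<bar>" "3 / 2 * (u\<^sup>2 + v\<^sup>2)"]
        by (simp only: abs_mult abs_minus_commute[of v u])
      then show ?thesis by (simp add: algebra_simps)
    qed
    have term_le: "\<bar>(a j) ^ 3 + (b j) ^ 3 - 2 * (c j) ^ 3\<bar> \<le> 3 * e * \<eta>\<^sup>2 + 3 * e * (c j)\<^sup>2" if j: "j \<in> {1..<m}" for j
    proof -
      have "(a j)\<^sup>2 \<le> \<eta>\<^sup>2" "(b j)\<^sup>2 \<le> \<eta>\<^sup>2" using small[OF j] \<eta> unfolding \<eta>_def[symmetric]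
        by (auto intro: power2_le_iff_abs_le[THEN iffD2])
      then have "3 / 2 * e * ((a j)\<^sup>2 + (c j)\<^sup>2) + 3 / 2 * e * ((b j)\<^sup>2 + (c j)\<^sup>2) \<le> 3 / 2 * e * (\<eta>\<^sup>2 + (c j)\<^sup>2) + 3 / 2 * e * (\<eta>\<^sup>2 + (c j)\<^sup>2)"
        using e by (intro add_mono mult_left_mono) auto
      then show ?thesis
        using cube_diff[OF close(1)[OF j]] cube_diff[OF close(2)[OF j]] by (simp add: abs_le_iff algebra_simps)
    qed
    have "\<bar>\<Sum>j\<in>{1..<m}. (a j) ^ 3 + (b j) ^ 3 - 2 * (c j) ^ 3\<bar> \<le> (\<Sum>j\<in>{1..<m}. 3 * e * \<eta>\<^sup>2 + 3 * e * (c j)\<^sup>2)"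
      by (rule order_trans[OF sum_abs sum_mono[OF term_le]])
    also have "\<dots> = (\<Sum>j\<in>{1..<m}. 3 * e * \<eta>\<^sup>2) + 3 * e * (\<Sum>j\<in>{1..<m}. (c j)\<^sup>2)"
      by (simp only: sum.distrib sum_distrib_left)
    also have "\<dots> \<le> m * (3 * e * \<eta>\<^sup>2) + 3 * e * (1000 / 999 - (1 - e)\<^sup>2)"
      using bessel e unfolding split zero by (intro add_mono const mult_left_mono) auto
    also have "m * (3 * e * \<eta>\<^sup>2) = 3 * e * \<eta> * (m * \<eta>)" by (simp add: power2_eq_square)
    also have "\<dots> \<le> 3 * e * (1 / 1000) * (1 / 1000)"
      unfolding \<eta>(3) using \<eta> e by (intro mult_right_mono mult_left_mono) auto
    finally have "\<bar>\<Sum>j\<in>{1..<m}. (a j) ^ 3 + (b j) ^ 3 - 2 * (c j) ^ 3\<bar> \<le> e * (3 / 1000000 + 3 * (1000 / 999 - (1 - e)\<^sup>2))"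
      by (simp add: algebra_simps)
    also have "\<dots> \<le> e * (1 / 2)"
    proof (rule mult_left_mono)
      have "(49 / 50)\<^sup>2 \<le> (1 - e)\<^sup>2" using True e by (intro power_mono) auto
      then show "3 / 1000000 + 3 * (1000 / 999 - (1 - e)\<^sup>2) \<le> 1 / 2" by (simp add: power2_eq_square)
    qed (use e in auto)
    finally have rest: "\<bar>\<Sum>j\<in>{1..<m}. (a j) ^ 3 + (b j) ^ 3 - 2 * (c j) ^ 3\<bar> \<le> e / 2" by simp
    have q: "q = (2 - 2 * (1 - e) ^ 3) + (\<Sum>j\<in>{1..<m}. (a j) ^ 3 + (b j) ^ 3 - 2 * (c j) ^ 3)"
      unfolding q_def split zero by simp
    have "2 - 2 * (1 - e) ^ 3 = e * (6 - 6 * e + 2 * e\<^sup>2)" by algebra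
    moreover have "e * 5 \<le> e * (6 - 6 * e + 2 * e\<^sup>2)" "e * (6 - 6 * e + 2 * e\<^sup>2) \<le> e * 6"
    proof -
      have "e * e \<le> 1 * e" using True e by (intro mult_right_mono) auto
      then have "5 \<le> 6 - 6 * e + 2 * e\<^sup>2" "6 - 6 * e + 2 * e\<^sup>2 \<le> 6"
        using True e zero_le_square[of e] unfolding power2_eq_square by linarith+
      then show "e * 5 \<le> e * (6 - 6 * e + 2 * e\<^sup>2)" "e * (6 - 6 * e + 2 * e\<^sup>2) \<le> e * 6"
        using e by (auto intro!: mult_left_mono simp del: distrib_left)
    qed
    ultimately show ?thesis using q rest e unfolding abs_le_iff by linarith
  next
    case False
    have small_sum: "\<bar>(\<Sum>j\<in>{1..<m}. (u j) ^ 3)\<bar> \<le> 1 / 1000" if u: "\<And>j. j \<in> {1..<m} \<Longrightarrow> \<bar>u j\<bar> \<le> \<eta>" for u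
    proof -
      have "\<bar>(\<Sum>j\<in>{1..<m}. (u j) ^ 3)\<bar> \<le> (\<Sum>j\<in>{1..<m}. \<eta>)"
      proof (rule order_trans[OF sum_abs sum_mono])
        fix j assume "j \<in> {1..<m}"
        then have "\<bar>u j\<bar> ^ 3 \<le> \<eta> ^ 3" using u by (intro power_mono) auto
        also have "\<dots> \<le> \<eta> ^ 1" using \<eta> by (intro power_decreasing) auto
        finally show "\<bar>(u j) ^ 3\<bar> \<le> \<eta>" by (simp add: power_abs)
      qed
      also have "\<dots> \<le> m * \<eta>" using \<eta> by (intro const) auto
      finally show ?thesis using \<eta> by simp
    qed
    have A: "\<bar>\<Sum>j\<in>{1..<m}. (a j) ^ 3\<bar> \<le> 1 / 1000"
      by (rule small_sum) (unfold \<eta>_def, rule small(1))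
    have B: "\<bar>\<Sum>j\<in>{1..<m}. (b j) ^ 3\<bar> \<le> 1 / 1000"
      by (rule small_sum) (unfold \<eta>_def, rule small(2))
    \<comment> \<open>One factor c_j is at most 1 - e, below 49/50, and the remaining squares are
      summed by the Bessel bound.\<close>
    have C1: "(\<Sum>j<m. (c j) ^ 3) \<le> 49 / 50 * (1000 / 999)"
    proof -
      have "(\<Sum>j<m. (c j) ^ 3) \<le> (\<Sum>j<m. 49 / 50 * (c j)\<^sup>2)"
      proof (rule sum_mono)
        fix j assume "j \<in> {..<m}"
        then have "c j * (c j)\<^sup>2 \<le> 49 / 50 * (c j)\<^sup>2" using le[of j] False by (intro mult_right_mono) auto
        then show "(c j) ^ 3 \<le> 49 / 50 * (c j)\<^sup>2" by (simp add: power3_eq_cube power2_eq_square)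
      qed
      then show ?thesis using bessel unfolding sum_distrib_left[symmetric] by linarith
    qed
    have C2: "- (101 / 100) * (1000 / 999) \<le> (\<Sum>j<m. (c j) ^ 3)"
    proof -
      have "(\<Sum>j<m. - (101 / 100) * (c j)\<^sup>2) \<le> (\<Sum>j<m. (c j) ^ 3)"
      proof (rule sum_mono)
        fix j assume "j \<in> {..<m}"
        then have "(c j)\<^sup>2 \<le> 1000 / 999" using bessel member_le_sum[of j "{..<m}" "\<lambda>j. (c j)\<^sup>2"] by auto
        also have "\<dots> \<le> (101 / 100)\<^sup>2" by (simp add: power2_eq_square)
        finally have "\<bar>c j\<bar> \<le> 101 / 100" by (simp add: abs_le_square_iff[symmetric] flip: abs_le_square_iff)
        then have "- (101 / 100) * (c j)\<^sup>2 \<le> c j * (c j)\<^sup>2" by (intro mult_right_mono) auto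
        then show "- (101 / 100) * (c j)\<^sup>2 \<le> (c j) ^ 3" by (simp add: power3_eq_cube power2_eq_square)
      qed
      then show ?thesis using bessel unfolding sum_distrib_left[symmetric] by linarith
    qed
    have "q = (1 + (\<Sum>j\<in>{1..<m}. (a j) ^ 3)) + (1 + (\<Sum>j\<in>{1..<m}. (b j) ^ 3)) - 2 * (\<Sum>j<m. (c j) ^ 3)"
      unfolding q_def sum.distrib sum_subtractf sum_distrib_left[symmetric] split[of "\<lambda>j. (a j) ^ 3"] split[of "\<lambda>j. (b j) ^ 3"]
      by (simp add: zero)
    then show ?thesis using A B C1 C2 False e unfolding abs_le_iff by linarith
  qed
  then show "17 / 1000 * e \<le> q" "q \<le> 205 * e" by auto
qed

context shift_cube
begin

text \<open>The sum over the orbit makes the vector shift-invariant. The first tensor power would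
  retain only the sums along the L cycles, and the second would identify x with -x, which are far
  apart when x is good; the third avoids both.\<close>

definition feature :: "(nat \<times> nat \<Rightarrow> real) \<Rightarrow> (nat \<times> nat) \<times> (nat \<times> nat) \<times> (nat \<times> nat) \<Rightarrow> real" where
  "feature x = (\<lambda>(p, q, r). \<Sum>j<m. sh j x p * sh j x q * sh j x r)"

lemma ip_self: "x \<in> cube I \<Longrightarrow> ip x x = m * L"
  by (simp add: ip_ham)

lemma ip_sh_le: "good y \<Longrightarrow> i < m \<Longrightarrow> j < m \<Longrightarrow> i \<noteq> j \<Longrightarrow> \<bar>ip (sh i y) (sh j y)\<bar> \<le> L / 1000"
proof (induction i j rule: linorder_wlog)
  case (le i j)
  then have "sh j y = sh i (sh (j - i) y)" by (simp add: sh_sh)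
  then have "ip (sh i y) (sh j y) = ip y (sh (j - i) y)" by (simp add: ip_sh)
  moreover have "j - i \<in> {1..<m}" using le by auto
  ultimately show ?case using le unfolding good_def by auto
next
  case (sym i j) then show ?case by (simp add: ip_commute)
qed

text \<open>Expand the squared norm of x minus the sum of the c_j \<open>sh j y\<close>. The
  off-diagonal terms total at most L/1000 times the squared l_1 norm of c, hence at most K S/1000 by
  Cauchy-Schwarz, and nonnegativity becomes 1 - 2 S + S + S/1000 >= 0.\<close>

lemma bessel_shifts:
  assumes x: "x \<in> cube I" and y: "good y" and L: "L > 0"
  shows "(\<Sum>j<m. (ip x (sh j y) / (m * L))\<^sup>2) \<le> 1000 / 999"
proof -
  define K where "K = real (m * L)"
  have K: "K > 0" using L m_pos by (simp add: K_def)
  define c where "c = (\<lambda>j. ip x (sh j y) / K)"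
  define S where "S = (\<Sum>j<m. (c j)\<^sup>2)"
  have yc: "y \<in> cube I" using y by (rule good_cube)
  have "0 \<le> (\<Sum>p\<in>I. (x p - (\<Sum>j<m. c j * sh j y p))\<^sup>2)" by (intro sum_nonneg) auto
  also have "\<dots> = (\<Sum>p\<in>I. x p * x p - 2 * (\<Sum>j<m. c j * (x p * sh j y p)) + (\<Sum>i<m. \<Sum>j<m. c i * c j * (sh i y p * sh j y p)))"
  proof (intro sum.cong refl)
    fix p
    define u where "u = (\<lambda>j. c j * sh j y p)"
    have "(x p - (\<Sum>j<m. u j))\<^sup>2 = x p * x p - 2 * (\<Sum>j<m. x p * u j) + (\<Sum>i<m. \<Sum>j<m. u i * u j)"
    proof -
      have "(\<Sum>i<m. \<Sum>j<m. u i * u j) = (\<Sum>j<m. u j) * (\<Sum>j<m. u j)" by (simp only: sum_product)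
      moreover have "(\<Sum>j<m. x p * u j) = x p * (\<Sum>j<m. u j)" by (simp only: sum_distrib_left)
      ultimately show ?thesis by (simp add: power2_eq_square algebra_simps)
    qed
    then show "(x p - (\<Sum>j<m. c j * sh j y p))\<^sup>2 = x p * x p - 2 * (\<Sum>j<m. c j * (x p * sh j y p)) +
       (\<Sum>i<m. \<Sum>j<m. c i * c j * (sh i y p * sh j y p))"
      by (simp add: u_def mult_ac)
  qed
  also have "\<dots> = ip x x - 2 * (\<Sum>j<m. c j * ip x (sh j y)) + (\<Sum>i<m. \<Sum>j<m. c i * c j * ip (sh i y) (sh j y))"
  proof -
    have 1: "(\<Sum>p\<in>I. \<Sum>j<m. c j * (x p * sh j y p)) = (\<Sum>j<m. c j * ip x (sh j y))"
      by (subst sum.swap) (simp add: ip_def sum_distrib_left)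
    have "(\<Sum>p\<in>I. \<Sum>i<m. \<Sum>j<m. c i * c j * (sh i y p * sh j y p)) = (\<Sum>i<m. \<Sum>p\<in>I. \<Sum>j<m. c i * c j * (sh i y p * sh j y p))"
      by (rule sum.swap)
    also have "\<dots> = (\<Sum>i<m. \<Sum>j<m. c i * c j * ip (sh i y) (sh j y))"
      by (intro sum.cong refl, subst sum.swap) (simp add: ip_def sum_distrib_left)
    finally show ?thesis using 1 by (simp add: sum.distrib sum_subtractf ip_def flip: sum_distrib_left)
  qed
  also have "(\<Sum>j<m. c j * ip x (sh j y)) = K * S"
    unfolding S_def sum_distrib_left using K by (intro sum.cong refl) (simp add: c_def power2_eq_square)
  also have "(\<Sum>i<m. \<Sum>j<m. c i * c j * ip (sh i y) (sh j y)) \<le> (\<Sum>i<m. \<Sum>j<m. (if i = j then K * (c i)\<^sup>2 else 0) + L / 1000 * (\<bar>c i\<bar> * \<bar>c j\<bar>))"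
  proof (intro sum_mono)
    fix i j assume ij: "i \<in> {..<m}" "j \<in> {..<m}"
    show "c i * c j * ip (sh i y) (sh j y) \<le> (if i = j then K * (c i)\<^sup>2 else 0) + L / 1000 * (\<bar>c i\<bar> * \<bar>c j\<bar>)"
    proof (cases "i = j")
      case True
      then show ?thesis using yc by (simp add: ip_self sh_cube K_def power2_eq_square)
    next
      case False
      have "c i * c j * ip (sh i y) (sh j y) \<le> \<bar>c i * c j\<bar> * \<bar>ip (sh i y) (sh j y)\<bar>" by (simp flip: abs_mult)
      also have "\<dots> \<le> \<bar>c i * c j\<bar> * (L / 1000)" using ip_sh_le[OF y] ij False by (intro mult_left_mono) auto
      finally show ?thesis using False by (simp add: abs_mult mult.commute)
    qed
  qed
  also have "\<dots> = K * S + L / 1000 * (\<Sum>i<m. \<bar>c i\<bar>)\<^sup>2"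
    unfolding power2_eq_square[of "\<Sum>i<m. \<bar>c i\<bar>"] sum_product
    by (simp add: sum.distrib S_def) (simp add: sum_distrib_left sum_divide_distrib)
  also have "(\<Sum>i<m. \<bar>c i\<bar>)\<^sup>2 \<le> m * S"
    using Cauchy_Schwarz_ineq_sum[of "\<lambda>_. 1" "\<lambda>i. \<bar>c i\<bar>" "{..<m}"] by (simp add: S_def)
  finally have "0 \<le> ip x x - 2 * (K * S) + (K * S + L / 1000 * (m * S))"
    by (simp add: mult_left_mono)
  then have "0 \<le> K * (1 - 999 / 1000 * S)" using x by (simp add: ip_self K_def algebra_simps)
  then have "S \<le> 1000 / 999" using K by (simp add: zero_le_mult_iff)
  then show ?thesis by (simp add: S_def c_def K_def)
qed

lemma feature_sh: "t \<in> I \<times> I \<times> I \<Longrightarrow> feature (sh j x) t = feature x t"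
proof -
  assume "t \<in> I \<times> I \<times> I"
  then obtain p q r where t: "t = (p, q, r)" by (cases t) auto
  have "feature (sh j x) t = (\<Sum>k<m. sh ((k + j) mod m) x p * sh ((k + j) mod m) x q * sh ((k + j) mod m) x r)"
    by (simp add: feature_def t sh_sh sh_mod)
  also have "\<dots> = feature x t"
    unfolding feature_def t using sum_mod_shift[OF m_pos, of "\<lambda>k. sh k x p * sh k x q * sh k x r" j] by simp
  finally show ?thesis .
qed

text \<open>Inner products of third tensor powers are cubes of inner products, and those of the
  shifts by j and k depend only on k - j.\<close>

lemma feature_inner:
  "(\<Sum>t\<in>I \<times> I \<times> I. feature x t * feature y t) = m * (\<Sum>k<m. (ip x (sh k y)) ^ 3)"
proof -
  have "(\<Sum>t\<in>I \<times> I \<times> I. feature x t * feature y t) =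
     (\<Sum>(p, q, r)\<in>I \<times> I \<times> I. \<Sum>j<m. \<Sum>k<m. (sh j x p * sh k y p) * ((sh j x q * sh k y q) * (sh j x r * sh k y r)))"
    by (intro sum.cong refl) (auto simp: feature_def sum_product mult_ac)
  also have "\<dots> = (\<Sum>j<m. \<Sum>k<m. \<Sum>(p, q, r)\<in>I \<times> I \<times> I. (sh j x p * sh k y p) * ((sh j x q * sh k y q) * (sh j x r * sh k y r)))"
    unfolding case_prod_unfold by (subst sum.swap, intro sum.cong refl, subst sum.swap) (rule refl)
  also have "\<dots> = (\<Sum>j<m. \<Sum>k<m. (ip (sh j x) (sh k y)) ^ 3)"
    unfolding sum.cartesian_product[symmetric] ip_def
    by (simp add: power3_eq_cube sum_product sum_distrib_left mult.assoc flip: sum_distrib_left)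
  also have "\<dots> = (\<Sum>j<m. \<Sum>k<m. (ip (sh j x) (sh ((k + j) mod m) y)) ^ 3)"
    using sum_mod_shift[OF m_pos] by (metis (no_types, lifting) sum.cong)
  also have "\<dots> = (\<Sum>j<m. \<Sum>k<m. (ip x (sh k y)) ^ 3)"
  proof (intro sum.cong refl)
    fix j k
    have "sh ((k + j) mod m) y = sh j (sh k y)" by (simp add: sh_mod sh_sh add.commute)
    then show "(ip (sh j x) (sh ((k + j) mod m) y)) ^ 3 = (ip x (sh k y)) ^ 3" by (simp add: ip_sh)
  qed
  finally show ?thesis by simp
qed

text \<open>With K = m L the squared feature distance is m K^3 q, and e = 2 \<open>qd x y\<close> /
  K doubles the constants 17/1000 and 205 of \<open>cubic_sum_bounds\<close>. Alignment puts the
  largest correlation at j = 0.\<close>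

lemma feature_distance_aligned:
  assumes g: "good x" "good y" and L: "L > 0" and aligned: "qd x y = ham x y"
  shows "34 / 1000 * (real m * (real m * real L)\<^sup>2) * qd x y \<le> (\<Sum>t\<in>I \<times> I \<times> I. (feature x t - feature y t)\<^sup>2)"
    and "(\<Sum>t\<in>I \<times> I \<times> I. (feature x t - feature y t)\<^sup>2) \<le> 410 * (real m * (real m * real L)\<^sup>2) * qd x y"
proof -
  define K where "K = real (m * L)"
  have K: "K > 0" using L m_pos by (simp add: K_def)
  have cu: "x \<in> cube I" "y \<in> cube I" using g good_cube by auto
  define e where "e = 2 * qd x y / K"
  define a b c where "a = (\<lambda>j. ip x (sh j x) / K)" and "b = (\<lambda>j. ip y (sh j y) / K)" and "c = (\<lambda>j. ip x (sh j y) / K)"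
  define q where "q = (\<Sum>j<m. (a j) ^ 3 + (b j) ^ 3 - 2 * (c j) ^ 3)"
  have m1: "m \<ge> 1" using m_pos by simp
  have small: "\<bar>ip z (sh j z) / K\<bar> \<le> 1 / (1000 * real m)" if "good z" "j \<in> {1..<m}" for z j
  proof -
    have "\<bar>ip z (sh j z)\<bar> / K \<le> L / 1000 / K" using that K by (intro divide_right_mono) (auto simp: good_def)
    also have "\<dots> = 1 / (1000 * real m)" using L by (simp add: K_def)
    finally show ?thesis using K by simp
  qed
  have hamxy: "ham y x / K = e / 2" "ham x y / K = e / 2" using aligned by (simp_all add: e_def ham_commute)
  have ca: "\<bar>c j - a j\<bar> \<le> e" for j
  proof -
    have "\<bar>c j - a j\<bar> = \<bar>ip x (sh j y) - ip x (sh j x)\<bar> / K"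
      using K by (simp add: c_def a_def flip: diff_divide_distrib)
    also have "\<dots> \<le> 2 * ham (sh j y) (sh j x) / K" using ip_diff_le[OF cu(1)] K by (intro divide_right_mono) auto
    finally show ?thesis using hamxy by (simp add: ham_sh field_simps)
  qed
  have cb: "\<bar>c j - b j\<bar> \<le> e" for j
  proof -
    have "\<bar>c j - b j\<bar> = \<bar>ip (sh j y) x - ip (sh j y) y\<bar> / K"
      using K by (simp add: c_def b_def ip_commute flip: diff_divide_distrib)
    also have "\<dots> \<le> 2 * ham x y / K" using ip_diff_le[OF sh_cube[OF cu(2)]] K by (intro divide_right_mono) auto
    finally show ?thesis using hamxy by (simp add: field_simps)
  qed
  have ch: "c j = 1 - 2 * ham x (sh j y) / K" for j
    using ip_ham[OF cu(1) sh_cube[OF cu(2)], of j] L m_pos by (simp add: c_def K_def field_simps)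
  have cle: "c j \<le> 1 - e" for j
    using qd_le[of x y j] K by (simp add: ch e_def divide_right_mono)
  have c0: "c 0 = 1 - e" using aligned by (simp add: ch e_def sh_0 cu)
  have e0: "0 \<le> e" using K by (simp add: e_def qd_nonneg)
  have e2: "e \<le> 2"
  proof -
    have "(\<Sum>p\<in>I. \<bar>x p - y p\<bar>) \<le> (\<Sum>p\<in>I. 2)"
    proof (rule sum_mono)
      fix p assume "p \<in> I"
      then show "\<bar>x p - y p\<bar> \<le> 2" using cube_mem[OF cu(1)] cube_mem[OF cu(2)] by fastforce
    qed
    then have "ham x y \<le> K" by (simp add: ham_def card_I K_def)
    then show ?thesis using K aligned by (simp add: e_def field_simps)
  qed
  have a0: "a 0 = 1" and b0: "b 0 = 1" using L m_pos cu by (simp_all add: a_def b_def sh_0 ip_self K_def)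
  have bessel: "(\<Sum>j<m. (c j)\<^sup>2) \<le> 1000 / 999"
    using bessel_shifts[OF cu(1) g(2) L] by (simp only: c_def K_def)
  have sa: "\<bar>a j\<bar> \<le> 1 / (1000 * real m)" and sb: "\<bar>b j\<bar> \<le> 1 / (1000 * real m)" if "j \<in> {1..<m}" for j
    using small[OF g(1) that] small[OF g(2) that] by (simp_all only: a_def b_def)
  have "17 / 1000 * e \<le> q"
    unfolding q_def by (rule cubic_sum_bounds(1)[of m a b c e, OF m1 a0 b0 c0 e0 e2]) (rule sa sb ca cb cle bessel | assumption)+
  moreover have "q \<le> 205 * e"
    unfolding q_def by (rule cubic_sum_bounds(2)[of m a b c e, OF m1 a0 b0 c0 e0 e2]) (rule sa sb ca cb cle bessel | assumption)+
  ultimately have q: "17 / 1000 * e \<le> q" "q \<le> 205 * e" by auto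
  have "(\<Sum>t\<in>I \<times> I \<times> I. (feature x t - feature y t)\<^sup>2) =
      (\<Sum>t\<in>I \<times> I \<times> I. feature x t * feature x t + feature y t * feature y t - 2 * (feature x t * feature y t))"
    by (intro sum.cong refl) (simp add: power2_eq_square algebra_simps)
  also have "\<dots> = m * (\<Sum>k<m. (ip x (sh k x)) ^ 3) + m * (\<Sum>k<m. (ip y (sh k y)) ^ 3) - 2 * (m * (\<Sum>k<m. (ip x (sh k y)) ^ 3))"
    by (simp only: sum.distrib sum_subtractf sum_distrib_left[symmetric] feature_inner)
  also have "\<dots> = m * K ^ 3 * q"
    using K unfolding q_def a_def b_def c_def
    by (simp add: sum.distrib sum_subtractf sum_distrib_left sum_divide_distrib[symmetric] power_divide algebra_simps flip: sum_distrib_left)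
  finally have Q: "(\<Sum>t\<in>I \<times> I \<times> I. (feature x t - feature y t)\<^sup>2) = m * K ^ 3 * q" .
  have Ke: "m * K ^ 3 * e = 2 * (m * K\<^sup>2) * qd x y" using K by (simp add: e_def power3_eq_cube power2_eq_square)
  have "m * K ^ 3 * (17 / 1000 * e) \<le> m * K ^ 3 * q" "m * K ^ 3 * q \<le> m * K ^ 3 * (205 * e)"
    by (rule mult_left_mono[OF q(1)], use K in simp) (rule mult_left_mono[OF q(2)], use K in simp)
  then show "34 / 1000 * (real m * (real m * real L)\<^sup>2) * qd x y \<le> (\<Sum>t\<in>I \<times> I \<times> I. (feature x t - feature y t)\<^sup>2)"
    and "(\<Sum>t\<in>I \<times> I \<times> I. (feature x t - feature y t)\<^sup>2) \<le> 410 * (real m * (real m * real L)\<^sup>2) * qd x y"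
    unfolding Q using Ke unfolding K_def of_nat_mult by linarith+
qed

text \<open>Replacing y by the shift that attains the distance changes neither its features nor its
  goodness.\<close>

lemma feature_distance:
  assumes g: "good x" "good y" and L: "L > 0"
  shows "34 / 1000 * (real m * (real m * real L)\<^sup>2) * qd x y \<le> (\<Sum>t\<in>I \<times> I \<times> I. (feature x t - feature y t)\<^sup>2)"
    and "(\<Sum>t\<in>I \<times> I \<times> I. (feature x t - feature y t)\<^sup>2) \<le> 410 * (real m * (real m * real L)\<^sup>2) * qd x y"
proof -
  obtain j where j: "qd x y = ham x (sh j y)" using qd_attained by blast
  have qs: "qd x (sh j y) = qd x y" using g by (simp add: qd_sh_right good_cube)
  have s: "(\<Sum>t\<in>I \<times> I \<times> I. (feature x t - feature (sh j y) t)\<^sup>2) = (\<Sum>t\<in>I \<times> I \<times> I. (feature x t - feature y t)\<^sup>2)"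
    by (intro sum.cong refl) (simp add: feature_sh)
  show "34 / 1000 * (real m * (real m * real L)\<^sup>2) * qd x y \<le> (\<Sum>t\<in>I \<times> I \<times> I. (feature x t - feature y t)\<^sup>2)"
    and "(\<Sum>t\<in>I \<times> I \<times> I. (feature x t - feature y t)\<^sup>2) \<le> 410 * (real m * (real m * real L)\<^sup>2) * qd x y"
    using feature_distance_aligned[OF g(1) good_sh[OF g(2)] L, of j] qs j s by auto
qed

text \<open>The constant D has to exceed 1024 times the ratio of 410 to 34/1000, which is about 12.4
  million.\<close>

lemma sketchable_good:
  assumes "finite X" "\<And>x. x \<in> X \<Longrightarrow> good (h x)" "L > 0"
  shows "sketchable 4 20000000 X (\<lambda>x y. qd (h x) (h y))"
proof (rule sketchable_of_integer_vectors[where V = "\<lambda>x. feature (h x)" and J = "I \<times> I \<times> I"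
      and a = "34 / 1000 * (real m * (real m * real L)\<^sup>2)" and b = "410 * (real m * (real m * real L)\<^sup>2)"])
  show "nonnegative_kernel X (\<lambda>x y. qd (h x) (h y))"
    unfolding nonnegative_kernel_def using assms(2) by (auto simp: qd_nonneg qd_commute good_cube)
  fix x t assume xt: "x \<in> X" "t \<in> I \<times> I \<times> I"
  have "h x p \<in> \<int>" if "p \<in> I" for p using cube_mem[OF good_cube[OF assms(2)[OF xt(1)]] that] by auto
  then have "sh j (h x) p \<in> \<int>" if "p \<in> I" for j p using that by (simp add: rot_I)
  then show "feature (h x) t \<in> \<int>" using xt unfolding feature_def
    by (auto intro!: Ints_sum Ints_mult simp del: sh_apply)
next
  show "0 < 34 / 1000 * (real m * (real m * real L)\<^sup>2)" "0 < 410 * (real m * (real m * real L)\<^sup>2)" using assms(3) m_pos by auto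
  show "1024 * (410 * (real m * (real m * real L)\<^sup>2)) \<le> 34 / 1000 * (real m * (real m * real L)\<^sup>2) * 20000000"
    by simp
qed (use assms feature_distance in auto)

end

section \<open>Snowflakes of the line as superpositions of cuts\<close>

text \<open>The point a lies in \<open>{u<..u + r}\<close> exactly when u lies in
  \<open>{a - r..<a}\<close>, so the integrand is the indicator of the symmetric difference of two
  intervals of length r.\<close>

lemma has_bochner_integral_interval_cut:
  fixes a b r :: real
  assumes "r \<ge> 0"
  shows "has_bochner_integral lborel
    (\<lambda>u. \<bar>of_bool (a \<in> {u<..u + r}) - of_bool (b \<in> {u<..u + r})\<bar> :: real) (2 * min \<bar>a - b\<bar> r)"
proof (induction a b rule: linorder_wlog)
  case (le a b)
  have "has_bochner_integral lborel (\<lambda>u. indicator {a - r..<min a (b - r)} u + indicator {max a (b - r)..<b} u :: real)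
     (measure lborel {a - r..<min a (b - r)} + measure lborel {max a (b - r)..<b})"
  proof -
    have "emeasure lborel {c..<d} < \<infinity>" for c d :: real
      by (rule emeasure_bounded_finite, rule bounded_subset[OF bounded_closed_interval[of c d]]) auto
    then show ?thesis
      by (intro has_bochner_integral_add has_bochner_integral_real_indicator) auto
  qed
  moreover have "measure lborel {a - r..<min a (b - r)} + measure lborel {max a (b - r)..<b} = 2 * min \<bar>a - b\<bar> r"
    using le assms by (auto simp: min_def max_def)
  moreover have "(\<lambda>u. indicator {a - r..<min a (b - r)} u + indicator {max a (b - r)..<b} u :: real) =
     (\<lambda>u. \<bar>of_bool (a \<in> {u<..u + r}) - of_bool (b \<in> {u<..u + r})\<bar>)"
    using le assms by (auto simp: fun_eq_iff indicator_def)
  ultimately show ?case by simp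
next
  case (sym a b)
  then show ?case by (simp add: abs_minus_commute)
qed

text \<open>On finitely many nodes an increasing concave function is a nonnegative combination of
  the truncations min(u, r). Induction removes the largest node b, whose weight is the last slope.
  Monotonicity is asked on the nodes only, because it need not survive beyond them once a linear
  function is subtracted.\<close>

lemma concave_min_representation:
  fixes h :: "real \<Rightarrow> real"
  assumes "finite U" "\<And>u. u \<in> U \<Longrightarrow> u > 0" "h 0 = 0"
    and "\<And>x y z. 0 \<le> x \<Longrightarrow> x < y \<Longrightarrow> y < z \<Longrightarrow> (h z - h y) * (y - x) \<le> (h y - h x) * (z - y)"
    and "\<And>u v. u \<in> insert 0 U \<Longrightarrow> v \<in> insert 0 U \<Longrightarrow> u \<le> v \<Longrightarrow> h u \<le> h v"
  shows "\<exists>w. (\<forall>r\<in>U. 0 \<le> w r) \<and> (\<forall>u\<in>insert 0 U. h u = (\<Sum>r\<in>U. w r * min u r))"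
  using assms
proof (induction U arbitrary: h rule: finite_linorder_max_induct)
  case empty then show ?case by simp
next
  case (insert b U)
  define a where "a = Max (insert 0 U)"
  have a_in: "a \<in> insert 0 U" unfolding a_def using insert.hyps by (intro Max_in) auto
  have a_max: "u \<le> a" if "u \<in> insert 0 U" for u unfolding a_def using insert.hyps that by (intro Max_ge) auto
  have ab: "a < b" using a_in insert by auto
  \<comment> \<open>By concavity the slope over the last gap is the smallest, so subtracting s u
    keeps h increasing on the smaller nodes.\<close>
  define s where "s = (h b - h a) / (b - a)"
  have s: "s * (b - a) = h b - h a" using ab by (simp add: s_def)
  have s0: "0 \<le> s" unfolding s_def using ab insert.prems(4)[of a b] a_in by (intro divide_nonneg_nonneg) auto
  have slope: "s * (b - u) \<le> h b - h u" if u: "u \<in> insert 0 U" for u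
  proof (cases "u = a")
    case False
    then have "u < a" "0 \<le> u" using a_max[OF u] u insert.prems(1) by (auto simp: less_imp_le)
    then have "(h b - h a) * (a - u) \<le> (h a - h u) * (b - a)" using insert.prems(3)[of u a b] ab by simp
    then have "s * (a - u) * (b - a) \<le> (h a - h u) * (b - a)"
      unfolding s[symmetric] by (simp only: mult_ac)
    then have "s * (a - u) \<le> h a - h u" using ab by simp
    then show ?thesis using s by (simp add: algebra_simps)
  qed (use s in simp)
  define h' where "h' = (\<lambda>u. h u - s * u)"
  have "\<exists>w. (\<forall>r\<in>U. 0 \<le> w r) \<and> (\<forall>u\<in>insert 0 U. h' u = (\<Sum>r\<in>U. w r * min u r))"
  proof (rule insert.IH)
    show "h' 0 = 0" using insert.prems by (simp add: h'_def)
    show "(h' z - h' y) * (y - x) \<le> (h' y - h' x) * (z - y)" if "0 \<le> x" "x < y" "y < z" for x y z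
      using insert.prems(3)[OF that] by (simp add: h'_def algebra_simps)
    show "h' u \<le> h' v" if uv: "u \<in> insert 0 U" "v \<in> insert 0 U" "u \<le> v" for u v
    proof (cases "u = v")
      case False
      have u0: "0 \<le> u" using uv(1) insert.prems(1) by (auto simp: less_imp_le)
      have vb: "v < b" using a_max[OF uv(2)] ab by simp
      have "(h b - h v) * (v - u) \<le> (h v - h u) * (b - v)"
        using insert.prems(3)[of u v b] u0 vb uv False by simp
      moreover have "s * (b - v) * (v - u) \<le> (h b - h v) * (v - u)"
        using slope[OF uv(2)] uv by (intro mult_right_mono) auto
      ultimately have "s * (v - u) * (b - v) \<le> (h v - h u) * (b - v)" by (simp add: mult_ac)
      then have "s * (v - u) \<le> h v - h u" using vb by simp
      then show ?thesis by (simp add: h'_def algebra_simps)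
    qed simp
  qed (use insert.prems in auto)
  then obtain w where w: "\<forall>r\<in>U. 0 \<le> w r" "\<forall>u\<in>insert 0 U. h' u = (\<Sum>r\<in>U. w r * min u r)" by blast
  define w' where "w' = w(b := s)"
  have bU: "b \<notin> U" using insert.hyps by auto
  have sum_w': "(\<Sum>r\<in>insert b U. w' r * min u r) = s * min u b + (\<Sum>r\<in>U. w r * min u r)" for u
    using insert.hyps bU unfolding w'_def by (subst sum.insert) (auto intro!: sum.cong)
  have "h u = (\<Sum>r\<in>insert b U. w' r * min u r)" if u: "u \<in> insert 0 (insert b U)" for u
  proof (cases "u = b")
    case True
    \<comment> \<open>All remaining nodes are at most a, so their truncations no longer distinguish
      b from a.\<close>
    have "(\<Sum>r\<in>U. w r * min b r) = (\<Sum>r\<in>U. w r * min a r)"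
      using a_max ab by (intro sum.cong refl) (fastforce simp: min_def)
    also have "\<dots> = h' a" by (rule sym, rule bspec[OF w(2) a_in])
    finally show ?thesis unfolding sum_w' True using s by (simp add: h'_def algebra_simps)
  next
    case False
    then have u': "u \<in> insert 0 U" using u by auto
    then have "min u b = u" using a_max ab by (force simp: min_def)
    then show ?thesis unfolding sum_w' using bspec[OF w(2) u'] by (simp add: h'_def)
  qed
  moreover have "\<forall>r\<in>insert b U. 0 \<le> w' r" using w(1) s0 by (auto simp: w'_def)
  ultimately show ?case by blast
qed

text \<open>Both chords are compared with the tangent at y, which lies above the graph by Young's
  inequality; the point 0 is checked separately.\<close>

lemma powr_chord_slopes:
  fixes p :: real
  assumes p: "0 < p" "p < 1" and "0 \<le> x" "x < y" "y < z"
  shows "(z powr p - y powr p) * (y - x) \<le> (y powr p - x powr p) * (z - y)"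
proof -
  have y: "y > 0" using assms by simp
  define k where "k = p * y powr (p - 1)"
  have tangent: "u powr p - y powr p \<le> k * (u - y)" if u: "u \<ge> 0" for u
  proof (cases "u = 0")
    case True
    have "y powr p = y powr (p - 1) * y" using y by (simp add: powr_diff)
    then show ?thesis using True p y mult_right_mono[of p 1 "y powr p"] by (simp add: k_def mult.assoc)
  next
    case False
    then have "u powr p * y powr (1 - p) \<le> p * u + (1 - p) * y"
      using Youngs_inequality_0[of p "1 - p" u y] p y u by simp
    then have "u powr p * y powr (1 - p) * y powr (p - 1) \<le> (p * u + (1 - p) * y) * y powr (p - 1)"
      by (intro mult_right_mono) auto
    moreover have "u powr p * y powr (1 - p) * y powr (p - 1) = u powr p"
      using y by (simp add: mult.assoc flip: powr_add)
    ultimately have "u powr p \<le> (p * u + (1 - p) * y) * y powr (p - 1)" by (simp only:)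
    also have "\<dots> = k * (u - y) + y * y powr (p - 1)" by (simp add: k_def algebra_simps)
    also have "y * y powr (p - 1) = y powr p" using y by (simp add: powr_diff)
    finally show ?thesis by simp
  qed
  have "(z powr p - y powr p) * (y - x) \<le> k * (z - y) * (y - x)"
    using tangent[of z] assms by (intro mult_right_mono) auto
  also have "\<dots> = k * (y - x) * (z - y)" by simp
  also have "\<dots> \<le> (y powr p - x powr p) * (z - y)"
    using tangent[of x] assms by (intro mult_right_mono) (auto simp: algebra_simps)
  finally show ?thesis .
qed

text \<open>The snowflaked line is a superposition of cuts, so an inequality between weighted averages of
  distances need only be checked on cuts.\<close>

lemma powr_distance_of_cuts:
  fixes F :: "'a \<Rightarrow> real" and W :: "'a \<Rightarrow> 'a \<Rightarrow> real"
  assumes Y: "finite Y" and p: "0 < p" "p < 1"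
    and cut: "\<And>T :: real set. 0 \<le> (\<Sum>x\<in>Y. \<Sum>y\<in>Y. W x y * \<bar>of_bool (F x \<in> T) - of_bool (F y \<in> T)\<bar>)"
  shows "0 \<le> (\<Sum>x\<in>Y. \<Sum>y\<in>Y. W x y * \<bar>F x - F y\<bar> powr p)"
proof -
  \<comment> \<open>Truncated distance is the integral over u of the cuts by the intervals (u, u +
    r], so the hypothesis passes to it.\<close>
  have trunc: "0 \<le> (\<Sum>x\<in>Y. \<Sum>y\<in>Y. W x y * min \<bar>F x - F y\<bar> r)" if r: "r \<ge> 0" for r
  proof -
    have "has_bochner_integral lborel (\<lambda>u. \<Sum>x\<in>Y. \<Sum>y\<in>Y. W x y * \<bar>of_bool (F x \<in> {u<..u + r}) - of_bool (F y \<in> {u<..u + r})\<bar>)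
       (\<Sum>x\<in>Y. \<Sum>y\<in>Y. W x y * (2 * min \<bar>F x - F y\<bar> r))" (is "has_bochner_integral lborel ?f ?S")
      by (intro has_bochner_integral_sum has_bochner_integral_mult_right has_bochner_integral_interval_cut r)
    then have "integral\<^sup>L lborel ?f = ?S" by (rule has_bochner_integral_integral_eq)
    moreover have "0 \<le> integral\<^sup>L lborel ?f" by (rule Bochner_Integration.integral_nonneg) (rule cut)
    moreover have "?S = 2 * (\<Sum>x\<in>Y. \<Sum>y\<in>Y. W x y * min \<bar>F x - F y\<bar> r)"
      by (simp add: sum_distrib_left mult_ac)
    ultimately show ?thesis by simp
  qed
  \<comment> \<open>The power has to be represented only at the finitely many distances that occur,
    so a finite combination of truncations suffices.\<close>
  define U where "U = (\<lambda>(x, y). \<bar>F x - F y\<bar>) ` (Y \<times> Y) - {0}"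
  have U: "finite U" "\<And>u. u \<in> U \<Longrightarrow> u > 0" using Y by (auto simp: U_def)
  have "\<exists>w. (\<forall>r\<in>U. 0 \<le> w r) \<and> (\<forall>u\<in>insert 0 U. u powr p = (\<Sum>r\<in>U. w r * min u r))"
  proof (rule concave_min_representation[OF U])
    fix u v assume "u \<in> insert 0 U" "v \<in> insert 0 U" "u \<le> v"
    then show "u powr p \<le> v powr p" using U(2) p by (intro powr_mono2) (auto simp: less_imp_le)
  qed (use powr_chord_slopes[OF p] in auto)
  then obtain w where w: "\<And>r. r \<in> U \<Longrightarrow> 0 \<le> w r" "\<And>u. u \<in> insert 0 U \<Longrightarrow> u powr p = (\<Sum>r\<in>U. w r * min u r)"
    by blast
  have "(\<Sum>x\<in>Y. \<Sum>y\<in>Y. W x y * \<bar>F x - F y\<bar> powr p) = (\<Sum>x\<in>Y. \<Sum>y\<in>Y. \<Sum>r\<in>U. w r * (W x y * min \<bar>F x - F y\<bar> r))"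
  proof (intro sum.cong refl)
    fix x y assume "x \<in> Y" "y \<in> Y"
    then have "\<bar>F x - F y\<bar> \<in> insert 0 U" by (auto simp: U_def)
    then show "W x y * \<bar>F x - F y\<bar> powr p = (\<Sum>r\<in>U. w r * (W x y * min \<bar>F x - F y\<bar> r))"
      by (simp add: w(2) sum_distrib_left mult_ac)
  qed
  also have "\<dots> = (\<Sum>x\<in>Y. \<Sum>r\<in>U. \<Sum>y\<in>Y. w r * (W x y * min \<bar>F x - F y\<bar> r))"
    by (intro sum.cong refl sum.swap)
  also have "\<dots> = (\<Sum>r\<in>U. w r * (\<Sum>x\<in>Y. \<Sum>y\<in>Y. W x y * min \<bar>F x - F y\<bar> r))"
    by (subst sum.swap) (simp add: sum_distrib_left)
  also have "\<dots> \<ge> 0"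
    using U by (intro sum_nonneg, intro mult_nonneg_nonneg[OF w(1) trunc]) (auto simp: less_imp_le)
  finally show ?thesis .
qed

lemma powr_abs_diff_le:
  fixes a b p :: real
  assumes p: "0 < p" "p < 1"
  shows "\<bar>a - b\<bar> powr p \<le> \<bar>a\<bar> powr p + \<bar>b\<bar> powr p"
proof -
  have add: "(u + v) powr p \<le> u powr p + v powr p" if uv: "0 \<le> u" "0 \<le> v" for u v :: real
  proof (cases "u + v = 0")
    case False
    then have s: "u + v > 0" using uv by simp
    have le: "t * (u + v) powr (p - 1) \<le> t powr p" if t: "0 \<le> t" "t \<le> u + v" for t
    proof (cases "t = 0")
      case False
      then have "(u + v) powr (p - 1) \<le> t powr (p - 1)" using t p by (intro powr_mono2') auto
      then have "t * (u + v) powr (p - 1) \<le> t * t powr (p - 1)" using t by (intro mult_left_mono)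
      also have "\<dots> = t powr p" using t False by (simp add: powr_diff)
      finally show ?thesis .
    qed simp
    have "(u + v) powr p = u * (u + v) powr (p - 1) + v * (u + v) powr (p - 1)"
    proof -
      have "(u + v) powr p = (u + v) * (u + v) powr (p - 1)" using s by (simp add: powr_diff)
      then show ?thesis by (simp only: distrib_right)
    qed
    then show ?thesis using le[of u] le[of v] uv by linarith
  qed (use uv in auto)
  have "\<bar>a - b\<bar> powr p \<le> (\<bar>a\<bar> + \<bar>b\<bar>) powr p" using p by (intro powr_mono2) auto
  also have "\<dots> \<le> \<bar>a\<bar> powr p + \<bar>b\<bar> powr p" by (rule add) auto
  finally show ?thesis .
qed

section \<open>The Poincare inequality on good points\<close>

context shift_cube
begin

definition noise_rate :: "nat \<Rightarrow> real" where "noise_rate l = cos (pi / (2 * l))"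

text \<open>The lower bound on 1 - \<open>noise_rate l\<close> lets good points stay good; the upper
  bound says that noise moves a point by at most m L / l^2 on average.\<close>

lemma noise_rate:
  assumes "l \<ge> 1"
  shows "0 \<le> noise_rate l" "noise_rate l < 1" "3 / (4 * (real l)\<^sup>2) \<le> 1 - noise_rate l"
    "1 - noise_rate l \<le> 2 / (real l)\<^sup>2"
proof -
  have l: "real l > 0" using assms by simp
  have "pi / real (2 * l) \<le> pi / 2" "0 \<le> pi / real (2 * l)" using assms by (auto simp: field_simps)
  moreover have "- (pi / 2) \<le> 0" by simp
  ultimately show "0 \<le> noise_rate l" unfolding noise_rate_def by (intro cos_ge_zero) linarith+
  show 1: "3 / (4 * (real l)\<^sup>2) \<le> 1 - noise_rate l"
    unfolding noise_rate_def by (rule one_minus_cos_ge[OF assms])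
  have "3 / (4 * (real l)\<^sup>2) > 0" using l by simp
  then show "noise_rate l < 1" using 1 by linarith
  define t where "t = pi / real (4 * l)"
  have "1 - noise_rate l = 2 * (sin t)\<^sup>2" using cos_double_sin[of t] by (simp add: noise_rate_def t_def)
  also have "\<dots> \<le> 2 * t\<^sup>2"
    using abs_sin_x_le_abs_x[of t] by (intro mult_left_mono) (auto simp: abs_le_square_iff)
  also have "\<dots> \<le> 2 * (1 / l)\<^sup>2"
    using l pi_less_4 by (intro mult_left_mono power_mono) (auto simp: t_def field_simps)
  finally show "1 - noise_rate l \<le> 2 / (real l)\<^sup>2" by (simp add: power_divide)
qed

definition both_good :: "(nat \<times> nat \<Rightarrow> real) \<Rightarrow> (nat \<times> nat \<Rightarrow> real) \<Rightarrow> real" where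
  "both_good x y = of_bool (good x \<and> good y)"

text \<open>Isoperimetry is applied to the indicator of the good points with F in T. It changes
  either across the cut between good points or because one point is not good. The latter has
  probability at most \<open>\<mu>\<close>/(80 l), and 40 l times this is \<open>\<mu>\<close>/2,
  which is absorbed.\<close>

lemma cut_poincare_half:
  assumes inv: "\<And>j x. x \<in> cube I \<Longrightarrow> F (sh j x) = F x"
    and half: "corr_exp 0 I (\<lambda>x y. of_bool (good x \<and> F x \<in> T)) \<le> 1 / 2"
    and l: "l \<ge> 1" and m: "60 * 9 ^ (l\<^sup>2) * l ^ 5 \<le> m"
    and stay: "\<And>x. good x \<Longrightarrow> noise_mean (noise_rate l) I x (\<lambda>y. of_bool (\<not> good y)) \<le> 1 / (160 * real l)"
  shows "corr_exp 0 I (\<lambda>x y. both_good x y * \<bar>of_bool (F x \<in> T) - of_bool (F y \<in> T)\<bar>) \<le>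
    160 * real l * corr_exp (noise_rate l) I (\<lambda>x y. both_good x y * \<bar>of_bool (F x \<in> T) - of_bool (F y \<in> T)\<bar>)"
proof -
  define f :: "_ \<Rightarrow> real" where "f = (\<lambda>x. of_bool (good x \<and> F x \<in> T))"
  define \<mu> where "\<mu> = corr_exp 0 I (\<lambda>x y. f x)"
  define N where "N = corr_exp (noise_rate l) I (\<lambda>x y. both_good x y * \<bar>of_bool (F x \<in> T) - of_bool (F y \<in> T)\<bar>)"
  have \<rho>: "\<bar>noise_rate l\<bar> \<le> 1" using noise_rate[OF l] by simp
  have finv: "f (sh j x) = f x" if "x \<in> cube I" for j x
    using that by (simp add: f_def good_sh_iff inv)
  have iso: "\<mu> \<le> 40 * real l * corr_exp (noise_rate l) I (\<lambda>x y. \<bar>f x - f y\<bar>)"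
    unfolding \<mu>_def noise_rate_def
    by (rule invariant_isoperimetry[OF finv _ _ l m]) (use half in \<open>auto simp: f_def\<close>)
  have leave: "corr_exp (noise_rate l) I (\<lambda>x y. f x * of_bool (\<not> good y)) \<le> \<mu> / (160 * real l)"
  proof -
    have "corr_exp (noise_rate l) I (\<lambda>x y. f x * of_bool (\<not> good y)) =
        (\<Sum>x\<in>cube I. f x * noise_mean (noise_rate l) I x (\<lambda>y. of_bool (\<not> good y))) / 2 ^ card I"
      unfolding corr_exp_noise_mean noise_mean_cmult ..
    also have "\<dots> \<le> (\<Sum>x\<in>cube I. f x * (1 / (160 * real l))) / 2 ^ card I"
    proof (intro divide_right_mono sum_mono)
      fix x
      show "f x * noise_mean (noise_rate l) I x (\<lambda>y. of_bool (\<not> good y)) \<le> f x * (1 / (160 * real l))"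
        using stay[of x] by (auto simp: f_def)
    qed auto
    also have "\<dots> = \<mu> / (160 * real l)"
      by (simp add: \<mu>_def corr_exp_fst sum_divide_distrib mult_ac)
    finally show ?thesis .
  qed
  have "corr_exp (noise_rate l) I (\<lambda>x y. \<bar>f x - f y\<bar>) \<le> corr_exp (noise_rate l) I (\<lambda>x y.
      both_good x y * \<bar>of_bool (F x \<in> T) - of_bool (F y \<in> T)\<bar> + f x * of_bool (\<not> good y) + f y * of_bool (\<not> good x))"
    by (rule corr_exp_mono[OF _ \<rho>]) (auto simp: f_def both_good_def)
  also have "\<dots> \<le> N + \<mu> / (160 * real l) + \<mu> / (160 * real l)"
    unfolding corr_exp_add N_def
    using leave corr_exp_swap[of "noise_rate l" I "\<lambda>x y. f x * of_bool (\<not> good y)"] by simp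
  finally have "40 * real l * corr_exp (noise_rate l) I (\<lambda>x y. \<bar>f x - f y\<bar>) \<le> 40 * real l * (N + \<mu> / (80 * real l))"
    by (intro mult_left_mono) auto
  also have "\<dots> = 40 * real l * N + \<mu> / 2" using l by (simp add: field_simps)
  finally have "2 * \<mu> \<le> 160 * real l * N" using iso by linarith
  moreover have "corr_exp 0 I (\<lambda>x y. both_good x y * \<bar>of_bool (F x \<in> T) - of_bool (F y \<in> T)\<bar>) \<le> corr_exp 0 I (\<lambda>x y. f x + f y)"
    by (rule corr_exp_mono) (auto simp: f_def both_good_def)
  moreover have "corr_exp 0 I (\<lambda>x y. f x + f y) = 2 * \<mu>"
    using corr_exp_swap[of 0 I "\<lambda>x y. f x"] by (simp add: corr_exp_add \<mu>_def)
  ultimately show ?thesis by (simp add: N_def)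
qed

text \<open>T and its complement define the same cut, and one of the two has measure at most 1/2
  among the good points.\<close>

lemma cut_poincare:
  assumes inv: "\<And>j x. x \<in> cube I \<Longrightarrow> F (sh j x) = F x"
    and l: "l \<ge> 1" and m: "60 * 9 ^ (l\<^sup>2) * l ^ 5 \<le> m"
    and stay: "\<And>x. good x \<Longrightarrow> noise_mean (noise_rate l) I x (\<lambda>y. of_bool (\<not> good y)) \<le> 1 / (160 * real l)"
  shows "corr_exp 0 I (\<lambda>x y. both_good x y * \<bar>of_bool (F x \<in> T) - of_bool (F y \<in> T)\<bar>) \<le>
    160 * real l * corr_exp (noise_rate l) I (\<lambda>x y. both_good x y * \<bar>of_bool (F x \<in> T) - of_bool (F y \<in> T)\<bar>)"
proof (cases "corr_exp 0 I (\<lambda>x y. of_bool (good x \<and> F x \<in> T)) \<le> 1 / 2")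
  case True
  then show ?thesis using cut_poincare_half[where F = F and T = T] assms by blast
next
  case False
  have "corr_exp 0 I (\<lambda>x y. of_bool (good x \<and> F x \<in> T) + of_bool (good x \<and> F x \<in> - T)) \<le> corr_exp 0 I (\<lambda>x y. 1)"
    by (rule corr_exp_mono) auto
  then have "corr_exp 0 I (\<lambda>x y. of_bool (good x \<and> F x \<in> - T)) \<le> 1 / 2"
    using False by (simp only: corr_exp_add corr_exp_const[OF finite_I])
  from cut_poincare_half[OF inv this l m stay]
  have "corr_exp 0 I (\<lambda>x y. both_good x y * \<bar>of_bool (F x \<in> - T) - of_bool (F y \<in> - T)\<bar>) \<le>
    160 * real l * corr_exp (noise_rate l) I (\<lambda>x y. both_good x y * \<bar>of_bool (F x \<in> - T) - of_bool (F y \<in> - T)\<bar>)" .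
  moreover have "\<bar>of_bool (F x \<in> - T) - of_bool (F y \<in> - T)\<bar> = \<bar>of_bool (F x \<in> T) - of_bool (F y \<in> T) :: real\<bar>" for x y
    by auto
  ultimately show ?thesis by simp
qed

lemma powr_poincare:
  fixes F :: "(nat \<times> nat \<Rightarrow> real) \<Rightarrow> real"
  assumes inv: "\<And>j x. x \<in> cube I \<Longrightarrow> F (sh j x) = F x"
    and l: "l \<ge> 1" and m: "60 * 9 ^ (l\<^sup>2) * l ^ 5 \<le> m"
    and stay: "\<And>x. good x \<Longrightarrow> noise_mean (noise_rate l) I x (\<lambda>y. of_bool (\<not> good y)) \<le> 1 / (160 * real l)"
    and p: "0 < p" "p < 1"
  shows "corr_exp 0 I (\<lambda>x y. both_good x y * \<bar>F x - F y\<bar> powr p) \<le>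
    160 * real l * corr_exp (noise_rate l) I (\<lambda>x y. both_good x y * \<bar>F x - F y\<bar> powr p)"
proof -
  define w where "w = (\<lambda>\<rho> x y. (\<Prod>i\<in>I. (1 + \<rho> * x i * y i) / 4 :: real))"
  \<comment> \<open>The inequality is read as nonnegativity of one signed combination of distances,
    the form required by \<open>powr_distance_of_cuts\<close>.\<close>
  define W where "W = (\<lambda>x y. (160 * real l * w (noise_rate l) x y - w 0 x y) * both_good x y)"
  have W: "(\<Sum>x\<in>cube I. \<Sum>y\<in>cube I. W x y * G x y) =
    160 * real l * corr_exp (noise_rate l) I (\<lambda>x y. both_good x y * G x y) - corr_exp 0 I (\<lambda>x y. both_good x y * G x y)" for G
  proof -
    have w: "corr_exp \<rho> I G' = (\<Sum>x\<in>cube I. \<Sum>y\<in>cube I. w \<rho> x y * G' x y)" for \<rho> G'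
      by (simp only: corr_exp_def w_def)
    show ?thesis unfolding w W_def by (simp add: algebra_simps sum_subtractf sum_distrib_left)
  qed
  have "0 \<le> (\<Sum>x\<in>cube I. \<Sum>y\<in>cube I. W x y * \<bar>F x - F y\<bar> powr p)"
    by (rule powr_distance_of_cuts[OF finite_cube[OF finite_I] p])
       (use cut_poincare[OF inv l m stay] in \<open>simp add: W\<close>)
  then show ?thesis by (simp add: W)
qed

lemma suminf_powr_poincare:
  fixes F :: "(nat \<times> nat \<Rightarrow> real) \<Rightarrow> nat \<Rightarrow> real"
  assumes inv: "\<And>j x. x \<in> cube I \<Longrightarrow> F (sh j x) = F x"
    and l: "l \<ge> 1" and m: "60 * 9 ^ (l\<^sup>2) * l ^ 5 \<le> m"
    and stay: "\<And>x. good x \<Longrightarrow> noise_mean (noise_rate l) I x (\<lambda>y. of_bool (\<not> good y)) \<le> 1 / (160 * real l)"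
    and p: "0 < p" "p < 1"
    and summable: "\<And>x y. good x \<Longrightarrow> good y \<Longrightarrow> summable (\<lambda>i. \<bar>F x i - F y i\<bar> powr p)"
  shows "corr_exp 0 I (\<lambda>x y. both_good x y * (\<Sum>i. \<bar>F x i - F y i\<bar> powr p)) \<le>
    160 * real l * corr_exp (noise_rate l) I (\<lambda>x y. both_good x y * (\<Sum>i. \<bar>F x i - F y i\<bar> powr p))"
proof -
  have S: "(\<lambda>i. corr_exp \<rho> I (\<lambda>x y. both_good x y * \<bar>F x i - F y i\<bar> powr p)) sums
      corr_exp \<rho> I (\<lambda>x y. both_good x y * (\<Sum>i. \<bar>F x i - F y i\<bar> powr p))" for \<rho>
    unfolding corr_exp_def
  proof (intro sums_sum, rule sums_mult)
    fix x y
    show "(\<lambda>i. both_good x y * \<bar>F x i - F y i\<bar> powr p) sums (both_good x y * (\<Sum>i. \<bar>F x i - F y i\<bar> powr p))"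
    proof (cases "good x \<and> good y")
      case True
      then show ?thesis using summable by (intro sums_mult summable_sums) auto
    next
      case False
      then have "both_good x y = 0" by (auto simp: both_good_def)
      then show ?thesis by simp
    qed
  qed
  show ?thesis
  proof (rule sums_le[OF _ S sums_mult[OF S]])
    show "corr_exp 0 I (\<lambda>x y. both_good x y * \<bar>F x i - F y i\<bar> powr p) \<le>
       160 * real l * corr_exp (noise_rate l) I (\<lambda>x y. both_good x y * \<bar>F x i - F y i\<bar> powr p)" for i
      by (rule powr_poincare[OF _ l m stay p]) (simp add: inv)
  qed
qed

lemma corr_exp_ham:
  fixes \<rho> :: real
  shows "corr_exp \<rho> I (\<lambda>x y. ham x y) = m * L * (1 - \<rho>) / 2"
proof -
  have N: "noise_mean \<rho> I x (\<lambda>y. ham x y) = m * L * (1 - \<rho>) / 2" if x: "x \<in> cube I" for x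
  proof -
    have "ham x y = m * L / 2 - 1 / 2 * (\<Sum>p\<in>I. x p * y p)" if "y \<in> cube I" for y
      using ip_ham[OF x that] unfolding ip_def by (simp add: diff_divide_distrib)
    then have "noise_mean \<rho> I x (\<lambda>y. ham x y) = noise_mean \<rho> I x (\<lambda>y. m * L / 2 - 1 / 2 * (\<Sum>p\<in>I. x p * y p))"
      unfolding noise_mean_def by (intro sum.cong refl) simp
    also have "\<dots> = m * L / 2 - 1 / 2 * (\<Sum>p\<in>I. x p * noise_mean \<rho> I x (\<lambda>y. y p))"
      by (simp only: noise_mean_diff noise_mean_cmult noise_mean_sum noise_mean_const[OF finite_I x])
    also have "(\<Sum>p\<in>I. x p * noise_mean \<rho> I x (\<lambda>y. y p)) = (\<Sum>p\<in>I. \<rho>)"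
    proof (intro sum.cong refl)
      fix p assume "p \<in> I"
      then show "x p * noise_mean \<rho> I x (\<lambda>y. y p) = \<rho>"
        using noise_mean_monomial[OF finite_I x, of "{p}" \<rho>] cube_sq[OF x] by (simp add: mult.left_commute)
    qed
    finally show ?thesis by (simp add: card_I algebra_simps)
  qed
  show ?thesis unfolding corr_exp_noise_mean by (simp add: N card_cube)
qed

text \<open>With K = m L, independent pairs are good and at distance at least K/4 with probability
  at least 1/2, while noisy pairs are within K/l^2 on average. The Poincare inequality compares the
  two p-th moments; the constant is 2560 = 2 * 160 * 2 * 4, with 4^p bounded by 4.\<close>

lemma powr_distortion:
  fixes F :: "(nat \<times> nat \<Rightarrow> real) \<Rightarrow> nat \<Rightarrow> real"
  assumes inv: "\<And>j x. x \<in> cube I \<Longrightarrow> F (sh j x) = F x"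
    and l: "l \<ge> 1" and m: "60 * 9 ^ (l\<^sup>2) * l ^ 5 \<le> m" and L: "L \<ge> 32"
    and stay: "\<And>x. good x \<Longrightarrow> noise_mean (noise_rate l) I x (\<lambda>y. of_bool (\<not> good y)) \<le> 1 / (160 * real l)"
    and most: "\<And>x. x \<in> cube I \<Longrightarrow> noise_mean 0 I x (\<lambda>y. of_bool (\<not> good y)) \<le> 1 / 8"
    and p: "0 < p" "p < 1" and \<alpha>: "\<alpha> \<ge> 0"
    and summable: "\<And>x y. good x \<Longrightarrow> good y \<Longrightarrow> summable (\<lambda>i. \<bar>F x i - F y i\<bar> powr p)"
    and lower: "\<And>x y. good x \<Longrightarrow> good y \<Longrightarrow> qd x y powr p \<le> (\<Sum>i. \<bar>F x i - F y i\<bar> powr p)"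
    and upper: "\<And>x y. good x \<Longrightarrow> good y \<Longrightarrow> (\<Sum>i. \<bar>F x i - F y i\<bar> powr p) \<le> (\<alpha> * qd x y) powr p"
  shows "l powr (2 * p - 1) / 2560 \<le> \<alpha> powr p"
proof -
  define K where "K = real (m * L)"
  have K: "K > 0" using L m_pos by (simp add: K_def)
  define S where "S = (\<lambda>x y. \<Sum>i. \<bar>F x i - F y i\<bar> powr p)"
  define \<rho> where "\<rho> = noise_rate l"
  have \<rho>: "\<bar>\<rho>\<bar> \<le> 1" using noise_rate[OF l] by (simp add: \<rho>_def)
  have good_mass: "corr_exp 0 I (\<lambda>x y. of_bool (\<not> good y)) \<le> 1 / 8"
  proof -
    have "(\<Sum>x\<in>cube I. noise_mean 0 I x (\<lambda>y. of_bool (\<not> good y))) \<le> (\<Sum>x\<in>cube I. 1 / 8)"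
      using most by (rule sum_mono)
    then show ?thesis unfolding corr_exp_noise_mean by (simp add: card_cube field_simps)
  qed
  have far_mass: "corr_exp 0 I (\<lambda>x y. of_bool (qd x y < m * L / 4)) \<le> 1 / 8"
  proof -
    have "(\<Sum>x\<in>cube I. noise_mean 0 I x (\<lambda>y. of_bool (qd x y < m * L / 4))) \<le> (\<Sum>x\<in>cube I. 1 / 8)"
    proof (rule sum_mono)
      fix x assume "x \<in> cube I"
      then have "noise_mean 0 I x (\<lambda>y. of_bool (qd x y < m * L / 4)) \<le> 4 / L"
        using L by (intro noise_mean_close) auto
      also have "\<dots> \<le> 1 / 8" using L by (simp add: field_simps)
      finally show "noise_mean 0 I x (\<lambda>y. of_bool (qd x y < m * L / 4)) \<le> 1 / 8" .
    qed
    then show ?thesis unfolding corr_exp_noise_mean by (simp add: card_cube field_simps)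
  qed
  have low: "(K / 4) powr p / 2 \<le> corr_exp 0 I (\<lambda>x y. both_good x y * S x y)"
  proof -
    \<comment> \<open>A union bound written as a function: G is positive only for good pairs at
      distance at least m L / 4, where it equals 1.\<close>
    define G :: "(nat \<times> nat \<Rightarrow> real) \<Rightarrow> _ \<Rightarrow> real"
      where "G = (\<lambda>x y. 1 - of_bool (\<not> good x) - of_bool (\<not> good y) - of_bool (qd x y < m * L / 4))"
    have "corr_exp 0 I G = 1 - corr_exp 0 I (\<lambda>x y. of_bool (\<not> good x)) - corr_exp 0 I (\<lambda>x y. of_bool (\<not> good y))
       - corr_exp 0 I (\<lambda>x y. of_bool (qd x y < m * L / 4))"
      by (simp only: G_def corr_exp_diff corr_exp_const[OF finite_I])
    also have "\<dots> \<ge> 1 / 2"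
    proof -
      have "corr_exp 0 I (\<lambda>x y. of_bool (\<not> good x)) = corr_exp 0 I (\<lambda>x y. of_bool (\<not> good y))"
        by (rule corr_exp_swap)
      then show ?thesis using good_mass far_mass by linarith
    qed
    finally have "(K / 4) powr p * (1 / 2) \<le> (K / 4) powr p * corr_exp 0 I G" by (intro mult_left_mono) auto
    also have "\<dots> \<le> corr_exp 0 I (\<lambda>x y. both_good x y * S x y)"
      unfolding corr_exp_cmult[symmetric]
    proof (rule corr_exp_mono)
      fix x y
      show "(K / 4) powr p * G x y \<le> both_good x y * S x y"
      proof (cases "good x \<and> good y")
        case True
        show ?thesis
        proof (cases "qd x y < m * L / 4")
          case True
          have "(K / 4) powr p * G x y \<le> 0" using True by (auto simp: G_def mult_le_0_iff)
          moreover have "0 \<le> both_good x y * S x y"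
            using order_trans[OF powr_ge_zero lower[of x y]] \<open>good x \<and> good y\<close> by (simp add: both_good_def S_def)
          ultimately show ?thesis by linarith
        next
          case False
          then have "(K / 4) powr p \<le> qd x y powr p" using K p by (intro powr_mono2) (auto simp: K_def)
          also have "\<dots> \<le> S x y" using lower \<open>good x \<and> good y\<close> by (simp add: S_def)
          finally show ?thesis using \<open>good x \<and> good y\<close> False by (simp add: both_good_def G_def)
        qed
      next
        case False
        then have "G x y \<le> 0" by (auto simp: G_def)
        then have "(K / 4) powr p * G x y \<le> 0" by (simp add: mult_le_0_iff)
        moreover have "both_good x y = 0" using False by (auto simp: both_good_def)
        ultimately show ?thesis by simp
      qed
    qed simp
    finally show ?thesis by simp
  qed
  have high: "corr_exp \<rho> I (\<lambda>x y. both_good x y * S x y) \<le> 2 * \<alpha> powr p * (K / l\<^sup>2) powr p"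
  proof -
    define a where "a = K / (real l)\<^sup>2"
    have a: "a > 0" using K l by (simp add: a_def)
    have "corr_exp \<rho> I (\<lambda>x y. both_good x y * S x y) \<le> corr_exp \<rho> I (\<lambda>x y. \<alpha> powr p * (a powr p + a powr (p - 1) * ham x y))"
    proof (rule corr_exp_mono[OF _ \<rho>])
      fix x y assume xy: "x \<in> cube I" "y \<in> cube I"
      have h0: "0 \<le> ham x y" by (rule ham_nonneg)
      \<comment> \<open>An affine bound at scale a = K/l^2 takes the place of Jensen's inequality
        for the p-th power, at the cost of a factor 2.\<close>
      have tang: "ham x y powr p \<le> a powr p + a powr (p - 1) * ham x y"
      proof (cases "ham x y \<le> a")
        case True
        then have "ham x y powr p \<le> a powr p" using h0 p by (intro powr_mono2) auto
        moreover have "0 \<le> a powr (p - 1) * ham x y" using h0 by simp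
        ultimately show ?thesis by linarith
      next
        case False
        then have "ham x y powr (p - 1) \<le> a powr (p - 1)" using a p by (intro powr_mono2') auto
        then have "ham x y powr (p - 1) * ham x y \<le> a powr (p - 1) * ham x y" using h0 by (rule mult_right_mono)
        moreover have "ham x y powr p = ham x y powr (p - 1) * ham x y" using False a by (simp add: powr_diff)
        moreover have "0 \<le> a powr p" by simp
        ultimately show ?thesis by linarith
      qed
      show "both_good x y * S x y \<le> \<alpha> powr p * (a powr p + a powr (p - 1) * ham x y)"
      proof (cases "good x \<and> good y")
        case True
        have "S x y \<le> (\<alpha> * qd x y) powr p" using upper True by (simp add: S_def)
        also have "\<dots> = \<alpha> powr p * qd x y powr p" using \<alpha> qd_nonneg by (simp add: powr_mult)
        also have "\<dots> \<le> \<alpha> powr p * (a powr p + a powr (p - 1) * ham x y)"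
        proof (intro mult_left_mono)
          have "qd x y \<le> ham x y" using qd_le[of x y 0] by (simp add: sh_0 xy)
          then have "qd x y powr p \<le> ham x y powr p" using p qd_nonneg by (intro powr_mono2) auto
          then show "qd x y powr p \<le> a powr p + a powr (p - 1) * ham x y" using tang by simp
        qed simp
        finally show ?thesis using True by (simp add: both_good_def)
      next
        case False
        then have "both_good x y = 0" by (auto simp: both_good_def)
        then show ?thesis using h0 by simp
      qed
    qed
    also have "\<dots> = \<alpha> powr p * (a powr p + a powr (p - 1) * (K * (1 - \<rho>) / 2))"
      by (simp add: corr_exp_cmult corr_exp_add corr_exp_const corr_exp_ham K_def)
    also have "\<dots> \<le> \<alpha> powr p * (a powr p + a powr (p - 1) * a)"
    proof (intro mult_left_mono add_left_mono)
      have "K * (1 - \<rho>) / 2 \<le> K * (2 / (real l)\<^sup>2) / 2"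
        using noise_rate(4)[OF l] K by (intro divide_right_mono mult_left_mono) (auto simp: \<rho>_def)
      then show "K * (1 - \<rho>) / 2 \<le> a" by (simp add: a_def)
    qed auto
    also have "a powr (p - 1) * a = a powr p" using a by (simp add: powr_diff)
    finally show ?thesis by (simp add: a_def)
  qed
  have "(K / 4) powr p / 2 \<le> 160 * real l * corr_exp \<rho> I (\<lambda>x y. both_good x y * S x y)"
    using low suminf_powr_poincare[of F, OF inv l m stay p summable] by (simp add: S_def \<rho>_def)
  also have "\<dots> \<le> 160 * real l * (2 * \<alpha> powr p * (K / l\<^sup>2) powr p)"
    using high by (intro mult_left_mono) auto
  finally have main: "(K / 4) powr p / 2 \<le> 160 * real l * (2 * \<alpha> powr p * (K / l\<^sup>2) powr p)" .
  have l0: "real l > 0" using l by simp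
  have e1: "(K / 4) powr p = K powr p / 4 powr p" using K by (simp add: powr_divide)
  have e2: "(K / l\<^sup>2) powr p = K powr p / l powr (2 * p)"
    using K l0 by (simp add: powr_divide powr_powr flip: powr_numeral)
  have "K powr p * (1 / 4 powr p / 2) \<le> K powr p * (320 * real l * \<alpha> powr p / l powr (2 * p))"
    using main unfolding e1 e2 by (simp add: mult_ac)
  then have "1 / 4 powr p / 2 \<le> 320 * real l * \<alpha> powr p / l powr (2 * p)"
    by (rule mult_left_le_imp_le) (use K in simp)
  then have 1: "l powr (2 * p) \<le> 640 * 4 powr p * real l * \<alpha> powr p"
    using l0 by (simp add: field_simps)
  have "4 powr p \<le> (4::real) powr 1" using p by (intro powr_mono) auto
  then have "640 * 4 powr p * real l * \<alpha> powr p \<le> 640 * 4 * real l * \<alpha> powr p"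
    by (intro mult_right_mono mult_left_mono) auto
  with 1 have "l powr (2 * p) \<le> 2560 * real l * \<alpha> powr p" by linarith
  moreover have "l powr (2 * p) = l powr (2 * p - 1) * l" using l0 by (simp add: powr_diff)
  ultimately have "l powr (2 * p - 1) * l \<le> (2560 * \<alpha> powr p) * l" by (simp add: mult_ac)
  then show ?thesis using l0 by simp
qed

end

section \<open>The quotient space and its distortion\<close>

context shift_cube
begin

text \<open>Each orbit of good points is replaced by the number of a chosen representative, so that
  the metric space lives on an initial segment of the naturals. The two size bounds hold because
  orbits have at most m points and representatives are cube points.\<close>

lemma quotient_space:
  assumes "good x0"
  obtains n :: nat and b :: "nat \<Rightarrow> nat \<times> nat \<Rightarrow> real" and idx :: "(nat \<times> nat \<Rightarrow> real) \<Rightarrow> nat"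
  where "\<And>i. good (b i)" "Metric_space {..<n} (\<lambda>i j. qd (b i) (b j))"
    "\<And>x. good x \<Longrightarrow> idx x < n" "\<And>j x. x \<in> cube I \<Longrightarrow> idx (sh j x) = idx x"
    "\<And>x y. good x \<Longrightarrow> good y \<Longrightarrow> qd (b (idx x)) (b (idx y)) = qd x y"
    "card {x. good x} \<le> n * m" "n \<le> 2 ^ (m * L)"
proof -
  define orb where "orb = (\<lambda>x. (\<lambda>j. sh j x) ` {..<m})"
  \<comment> \<open>The choice depends on the orbit only as a set, which is the same for all of its
    points; this makes the representative shift-invariant.\<close>
  define rp where "rp = (\<lambda>x. SOME y. y \<in> orb x)"
  have orb_iff: "y \<in> orb x \<longleftrightarrow> (\<exists>j. y = sh j x)" for x y
  proof
    assume "\<exists>j. y = sh j x"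
    then obtain j where "y = sh (j mod m) x" by (auto simp: sh_mod)
    then show "y \<in> orb x" unfolding orb_def using m_pos by auto
  qed (auto simp: orb_def)
  have orb_sh: "orb (sh k x) = orb x" if "x \<in> cube I" for k x
  proof (rule set_eqI)
    fix y
    have "sh j x = sh (j + (m - k mod m)) (sh k x)" for j
      by (simp only: sh_sh[symmetric, of j] sh_inverse(1)[OF that])
    then show "y \<in> orb (sh k x) \<longleftrightarrow> y \<in> orb x" unfolding orb_iff by (metis sh_sh)
  qed
  have rp: "\<exists>j. rp x = sh j x" for x
  proof -
    have "\<exists>y. y \<in> orb x" by (auto simp: orb_iff)
    then have "rp x \<in> orb x" unfolding rp_def by (rule someI_ex)
    then show ?thesis by (simp add: orb_iff)
  qed
  have rp_sh: "rp (sh k x) = rp x" if "x \<in> cube I" for k x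
    unfolding rp_def orb_sh[OF that] ..
  have good_fin: "finite {x. good x}"
    by (rule finite_subset[OF _ finite_cube[OF finite_I]]) (auto simp: good_cube)
  define R where "R = rp ` {x. good x}"
  have R: "finite R" using good_fin by (simp add: R_def)
  have good_R: "good r" if r: "r \<in> R" for r 
  proof -
    obtain x where x: "good x" "r = rp x" using r by (auto simp: R_def)
    then show ?thesis using rp[of x] good_sh by auto
  qed
  have rp_R: "rp r = r" if r: "r \<in> R" for r
  proof -
    obtain x where x: "good x" "r = rp x" using r by (auto simp: R_def)
    obtain j where "r = sh j x" using rp x by blast
    then show ?thesis using rp_sh[OF good_cube[OF x(1)], of j] x by simp
  qed
  define n where "n = card R"
  obtain h where h: "bij_betw h R {0..<n}" unfolding n_def using ex_bij_betw_finite_nat[OF R] by blast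
  define g where "g = inv_into R h"
  have g: "bij_betw g {0..<n} R" unfolding g_def by (rule bij_betw_inv_into[OF h])
  have gh: "g (h r) = r" if "r \<in> R" for r
    unfolding g_def using that h by (simp add: bij_betw_inv_into_left)
  have "rp x0 \<in> R" using assms by (simp add: R_def)
  then have n0: "n > 0" using R by (auto simp: n_def card_gt_0_iff)
  \<comment> \<open>Indices beyond n are sent to the point with index 0, so that \<open>b i\<close>
    is good for every i.\<close>
  define b where "b = (\<lambda>i. g (if i < n then i else 0))"
  define idx where "idx = (\<lambda>x. h (rp x))"
  have b_R: "b i \<in> R" for i
    unfolding b_def using bij_betwE[OF g] n0 by auto
  have qd_R: "qd r s = 0 \<longleftrightarrow> r = s" if rs: "r \<in> R" "s \<in> R" for r s
  proof
    assume q: "qd r s = 0"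
    obtain j where "qd r s = ham r (sh j s)" using qd_attained by blast
    then have "r = sh j s" using q rs good_R good_cube sh_cube by (intro ham_eq_0) auto
    then have "rp r = rp s" using rp_sh[of s j] rs good_R good_cube by simp
    then show "r = s" using rp_R rs by simp
  next
    assume "r = s"
    then have "qd r s \<le> 0" using qd_le[of r s 0] rs good_R good_cube by (simp add: sh_0)
    then show "qd r s = 0" using qd_nonneg[of r s] by simp
  qed
  show ?thesis
  proof (rule that[of b n idx])
    show "good (b i)" for i using good_R b_R by blast
    show "Metric_space {..<n} (\<lambda>i j. qd (b i) (b j))"
    proof
      fix i j k
      show "0 \<le> qd (b i) (b j)" by (rule qd_nonneg)
      show "qd (b i) (b j) = qd (b j) (b i)" using b_R good_R good_cube by (intro qd_commute) auto
      show "qd (b i) (b k) \<le> qd (b i) (b j) + qd (b j) (b k)" by (rule qd_triangle)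
    next
      fix i j assume ij: "i \<in> {..<n}" "j \<in> {..<n}"
      then have "b i = b j \<longleftrightarrow> i = j"
        using bij_betw_imp_inj_on[OF g] by (auto simp: b_def inj_on_def)
      then show "qd (b i) (b j) = 0 \<longleftrightarrow> i = j" using qd_R b_R by simp
    qed
    fix x assume x: "good x"
    then have rpx: "rp x \<in> R" by (simp add: R_def)
    show idx_n: "idx x < n" using bij_betwE[OF h] rpx by (auto simp: idx_def)
  next
    show "idx (sh j x) = idx x" if "x \<in> cube I" for j x using rp_sh[OF that] by (simp add: idx_def)
  next
    fix x y assume xy: "good x" "good y"
    have b_idx: "b (idx z) = rp z" if "good z" for z
    proof -
      have "rp z \<in> R" using that by (simp add: R_def)
      then have "idx z < n" "g (idx z) = rp z" using bij_betwE[OF h] gh by (auto simp: idx_def)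
      then show ?thesis by (simp add: b_def)
    qed
    obtain j k where jk: "rp x = sh j x" "rp y = sh k y" using rp by blast
    have c: "x \<in> cube I" "y \<in> cube I" using xy good_cube by auto
    have "qd (sh j x) (sh k y) = qd (sh j x) y" using c sh_cube by (intro qd_sh_right)
    also have "\<dots> = qd y (sh j x)" using c sh_cube by (intro qd_commute)
    also have "\<dots> = qd y x" using c by (intro qd_sh_right)
    also have "\<dots> = qd x y" using c by (intro qd_commute)
    finally show "qd (b (idx x)) (b (idx y)) = qd x y" using b_idx xy jk by simp
  next
    have "{x. good x} \<subseteq> (\<Union>r\<in>R. orb r)"
    proof
      fix x assume "x \<in> {x. good x}"
      then have x: "good x" by simp
      obtain j where j: "rp x = sh j x" using rp by blast
      have "x = sh (m - j mod m) (rp x)" using j sh_inverse(1)[OF good_cube[OF x], of j] by simp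
      then have "x \<in> orb (rp x)" unfolding orb_iff by blast
      then show "x \<in> (\<Union>r\<in>R. orb r)" using x by (auto simp: R_def)
    qed
    then have "card {x. good x} \<le> card (\<Union>r\<in>R. orb r)"
      using R by (intro card_mono) (auto simp: orb_def)
    also have "\<dots> \<le> (\<Sum>r\<in>R. card (orb r))" by (rule card_UN_le[OF R])
    also have "\<dots> \<le> (\<Sum>r\<in>R. m)"
      unfolding orb_def using card_image_le[of "{..<m}"] by (intro sum_mono) simp
    finally show "card {x. good x} \<le> n * m" by (simp add: n_def)
    have "n \<le> card (cube I)"
      unfolding n_def using good_R good_cube finite_cube by (intro card_mono) auto
    then show "n \<le> 2 ^ (m * L)" by (simp add: card_cube card_I)
  qed
qed

end

lemma ell_qnorm_powr:
  assumes "0 < p" "summable (\<lambda>i. \<bar>\<phi> i\<bar> powr p)"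
  shows "ell_qnorm p \<phi> powr p = (\<Sum>i. \<bar>\<phi> i\<bar> powr p)"
proof -
  have "0 \<le> (\<Sum>i. \<bar>\<phi> i\<bar> powr p)" using assms by (intro suminf_nonneg) auto
  then show ?thesis using assms by (simp add: ell_qnorm_def powr_powr)
qed

text \<open>The base must be at least 60 * 9 * 32 = 17280, as l^5 is at most 32^(l^2). The choice
  65536 = 2^16 also makes the logarithm of m explicit.\<close>

lemma distortion_parameters:
  fixes l :: nat
  assumes l: "l \<ge> 1"
  defines "m \<equiv> 65536 ^ (l\<^sup>2) :: nat"
  shows "60 * 9 ^ (l\<^sup>2) * l ^ 5 \<le> m" "l ^ 5 \<le> m" "65536 \<le> m" "l \<le> m"
proof -
  have l2: "l \<le> l\<^sup>2" using l by (simp add: power2_eq_square)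
  have 1: "(1::nat) \<le> l\<^sup>2" using l by simp
  have "l ^ 5 \<le> (2 ^ l) ^ 5" by (intro power_mono) (simp_all add: less_imp_le)
  also have "\<dots> = (2 ^ 5) ^ l" by (simp only: power_mult[symmetric] mult.commute)
  also have "\<dots> = 32 ^ l" by simp
  also have "\<dots> \<le> 32 ^ (l\<^sup>2)" using l2 by (intro power_increasing) auto
  finally have l5: "l ^ 5 \<le> 32 ^ (l\<^sup>2)" .
  have "(60::nat) ^ 1 \<le> 60 ^ (l\<^sup>2)" using 1 by (intro power_increasing) auto
  then have "60 * 9 ^ (l\<^sup>2) * l ^ 5 \<le> 60 ^ (l\<^sup>2) * 9 ^ (l\<^sup>2) * 32 ^ (l\<^sup>2)"
    using l5 by (intro mult_mono) auto
  also have "\<dots> = 17280 ^ (l\<^sup>2)" by (simp flip: power_mult_distrib)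
  also have "\<dots> \<le> m" unfolding m_def by (intro power_mono) auto
  finally show "60 * 9 ^ (l\<^sup>2) * l ^ 5 \<le> m" .
  have "(32::nat) ^ (l\<^sup>2) \<le> m" unfolding m_def by (intro power_mono) auto
  then show l5m: "l ^ 5 \<le> m" using l5 by linarith
  have "(65536::nat) ^ 1 \<le> m" unfolding m_def using 1 by (intro power_increasing) auto
  then show "65536 \<le> m" by simp
  have "l ^ 1 \<le> l ^ 5" using l by (intro power_increasing) auto
  then show "l \<le> m" using l5m by simp
qed

text \<open>Since (1 - \<open>\<rho>\<close>^2)^2 is at least 9/(16 l^4), the first bound reduces to
  a constant times m^2 l^5 against m^10; one factor m^2 covers the constant and one factor m covers
  l^5.\<close>

lemma noise_error_bounds:
  fixes l m :: nat and \<rho> :: real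
  assumes l: "l \<ge> 1" and m: "65536 \<le> m" "l ^ 5 \<le> m"
    and \<rho>: "0 \<le> \<rho>" "3 / (4 * (real l)\<^sup>2) \<le> 1 - \<rho>"
  shows "6 * 10 ^ 6 * (real m)\<^sup>2 / (real (m ^ 10) * (1 - \<rho>\<^sup>2)\<^sup>2) \<le> 1 / (160 * real l)"
    and "6 * 10 ^ 6 * (real m)\<^sup>2 / real (m ^ 10) \<le> 1 / 8"
proof -
  have m0: "real m \<ge> 65536" using m by simp
  have l0: "real l \<ge> 1" using l by simp
  have r1: "\<rho> \<le> 1"
  proof -
    have "0 \<le> 3 / (4 * (real l)\<^sup>2)" by simp
    then show ?thesis using \<rho>(2) by linarith
  qed
  have "\<rho>\<^sup>2 \<le> \<rho>" using \<rho>(1) r1 by (simp add: power2_eq_square mult_left_le_one_le)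
  then have "3 / (4 * (real l)\<^sup>2) \<le> 1 - \<rho>\<^sup>2" using \<rho> by linarith
  then have "(3 / (4 * (real l)\<^sup>2))\<^sup>2 \<le> (1 - \<rho>\<^sup>2)\<^sup>2" by (intro power_mono) auto
  then have d: "9 / (16 * real l ^ 4) \<le> (1 - \<rho>\<^sup>2)\<^sup>2"
    by (simp add: power_divide power_mult_distrib flip: power_mult)
  have big: "6 * 10 ^ 6 * 160 * 2 * (real m)\<^sup>2 * real l ^ 5 \<le> real m ^ 10"
  proof -
    have "65536 ^ 2 \<le> real m ^ 2" using m0 by (intro power_mono) auto
    then have c: "6 * 10 ^ 6 * 160 * 2 \<le> real m ^ 2" by simp
    have l5: "real l ^ 5 \<le> real m" using m(2) by (simp flip: of_nat_power)
    have "6 * 10 ^ 6 * 160 * 2 * (real m)\<^sup>2 * real l ^ 5 \<le> real m ^ 2 * real m ^ 2 * real m"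
      using c l5 m0 by (intro mult_mono) auto
    also have "\<dots> = real m ^ 5" by (simp add: eval_nat_numeral)
    also have "\<dots> \<le> real m ^ 10" using m0 by (intro power_increasing) auto
    finally show ?thesis .
  qed
  have "6 * 10 ^ 6 * (real m)\<^sup>2 / (real (m ^ 10) * (1 - \<rho>\<^sup>2)\<^sup>2) \<le> 6 * 10 ^ 6 * (real m)\<^sup>2 / (real (m ^ 10) * (9 / (16 * real l ^ 4)))"
    using d m0 l0 by (intro divide_left_mono mult_left_mono mult_pos_pos) (auto intro: less_le_trans[OF _ d])
  also have "\<dots> \<le> 1 / (160 * real l)"
  proof -
    have gen: "a / b \<le> 1 / c" if "a * c \<le> b" "b > 0" "c > 0" for a b c :: real
      using that by (simp add: field_simps)
    show ?thesis
    proof (rule gen)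
      have "16 * real l ^ 4 * (6 * 10 ^ 6 * (real m)\<^sup>2 * (160 * real l)) = 8 * (6 * 10 ^ 6 * 160 * 2 * (real m)\<^sup>2 * real l ^ 5)"
        by (simp add: eval_nat_numeral)
      also have "\<dots> \<le> 9 * real m ^ 10"
        using big zero_le_power[of "real m" 10] m0 by linarith
      finally show "6 * 10 ^ 6 * (real m)\<^sup>2 * (160 * real l) \<le> real (m ^ 10) * (9 / (16 * real l ^ 4))"
        using l0 by (simp add: pos_le_divide_eq mult.commute)
    qed (use m0 l0 in auto)
  qed
  finally show "6 * 10 ^ 6 * (real m)\<^sup>2 / (real (m ^ 10) * (1 - \<rho>\<^sup>2)\<^sup>2) \<le> 1 / (160 * real l)" .
  have "(real m)\<^sup>2 * 1 \<le> (real m)\<^sup>2 * real l ^ 5" using l0 by (intro mult_left_mono) auto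
  moreover have "1920000000 * ((real m)\<^sup>2 * real l ^ 5) \<le> real m ^ 10" using big by simp
  moreover have "0 \<le> (real m)\<^sup>2" by simp
  ultimately have "48000000 * (real m)\<^sup>2 \<le> real m ^ 10" by linarith
  then show "6 * 10 ^ 6 * (real m)\<^sup>2 / real (m ^ 10) \<le> 1 / 8" using m0 by (simp add: field_simps)
qed

text \<open>The logarithm of n is at most m^11, and that of m is at most 16 l^2, whence 176 = 11 *
  16. From n at least 16 the iterated logarithm is nonnegative.\<close>

lemma ln_ln_card_le:
  fixes n l :: nat
  defines "m \<equiv> 65536 ^ (l\<^sup>2) :: nat"
  assumes l: "l \<ge> 1" and n: "16 \<le> n" "n \<le> 2 ^ (m * m ^ 10)"
  shows "0 \<le> ln (ln (real n))" "ln (ln (real n)) \<le> 176 * (real l)\<^sup>2"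
proof -
  have m0: "real m > 0" by (simp add: m_def)
  have "1 \<le> ln (16 :: real)"
  proof -
    have "exp (1 :: real) \<le> 16" using exp_le by linarith
    then show ?thesis by (subst ln_ge_iff) auto
  qed
  also have "\<dots> \<le> ln (real n)" using n by (subst ln_le_cancel_iff) auto
  finally have 1: "1 \<le> ln (real n)" .
  then show "0 \<le> ln (ln (real n))" by simp
  have ln2: "ln (2 :: real) \<le> 1" using ln_le_minus_one[of 2] by simp
  have "real n \<le> 2 ^ (m * m ^ 10)" using n(2) by (metis of_nat_le_iff of_nat_numeral of_nat_power)
  then have "ln (real n) \<le> ln (2 ^ (m * m ^ 10) :: real)" using n by (subst ln_le_cancel_iff) auto
  also have "\<dots> = real (m * m ^ 10) * ln 2" by (simp add: ln_realpow)
  also have "\<dots> \<le> real (m * m ^ 10) * 1" using ln2 by (intro mult_left_mono) auto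
  also have "\<dots> = real m ^ 11" by (simp add: eval_nat_numeral)
  finally have "ln (ln (real n)) \<le> ln (real m ^ 11)" using 1 m0 by (subst ln_le_cancel_iff) auto
  also have "\<dots> = 11 * ln (real m)" using m0 by (simp add: ln_realpow)
  also have "ln (real m) = 16 * (real l)\<^sup>2 * ln 2"
  proof -
    have "real m = 2 ^ (16 * l\<^sup>2)" by (simp add: m_def power_mult)
    then show ?thesis by (simp add: ln_realpow)
  qed
  also have "11 * (16 * (real l)\<^sup>2 * ln 2) \<le> 11 * (16 * (real l)\<^sup>2 * 1)"
    using ln2 by (intro mult_left_mono) auto
  finally show "ln (ln (real n)) \<le> 176 * (real l)\<^sup>2" by simp
qed

theorem theorem1p2:
  "\<exists>(s :: nat) (D :: real) (c :: real). D \<ge> 1 \<and> c > 0 \<and>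
     (\<forall>N :: nat. \<exists>n\<ge>N. \<exists>(M :: nat set) (d :: nat \<Rightarrow> nat \<Rightarrow> real).
        finite M \<and> card M = n \<and> Metric_space M d \<and>
        sketchable s D M d \<and>
        (\<forall>\<epsilon> :: real. \<forall>\<alpha> :: real. 0 < \<epsilon> \<and> \<epsilon> < 1 / 2 \<and> \<alpha> \<ge> 1 \<and>
           (\<exists>f :: nat \<Rightarrow> nat \<Rightarrow> real. f \<in> M \<rightarrow> ell (1 - \<epsilon>) \<and>
              (\<forall>x\<in>M. \<forall>y\<in>M. d x y \<le> ell_qnorm (1 - \<epsilon>) (f x - f y) \<and>
                                ell_qnorm (1 - \<epsilon>) (f x - f y) \<le> \<alpha> * d x y))
           \<longrightarrow> \<alpha> \<ge> c * ln (ln (real n)) powr ((1 - 2 * \<epsilon>) / (2 * (1 - \<epsilon>)))))"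
proof (rule exI[of _ "4::nat"], rule exI[of _ "20000000::real"], rule exI[of _ "1 / (14 * 2560\<^sup>2) :: real"],
    intro conjI allI)
  \<comment> \<open>In the constant c, 14 bounds 176^e for e at most 1/2, and 2560^2 bounds
    2560^(1/p) for p above 1/2. Arbitrarily large n come from the chain N, l, m, n, which is
    nondecreasing.\<close>
  fix N :: nat
  define l where "l = N + 4"
  define m where "m = (65536 ^ (l\<^sup>2) :: nat)"
  define L where "L = m ^ 10"
  have l: "l \<ge> 1" by (simp add: l_def)
  note par = distortion_parameters[OF l, folded m_def]
  interpret shift_cube m L using par(3) by unfold_locales simp
  have L32: "L \<ge> 32"
  proof -
    have "m ^ 1 \<le> m ^ 10" using par(3) by (intro power_increasing) auto
    then show ?thesis using par(3) by (simp add: L_def)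
  qed
  note err = noise_error_bounds[OF l par(3,2) noise_rate(1,3)[OF l], folded L_def]
  have stay: "noise_mean (noise_rate l) I x (\<lambda>y. of_bool (\<not> good y)) \<le> 1 / (160 * real l)" if "good x" for x
    using noise_mean_not_good[OF good_cube[OF that] noise_rate(1,2)[OF l], of] that L32 err(1) by simp
  have most: "noise_mean 0 I x (\<lambda>y. of_bool (\<not> good y)) \<le> 1 / 8" if "x \<in> cube I" for x
  proof -
    have "noise_mean 0 I x (\<lambda>y. of_bool (\<not> good y)) \<le> 6 * 10 ^ 6 * (real m)\<^sup>2 / L"
      using noise_mean_not_good[OF that, of 0] L32 by simp
    then show ?thesis using err(2) by (rule order_trans)
  qed
  have card_good: "2 ^ (m * L) \<le> 2 * card {x. good x}"
  proof -
    obtain x where x: "x \<in> cube I" using card_cube[OF finite_I] by fastforce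
    have "noise_mean 0 I x (\<lambda>y. of_bool (\<not> good y)) = card {y \<in> cube I. \<not> good y} / 2 ^ (m * L)"
      unfolding noise_mean_def
      by (simp add: card_I power_divide finite_cube of_bool_def sum.If_cases Int_def field_simps flip: sum_divide_distrib)
    then have "real (card {y \<in> cube I. \<not> good y}) = 2 ^ (m * L) * noise_mean 0 I x (\<lambda>y. of_bool (\<not> good y))"
      by simp
    also have "\<dots> \<le> 2 ^ (m * L) * (1 / 8)" using most[OF x] by (rule mult_left_mono) simp
    finally have "real (card {y \<in> cube I. \<not> good y}) \<le> 2 ^ (m * L) / 8" by simp
    moreover have "real (card (cube I)) = real (card {y \<in> cube I. \<not> good y} + card {x. good x})"
    proof -
      have "cube I = {y \<in> cube I. \<not> good y} \<union> {x. good x}" using good_cube by auto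
      then show ?thesis
        by (subst card_Un_disjoint[symmetric]) (auto intro: finite_subset[OF _ finite_cube[OF finite_I]] good_cube)
    qed
    ultimately have "(2::real) ^ (m * L) \<le> 2 * card {x. good x}"
      unfolding card_cube[OF finite_I] card_I of_nat_add of_nat_power by simp
    then show ?thesis by (simp flip: of_nat_le_iff[where 'a = real])
  qed
  then have "card {x. good x} > 0" by (metis card_gt_0_iff mult_is_0 not_gr_zero power_not_zero zero_neq_numeral le_zero_eq)
  then obtain x0 where x0: "good x0" by (metis Collect_empty_eq card.empty less_irrefl)
  obtain n :: nat and b idx where b: "\<And>i. good (b i)" and met: "Metric_space {..<n} (\<lambda>i j. qd (b i) (b j))"
    and idx: "\<And>x. good x \<Longrightarrow> idx x < n" and idx_sh: "\<And>j x. x \<in> cube I \<Longrightarrow> idx (sh j x) = idx x"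
    and qd_idx: "\<And>x y. good x \<Longrightarrow> good y \<Longrightarrow> qd (b (idx x)) (b (idx y)) = qd x y"
    and n: "card {x. good x} \<le> n * m" "n \<le> 2 ^ (m * L)"
    by (rule quotient_space[OF x0]) (rule that; assumption)
  \<comment> \<open>The n orbits have at most m points each and cover at least half of the cube, so
    2^(m L) is at most 2 n m.\<close>
  have mn: "m \<le> n"
  proof -
    have "m * 3 \<le> m * L" using L32 by (intro mult_left_mono) auto
    then have "(2::nat) ^ (m * 3) \<le> 2 ^ (m * L)" by (intro power_increasing) auto
    also have "\<dots> \<le> 2 * (n * m)" using card_good n(1) by linarith
    finally have "2 ^ (m * 3) \<le> 2 * (n * m)" .
    moreover have "2 * (m * m) \<le> 2 ^ (m * 3)"
    proof -
      have m2: "m \<le> 2 ^ m" by (simp add: less_imp_le)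
      then have "2 * (m * m) \<le> 2 ^ m * (2 ^ m * 2 ^ m)"
        using par(3) by (intro mult_mono) (auto intro: order_trans[of _ m])
      moreover have "m * 3 = m + (m + m)" by simp
      ultimately show ?thesis by (simp only: power_add)
    qed
    ultimately have "m * m \<le> n * m" by linarith
    then show ?thesis using par(3) by simp
  qed
  define d where "d = (\<lambda>i j. qd (b i) (b j))"
  have dist: "1 / (14 * 2560\<^sup>2) * ln (ln (real n)) powr ((1 - 2 * \<epsilon>) / (2 * (1 - \<epsilon>))) \<le> \<alpha>"
    if \<epsilon>: "0 < \<epsilon>" "\<epsilon> < 1 / 2" and \<alpha>: "\<alpha> \<ge> 1" and f: "f \<in> {..<n} \<rightarrow> ell (1 - \<epsilon>)"
      and bounds: "\<And>x y. x \<in> {..<n} \<Longrightarrow> y \<in> {..<n} \<Longrightarrow> d x y \<le> ell_qnorm (1 - \<epsilon>) (f x - f y)"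
        "\<And>x y. x \<in> {..<n} \<Longrightarrow> y \<in> {..<n} \<Longrightarrow> ell_qnorm (1 - \<epsilon>) (f x - f y) \<le> \<alpha> * d x y"
    for \<epsilon> \<alpha> f
  proof -
    define p where "p = 1 - \<epsilon>"
    have p: "0 < p" "p < 1" "1 / 2 < p" using \<epsilon> by (auto simp: p_def)
    define F where "F = (\<lambda>x. f (idx x))"
    have summ: "summable (\<lambda>i. \<bar>F x i - F y i\<bar> powr p)" if xy: "good x" "good y" for x y
    proof (rule summable_comparison_test')
      have "F x \<in> ell p" "F y \<in> ell p" using f idx xy by (auto simp: F_def p_def)
      then show "summable (\<lambda>i. \<bar>F x i\<bar> powr p + \<bar>F y i\<bar> powr p)" by (intro summable_add) (auto simp: ell_def)
      show "norm (\<bar>F x i - F y i\<bar> powr p) \<le> \<bar>F x i\<bar> powr p + \<bar>F y i\<bar> powr p" if "i \<ge> 0" for i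
        using powr_abs_diff_le[OF p(1,2)] by simp
    qed
    have norm_eq: "ell_qnorm p (F x - F y) powr p = (\<Sum>i. \<bar>F x i - F y i\<bar> powr p)" if "good x" "good y" for x y
      using ell_qnorm_powr[OF p(1), of "F x - F y"] summ[OF that] by (simp add: fun_diff_def)
    have "l powr (2 * p - 1) / 2560 \<le> \<alpha> powr p"
    proof (rule powr_distortion[where F = F])
      show "F (sh j x) = F x" if "x \<in> cube I" for j x using idx_sh[OF that] by (simp add: F_def)
      fix x y assume xy: "good x" "good y"
      have dxy: "d (idx x) (idx y) = qd x y" using qd_idx xy by (simp add: d_def)
      have "qd x y \<le> ell_qnorm p (F x - F y)" "ell_qnorm p (F x - F y) \<le> \<alpha> * qd x y"
        using bounds[of "idx x" "idx y"] idx xy by (auto simp: dxy F_def p_def)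
      then show "qd x y powr p \<le> (\<Sum>i. \<bar>F x i - F y i\<bar> powr p)" "(\<Sum>i. \<bar>F x i - F y i\<bar> powr p) \<le> (\<alpha> * qd x y) powr p"
        unfolding norm_eq[OF xy, symmetric] using p qd_nonneg[of x y] by (auto intro!: powr_mono2)
    qed (use l par L32 stay most p \<alpha> summ in auto)
    \<comment> \<open>Taking p-th roots produces the exponent (2 p - 1)/p = 2 e, so that l^(2 e) can
      be compared with the e-th power of log log n.\<close>
    then have "(l powr (2 * p - 1) / 2560) powr (1 / p) \<le> (\<alpha> powr p) powr (1 / p)"
      using p by (intro powr_mono2) auto
    also have "\<dots> = \<alpha>" using p \<alpha> by (simp add: powr_powr)
    finally have low: "(l powr (2 * p - 1) / 2560) powr (1 / p) \<le> \<alpha>" .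
    define e where "e = (1 - 2 * \<epsilon>) / (2 * (1 - \<epsilon>))"
    have e: "e = (2 * p - 1) / (2 * p)" "0 \<le> e" "e \<le> 1 / 2" using \<epsilon> by (auto simp: e_def p_def field_simps)
    have l0: "real l > 0" using l by simp
    have "ln (ln (real n)) powr e \<le> (176 * (real l)\<^sup>2) powr e"
    proof (rule powr_mono2)
      have n16: "16 \<le> n" using mn par(3) by simp
      note lnb = ln_ln_card_le[OF l n16, folded m_def, folded L_def, OF n(2)]
      show "0 \<le> ln (ln (real n))" "ln (ln (real n)) \<le> 176 * (real l)\<^sup>2" by (rule lnb)+
    qed (rule e)
    also have "\<dots> = 176 powr e * l powr (2 * e)"
      using l0 by (simp add: powr_mult powr_powr flip: powr_numeral)
    also have "\<dots> \<le> 14 * l powr (2 * e)"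
    proof (rule mult_right_mono)
      have "176 powr e \<le> (196 :: real) powr e" using e by (intro powr_mono2) auto
      also have "\<dots> \<le> 196 powr (1 / 2)" using e by (intro powr_mono) auto
      also have "\<dots> = 14" by (simp add: powr_half_sqrt real_sqrt_unique)
      finally show "176 powr e \<le> (14 :: real)" .
    qed simp
    finally have up: "ln (ln (real n)) powr e \<le> 14 * l powr (2 * e)" .
    have "l powr (2 * e) / 2560\<^sup>2 \<le> l powr (2 * e) / 2560 powr (1 / p)"
    proof (rule divide_left_mono)
      have "2560 powr (1 / p) \<le> (2560 :: real) powr 2" using p by (intro powr_mono) (auto simp: field_simps)
      then show "2560 powr (1 / p) \<le> (2560\<^sup>2 :: real)" by simp
    qed auto
    also have "\<dots> = (l powr (2 * p - 1) / 2560) powr (1 / p)"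
    proof -
      have "2 * e = (2 * p - 1) * (1 / p)" using p by (simp add: e(1) field_simps)
      then show ?thesis using l0 by (simp add: powr_divide powr_powr)
    qed
    also have "\<dots> \<le> \<alpha>" by (rule low)
    finally have "l powr (2 * e) / 2560\<^sup>2 \<le> \<alpha>" .
    then show ?thesis using up unfolding e_def[symmetric] by (simp add: field_simps)
  qed
  have "l \<le> n" using mn par(4) by linarith
  then have "N \<le> n" by (simp add: l_def)
  moreover have "sketchable 4 20000000 {..<n} d"
    unfolding d_def using sketchable_good[of "{..<n}" b] b L32 by auto
  ultimately show "\<exists>n\<ge>N. \<exists>(M :: nat set) (d :: nat \<Rightarrow> nat \<Rightarrow> real).
        finite M \<and> card M = n \<and> Metric_space M d \<and> sketchable 4 20000000 M d \<and>
        (\<forall>\<epsilon> \<alpha>. 0 < \<epsilon> \<and> \<epsilon> < 1 / 2 \<and> \<alpha> \<ge> 1 \<and>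
           (\<exists>f. f \<in> M \<rightarrow> ell (1 - \<epsilon>) \<and>
              (\<forall>x\<in>M. \<forall>y\<in>M. d x y \<le> ell_qnorm (1 - \<epsilon>) (f x - f y) \<and>
                                ell_qnorm (1 - \<epsilon>) (f x - f y) \<le> \<alpha> * d x y))
           \<longrightarrow> \<alpha> \<ge> 1 / (14 * 2560\<^sup>2) * ln (ln (real n)) powr ((1 - 2 * \<epsilon>) / (2 * (1 - \<epsilon>))))"
    using met dist
    by (intro exI[of _ n] exI[of _ "{..<n}"] exI[of _ d] conjI allI impI) (auto simp: d_def)
qed auto

end
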